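(* There exists a constant $C_6 > 0$ such that for every locally integrable $V\ge 0$ on $\mathbb{R}^2$, $$N_-(\mathcal{E}_V) \le C_6\left(\int_{\mathbb{R}^2}V(x)\ln(2+|x|)\,dx + \int_{\mathbb{R}^2}V_*(|x|)\ln_+\frac{1}{|x|}\,dx\right) + 1 .$$
   Context: For a Hermitian form $\mathbf{q}$ with domain $\mathrm{Dom}(\mathbf{q})$ in a Hilbert space, $N_-(\mathbf{q}) := \sup\{\dim\mathcal{L} : \mathcal{L}\subseteq \mathrm{Dom}(\mathbf{q}) \text{ a linear subspace},\ \mathbf{q}[u]<0\ \forall u\in\mathcal{L}\setminus\{0\}\}\in\{0,1,2,\dots\}\cup\{\infty\}$. For locally integrable $V\ge 0$ on $\mathbb{R}^2$, $\mathcal{E}_V[w] := \int_{\mathbb{R}^2}|\nabla w(x)|^2dx - \int_{\mathbb{R}^2}V(x)|w(x)|^2dx$ with $\mathrm{Dom}(\mathcal{E}_V) := W^1_2(\mathbb{R}^2)\cap L_2(\mathbb{R}^2,V(x)dx)$, where $W^1_2$ is the Sobolev space of $L_2$ functions with $L_2$ first-order weak derivatives. $V_*:\mathbb{R}_+\to[0,+\infty]$ is the non-increasing spherical rearrangement of $V$: it is non-increasing, continuous from the right, and $|\{x\in\mathbb{R}^2 : V_*(|x|)>s\}| = |\{x\in\mathbb{R}^2 : V(x)>s\}|$ for all $s>0$, where $|E|$ is the two-dimensional Lebesgue measure of $E$. Also $\ln_+ t := \max\{0,\ln t\}$. *)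

theory Defs
  imports "HOL-Analysis.Analysis"
begin

section \<open>Dimension with value in the extended naturals, and the index \<open>N_minus\<close>\<close>

context vector_space
begin

text \<open>The library's \<^const>\<open>dim\<close> is a natural number and is \<open>0\<close> on subspaces of infinite
  dimension.\<close>

definition edim :: "'b set \<Rightarrow> enat" where
  "edim L = (if \<exists>B. finite B \<and> L \<subseteq> span B then enat (dim L) else \<infinity>)"

text \<open>A form is given by its domain \<open>D\<close> and its quadratic form \<open>q\<close>.\<close>

definition N_minus :: "'b set \<Rightarrow> ('b \<Rightarrow> real) \<Rightarrow> enat" where
  "N_minus D q = (SUP L\<in>{L. subspace L \<and> L \<subseteq> D \<and> (\<forall>u\<in>L - {0}. q u < 0)}. local.edim L)"

end


section \<open>The space \<open>L\<^sub>2(\<real>\<^sup>2)\<close> of complex functions modulo null functions\<close>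

definition sq_integrable :: "(real^2 \<Rightarrow> complex) \<Rightarrow> bool" where
  "sq_integrable f \<longleftrightarrow>
     f \<in> borel_measurable lebesgue \<and> integrable lebesgue (\<lambda>x. (norm (f x))\<^sup>2)"

definition l2_rel :: "(real^2 \<Rightarrow> complex) \<Rightarrow> (real^2 \<Rightarrow> complex) \<Rightarrow> bool" where
  "l2_rel f g \<longleftrightarrow> sq_integrable f \<and> sq_integrable g \<and> (AE x in lebesgue. f x = g x)"

lemma sq_integrable_zero: "sq_integrable (\<lambda>x. 0)"
  by (simp add: sq_integrable_def)

lemma sq_integrable_add:
  assumes "sq_integrable f" "sq_integrable g"
  shows "sq_integrable (\<lambda>x. f x + g x)"
proof -
  have [measurable]: "f \<in> borel_measurable lebesgue" "g \<in> borel_measurable lebesgue"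
    using assms by (auto simp: sq_integrable_def)
  have "integrable lebesgue (\<lambda>x. 2 * (norm (f x))\<^sup>2 + 2 * (norm (g x))\<^sup>2)"
    using assms by (auto simp: sq_integrable_def)
  moreover have "(norm (f x + g x))\<^sup>2 \<le> 2 * (norm (f x))\<^sup>2 + 2 * (norm (g x))\<^sup>2" for x
  proof -
    have "(norm (f x + g x))\<^sup>2 \<le> (norm (f x) + norm (g x))\<^sup>2"
      by (intro power_mono norm_triangle_ineq) auto
    also have "\<dots> \<le> 2 * (norm (f x))\<^sup>2 + 2 * (norm (g x))\<^sup>2"
      using sum_squares_bound[of "norm (f x)" "norm (g x)"] by (simp add: power2_sum)
    finally show ?thesis .
  qed
  ultimately have "integrable lebesgue (\<lambda>x. (norm (f x + g x))\<^sup>2)"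
    by (elim Bochner_Integration.integrable_bound) (auto intro!: AE_I2)
  then show ?thesis
    by (simp add: sq_integrable_def)
qed

lemma sq_integrable_scale:
  assumes "sq_integrable f"
  shows "sq_integrable (\<lambda>x. c * f x)"
  using assms by (auto simp: sq_integrable_def norm_mult power_mult_distrib)

quotient_type l2 = "real^2 \<Rightarrow> complex" / partial: l2_rel
proof (rule part_equivpI)
  show "\<exists>f. l2_rel f f"
    using sq_integrable_zero by (auto simp: l2_rel_def)
  show "symp l2_rel"
    by (auto simp: symp_def l2_rel_def eq_commute)
  show "transp l2_rel"
    unfolding transp_def l2_rel_def by (auto elim: AE_mp)
qed

instantiation l2 :: ab_group_add
begin

lift_definition zero_l2 :: l2 is "\<lambda>x. 0"
  by (simp add: l2_rel_def sq_integrable_zero)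

lift_definition plus_l2 :: "l2 \<Rightarrow> l2 \<Rightarrow> l2" is "\<lambda>f g x. f x + g x"
  by (auto simp: l2_rel_def intro: sq_integrable_add elim: AE_mp)

lift_definition uminus_l2 :: "l2 \<Rightarrow> l2" is "\<lambda>f x. - f x"
  by (auto simp: l2_rel_def sq_integrable_def)

definition minus_l2 :: "l2 \<Rightarrow> l2 \<Rightarrow> l2" where
  "minus_l2 u v = u + - v"

instance
proof
  fix u v w :: l2
  show "u + v + w = u + (v + w)"
    by transfer (auto simp: l2_rel_def add.assoc intro!: sq_integrable_add)
  show "u + v = v + u"
    by transfer (auto simp: l2_rel_def add.commute intro!: sq_integrable_add)
  show "0 + u = u"
    by transfer (auto simp: l2_rel_def)
  show "- u + u = 0"
    by transfer (auto simp: l2_rel_def sq_integrable_zero)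
  show "u - v = u + - v"
    by (rule minus_l2_def)
qed

end

lift_definition scale_l2 :: "complex \<Rightarrow> l2 \<Rightarrow> l2" is "\<lambda>c f x. c * f x"
  by (auto simp: l2_rel_def intro: sq_integrable_scale elim: AE_mp)

global_interpretation l2: vector_space scale_l2
proof
  fix a b :: complex and u v :: l2
  show "scale_l2 a (u + v) = scale_l2 a u + scale_l2 a v"
    by transfer
      (auto simp: l2_rel_def distrib_left intro!: sq_integrable_add sq_integrable_scale)
  show "scale_l2 (a + b) u = scale_l2 a u + scale_l2 b u"
    by transfer
      (auto simp: l2_rel_def distrib_right intro!: sq_integrable_add sq_integrable_scale)
  show "scale_l2 a (scale_l2 b u) = scale_l2 (a * b) u"
    by transfer (auto simp: l2_rel_def mult.assoc intro!: sq_integrable_scale)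
  show "scale_l2 1 u = u"
    by transfer (auto simp: l2_rel_def)
qed


section \<open>Weak derivatives and the Sobolev space \<open>W\<^sup>1\<^sub>2(\<real>\<^sup>2)\<close>\<close>

definition pderiv_at :: "2 \<Rightarrow> (real^2 \<Rightarrow> complex) \<Rightarrow> real^2 \<Rightarrow> complex" where
  "pderiv_at i f x = frechet_derivative f (at x) (axis i 1)"

primrec C_k :: "nat \<Rightarrow> (real^2 \<Rightarrow> complex) \<Rightarrow> bool" where
  "C_k 0 f \<longleftrightarrow> continuous_on UNIV f"
| "C_k (Suc k) f \<longleftrightarrow> (\<forall>x. f differentiable (at x)) \<and> (\<forall>i. C_k k (pderiv_at i f))"

definition test_function :: "(real^2 \<Rightarrow> complex) \<Rightarrow> bool" where
  "test_function \<phi> \<longleftrightarrow> (\<forall>k. C_k k \<phi>) \<and> compact (closure {x. \<phi> x \<noteq> 0})"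

text \<open>\<open>g\<close> is the weak partial derivative of \<open>u\<close> in direction \<open>i\<close>. Here \<^const>\<open>rep_l2\<close>
  picks a representative of a class; the integrals do not depend on it.\<close>

definition has_weak_pderiv :: "2 \<Rightarrow> l2 \<Rightarrow> l2 \<Rightarrow> bool" where
  "has_weak_pderiv i u g \<longleftrightarrow> (\<forall>\<phi>. test_function \<phi> \<longrightarrow>
     (\<integral>x. rep_l2 u x * pderiv_at i \<phi> x \<partial>lebesgue) = - (\<integral>x. rep_l2 g x * \<phi> x \<partial>lebesgue))"

definition weak_pderiv :: "2 \<Rightarrow> l2 \<Rightarrow> l2" where
  "weak_pderiv i u = (THE g. has_weak_pderiv i u g)"

definition W12 :: "l2 set" where
  "W12 = {u. \<forall>i. \<exists>g. has_weak_pderiv i u g}"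


section \<open>The form \<open>\<E>\<^sub>V\<close>\<close>

definition locally_integrable :: "(real^2 \<Rightarrow> real) \<Rightarrow> bool" where
  "locally_integrable V \<longleftrightarrow> (\<forall>K. compact K \<longrightarrow> V absolutely_integrable_on K)"

definition dom_E :: "(real^2 \<Rightarrow> real) \<Rightarrow> l2 set" where
  "dom_E V = W12 \<inter> {w. integrable lebesgue (\<lambda>x. V x * (norm (rep_l2 w x))\<^sup>2)}"

definition form_E :: "(real^2 \<Rightarrow> real) \<Rightarrow> l2 \<Rightarrow> real" where
  "form_E V w =
     (\<integral>x. (\<Sum>i\<in>UNIV. (norm (rep_l2 (weak_pderiv i w) x))\<^sup>2) \<partial>lebesgue)
     - (\<integral>x. V x * (norm (rep_l2 w x))\<^sup>2 \<partial>lebesgue)"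


section \<open>The non-increasing spherical rearrangement\<close>

text \<open>Only the values of \<open>Vs\<close> on \<open>(0, \<infinity>)\<close> matter; they are determined by these conditions.\<close>

definition is_rearrangement :: "(real^2 \<Rightarrow> real) \<Rightarrow> (real \<Rightarrow> ennreal) \<Rightarrow> bool" where
  "is_rearrangement V Vs \<longleftrightarrow>
     (\<forall>r t. 0 < r \<and> r \<le> t \<longrightarrow> Vs t \<le> Vs r) \<and>
     (\<forall>r>0. continuous (at_right r) Vs) \<and>
     (\<forall>s>0. emeasure lebesgue {x::real^2. Vs (norm x) > ennreal s}
            = emeasure lebesgue {x. V x > s})"

lemma locally_integrable_measurable:
  assumes "locally_integrable V"
  shows "V \<in> borel_measurable lebesgue"
proof -
  have "(\<lambda>x. indicator (cball 0 (real n)) x *\<^sub>R V x) \<in> borel_measurable lebesgue" for n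
    using assms unfolding locally_integrable_def set_integrable_def
    by (blast intro: borel_measurable_integrable compact_cball)
  moreover have "(\<lambda>n. indicator (cball 0 (real n)) x *\<^sub>R V x) \<longlonglongrightarrow> V x" for x
  proof (rule tendsto_eventually)
    obtain N where "norm x \<le> real N" using real_arch_simple by blast
    then show "\<forall>\<^sub>F n in sequentially. indicator (cball 0 (real n)) x *\<^sub>R V x = V x"
      by (intro eventually_sequentiallyI[of N]) (auto simp: indicator_def)
  qed
  ultimately show ?thesis
    by (rule borel_measurable_LIMSEQ_metric)
qed

lemma emeasure_disc: "r \<ge> 0 \<Longrightarrow> emeasure lebesgue (ball (0::real^2) r) = ennreal (pi * r\<^sup>2)"
  using emeasure_ball[of r "0::real^2"] by (simp add: unit_ball_vol_2)

lemma ex_rearrangement: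
  assumes "locally_integrable V"
  shows "\<exists>Vs. is_rearrangement V Vs"
proof -
  define \<mu> where "\<mu> s = emeasure lebesgue {x. V x > s}" for s :: real
  define Vs where "Vs r = Sup (ennreal ` {s. s > 0 \<and> ennreal (pi * r\<^sup>2) < \<mu> s})" for r :: real
  have [measurable]: "V \<in> borel_measurable lebesgue"
    by (rule locally_integrable_measurable[OF assms])
  have meas: "{x. V x > s} \<in> sets lebesgue" for s
    using borel_measurable_iff_greater[of V lebesgue] by auto
  have less: "ennreal a < ennreal s \<longleftrightarrow> a < s" if "a > 0" for a s
    using that by (auto simp: ennreal_less_iff)
  have key: "Vs r > ennreal s \<longleftrightarrow> ennreal (pi * r\<^sup>2) < \<mu> s" if "s > 0" for r s
  proof
    assume "Vs r > ennreal s"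
    then obtain t where t: "t > 0" "ennreal (pi * r\<^sup>2) < \<mu> t" "ennreal s < ennreal t"
      unfolding Vs_def less_SUP_iff by blast
    then have "s < t"
      using less[OF \<open>s > 0\<close>] by blast
    then have "\<mu> t \<le> \<mu> s"
      unfolding \<mu>_def by (intro emeasure_mono meas) auto
    with t(2) show "ennreal (pi * r\<^sup>2) < \<mu> s" by (rule less_le_trans)
  next
    assume *: "ennreal (pi * r\<^sup>2) < \<mu> s"
    have "(\<Union>n. {x. V x > s + inverse (real (Suc n))}) = {x. V x > s}"
    proof (intro equalityI subsetI)
      fix x assume "x \<in> {x. V x > s}"
      then have "0 < V x - s" by simp
      from reals_Archimedean[OF this] show "x \<in> (\<Union>n. {x. V x > s + inverse (real (Suc n))})"
        by (auto simp: algebra_simps)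
    next
      fix x assume "x \<in> (\<Union>n. {x. V x > s + inverse (real (Suc n))})"
      then obtain n where n: "V x > s + inverse (real (Suc n))" by auto
      have "inverse (real (Suc n)) > 0" by simp
      with n have "s < V x" by linarith
      then show "x \<in> {x. V x > s}" by simp
    qed
    moreover have "(SUP n. \<mu> (s + inverse (real (Suc n)))) = emeasure lebesgue (\<Union>n. {x. V x > s + inverse (real (Suc n))})"
      unfolding \<mu>_def
    proof (rule SUP_emeasure_incseq)
      show "range (\<lambda>n. {x. V x > s + inverse (real (Suc n))}) \<subseteq> sets lebesgue"
        using meas by auto
      show "incseq (\<lambda>n. {x. V x > s + inverse (real (Suc n))})"
      proof (intro incseq_SucI subsetI)
        fix n x assume "x \<in> {x. V x > s + inverse (real (Suc n))}"
        then have "V x > s + inverse (real (Suc n))" by blast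
        moreover have "inverse (real (Suc (Suc n))) \<le> inverse (real (Suc n))"
          by (intro le_imp_inverse_le) auto
        ultimately have "V x > s + inverse (real (Suc (Suc n)))" by linarith
        then show "x \<in> {x. V x > s + inverse (real (Suc (Suc n)))}" by blast
      qed
    qed
    ultimately have "ennreal (pi * r\<^sup>2) < (SUP n. \<mu> (s + inverse (real (Suc n))))"
      using * by (simp add: \<mu>_def)
    then obtain n where n: "ennreal (pi * r\<^sup>2) < \<mu> (s + inverse (real (Suc n)))"
      unfolding less_SUP_iff by blast
    have pos: "inverse (real (Suc n)) > 0" by simp
    have "ennreal s < ennreal (s + inverse (real (Suc n)))"
      using less[OF that] pos by (metis less_add_same_cancel1)
    also have "\<dots> \<le> Vs r"
      unfolding Vs_def using n add_pos_pos[OF that pos] by (intro SUP_upper) blast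
    finally show "Vs r > ennreal s" .
  qed
  have mono: "Vs t \<le> Vs r" if "0 < r" "r \<le> t" for r t
  proof -
    have "ennreal (pi * r\<^sup>2) \<le> ennreal (pi * t\<^sup>2)"
      using that by (intro ennreal_leI mult_left_mono power_mono) auto
    then show ?thesis
      unfolding Vs_def by (intro SUP_subset_mono) (blast intro: le_less_trans)+
  qed
  have cont: "continuous (at_right r) Vs" if "r > 0" for r
    unfolding continuous_within
  proof (rule order_tendstoI)
    fix a assume "a < Vs r"
    then obtain s where s: "s > 0" "ennreal (pi * r\<^sup>2) < \<mu> s" "a < ennreal s"
      unfolding Vs_def less_SUP_iff by blast
    have "((\<lambda>t. ennreal (pi * t\<^sup>2)) \<longlongrightarrow> ennreal (pi * r\<^sup>2)) (at_right r)"
      by (intro tendsto_intros)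
    then have "\<forall>\<^sub>F t in at_right r. ennreal (pi * t\<^sup>2) < \<mu> s"
      using s by (rule_tac order_tendstoD)
    then show "\<forall>\<^sub>F t in at_right r. a < Vs t"
    proof eventually_elim
      case (elim t)
      then have "ennreal s \<le> Vs t"
        unfolding Vs_def using s by (intro SUP_upper) auto
      with s show ?case by simp
    qed
  next
    fix a assume a: "Vs r < a"
    show "\<forall>\<^sub>F t in at_right r. Vs t < a"
      using eventually_at_right_less[of r]
    proof eventually_elim
      case (elim t)
      then show ?case using mono[of r t] that a by (meson le_less_trans less_imp_le)
    qed
  qed
  have equi: "emeasure lebesgue {x::real^2. Vs (norm x) > ennreal s} = \<mu> s" if "s > 0" for s
  proof (cases "\<mu> s")
    case (real m)
    define R where "R = sqrt (m / pi)"
    have R: "R \<ge> 0" "pi * R\<^sup>2 = m" using real by (auto simp: R_def)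
    have "ennreal (pi * (norm x)\<^sup>2) < \<mu> s \<longleftrightarrow> norm x < R" for x :: "real^2"
    proof -
      have "ennreal (pi * (norm x)\<^sup>2) < \<mu> s \<longleftrightarrow> pi * (norm x)\<^sup>2 < pi * R\<^sup>2"
        using real R by (simp add: ennreal_less_iff)
      also have "\<dots> \<longleftrightarrow> norm x < R"
        using power_mono_iff[OF R(1) norm_ge_zero[of x], of 2]
        by (simp add: mult_le_cancel_left_pos[OF pi_gt_zero] flip: not_le)
      finally show ?thesis .
    qed
    then have "{x::real^2. Vs (norm x) > ennreal s} = ball 0 R"
      by (simp only: key[OF that] set_eq_iff mem_Collect_eq mem_ball_0 simp_thms)
    then show ?thesis
      by (simp only: emeasure_disc[OF R(1)] R(2) real)
  next
    case top
    then have "{x::real^2. Vs (norm x) > ennreal s} = UNIV"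
      by (simp add: key[OF that])
    then show ?thesis using top by simp
  qed
  show ?thesis
    unfolding is_rearrangement_def
    by (rule exI[of _ Vs]) (use mono cont equi in \<open>auto simp: \<mu>_def\<close>)
qed


section \<open>Positive part of the logarithm\<close>

definition ln_plus :: "real \<Rightarrow> real" where
  "ln_plus t = max 0 (ln t)"

end

theory Submission
  imports Defs
begin

text \<open>
  It suffices to find at most \<open>1 + C R\<close> linear functionals, \<open>R\<close> being the sum of the two
  integrals, whose common kernel lies in \<open>{u. \<integral>V|u|\<^sup>2 \<le> \<integral>|\<nabla>u|\<^sup>2}\<close>: a negative subspace meets that kernel
  only in \<open>0\<close>. The functionals are means of \<open>u\<close> over squares of a triadic tree.
  The tree starts from the whole plane and treats the complements of large central squares as
  squares around infinity; weighted by \<open>9\<^sup>-\<^sup>2\<^sup>K\<close> on the \<open>K\<close>-th shell all cells of level \<open>n\<close> have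
  area about \<open>9\<^sup>-\<^sup>n\<close>, as on a sphere. Telescoping means along the tree bounds \<open>|u(x) - mean|\<close> by a
  dyadic Riesz potential of \<open>|\<nabla>u|\<close>, whose square is estimated against \<open>V\<close> by a Schur test: the kernel
  is the number of common cells of \<open>x\<close> and \<open>y\<close>, that is, a logarithm of the distance. The resulting quantity
  is dominated by a superadditive functional of \<open>L log L\<close> type which on the whole plane is at most
  \<open>12 R\<close>. A stopping-time argument cuts the tree where this functional exceeds a threshold;
  chains of cells with a single heavy child are skipped by passing to the annulus between two
  cells, and superadditivity bounds the number of cuts.
\<close>

section \<open>The triadic tree\<close>

text \<open>The Dirichlet integral in the plane is conformally invariant, so infinity can be treated
  like a point. Inversion scales lengths on shell \<open>K\<close> by about 9^-K; a square of side
  3^(2K-n) there matches one of side about 3^-n near that point, which dictates the sides of the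
  cells. With conformal factor \<open>weight\<close>, the gradient becomes \<open>f / weight\<close>
  and the area element \<open>weight\<close>^2: hence the product \<open>f * weight\<close> in
  \<open>wmass\<close>, while \<open>energy\<close> carries no weight.

  Two obstacles shape the counting. One functional for each cell of a long chain with a single heavy
  child could not be paid for by the integrals. But an annulus that skips generations still feels
  the gradient in its hole through the coarse levels, and charging that energy again at each of many
  nested annuli would be too much. So the inequality carried through the recursion keeps a slack
  term, \<open>flux\<close>.

  The \<open>+ 1\<close> of the theorem is the functional spent when the whole plane is light. The
  constant is 12 * 30 * 10 * 54^3: comparison with the two integrals, counting, and the inverse of
  \<open>threshold\<close>.\<close>

definition idx :: "int \<Rightarrow> real \<Rightarrow> int" where
  "idx j t = \<lfloor>t / 3 powi j + 1/2\<rfloor>"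

definition shell :: "real^2 \<Rightarrow> nat" where
  "shell x = (LEAST k. \<forall>i. idx (int k) (x$i) = 0)"

text \<open>The cell of level \<open>n\<close> around \<open>x\<close> is a square of side \<open>3\<^sup>2\<^sup>K\<^sup>-\<^sup>n\<close> if \<open>x\<close> lies in a shell \<open>K < n\<close>;
  otherwise it is the complement of the central square of side \<open>3\<^sup>n\<^sup>-\<^sup>1\<close>.\<close>

definition cell :: "nat \<Rightarrow> real^2 \<Rightarrow> (real^2) set" where
  "cell n x = (if shell x < n
     then {y. \<forall>i. idx (2 * int (shell x) - int n) (y$i) = idx (2 * int (shell x) - int n) (x$i)}
     else {y. n \<le> shell y})"

text \<open>The half in \<open>idx\<close> centres the intervals at the multiples of 3^j. Since 3 is
  odd, such centred grids refine one another, interval p consisting of 3p-1, 3p and 3p+1 one level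
  below; and the intervals of index 0 exhaust the line, which a grid with a vertex at the origin
  would not achieve.\<close>

lemma idx_plus1: "idx (j + 1) t = (idx j t + 1) div 3"
proof -
  have "t / 3 powi (j+1) + 1/2 = (t / 3 powi j + 1/2 + 1) / of_nat 3"
    by (simp add: power_int_add add_divide_distrib)
  then have "idx (j+1) t = \<lfloor>t / 3 powi j + 1/2 + 1\<rfloor> div int 3"
    unfolding idx_def using floor_divide_real_eq_div[of 3 "t / 3 powi j + 1/2 + 1"] by (simp only:) simp
  also have "\<lfloor>t / 3 powi j + 1/2 + 1\<rfloor> = idx j t + 1"
    unfolding idx_def by (metis floor_add_int of_int_1)
  finally show ?thesis by simp
qed

lemma idx_eq_iff:
  "idx j t = p \<longleftrightarrow> 3 powi j * (of_int p - 1/2) \<le> t \<and> t < 3 powi j * (of_int p + 1/2)"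
proof -
  have "(0::real) < 3 powi j" by simp
  then show ?thesis unfolding idx_def floor_eq_iff by (auto simp: field_simps)
qed

lemma idx_coarser:
  assumes "idx j s = idx j t" "j \<le> j'"
  shows "idx j' s = idx j' t"
proof -
  have "idx (j + int k) s = idx (j + int k) t" for k
  proof (induction k)
    case (Suc k)
    have "j + int (Suc k) = (j + int k) + 1" by simp
    with Suc show ?case by (simp only: idx_plus1)
  qed (use assms in simp)
  from this[of "nat (j' - j)"] assms(2) show ?thesis by simp
qed

lemma idx_zero_mono: "idx j t = 0 \<Longrightarrow> j \<le> j' \<Longrightarrow> idx j' t = 0"
  using idx_coarser[of j t 0 j'] by (simp add: idx_def)

lemma ex_idx_zero: "\<exists>k::nat. idx (int k) t = 0"
proof -
  obtain k where "2 * \<bar>t\<bar> < 3 ^ k" using real_arch_pow[of 3 "2*\<bar>t\<bar>"] by auto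
  then have "idx (int k) t = 0" unfolding idx_eq_iff by (simp add: abs_if split: if_splits)
  then show ?thesis by blast
qed

lemma shell_le_iff: "shell x \<le> k \<longleftrightarrow> (\<forall>i. idx (int k) (x$i) = 0)"
proof -
  have "\<exists>k::nat. \<forall>i::2. idx (int k) (x$i) = 0"
  proof -
    obtain k1 k2 where "idx (int k1) (x$1) = 0" "idx (int k2) (x$2) = 0"
      using ex_idx_zero by blast
    then have "\<forall>i::2. idx (int (max k1 k2)) (x$i) = 0"
      by (auto simp: forall_2 intro: idx_zero_mono)
    then show ?thesis by blast
  qed
  then have "\<forall>i. idx (int (shell x)) (x$i) = 0"
    unfolding shell_def by (rule LeastI_ex)
  then show ?thesis
    by (auto simp: shell_def intro: idx_zero_mono Least_le)
qed

text \<open>A grid strictly finer than the outer central square of a shell also refines the inner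
  one, so its squares cross neither boundary of the shell.\<close>

lemma shell_eqI:
  assumes "\<And>i. idx j (y$i) = idx j (x$i)" "j < int (shell x)"
  shows "shell y = shell x"
proof -
  have *: "\<forall>i. idx (int k) (y$i) = idx (int k) (x$i)" if "j \<le> int k" for k
    using assms(1) that by (auto intro: idx_coarser)
  have "shell y \<le> shell x"
    using *[of "shell x"] assms(2) shell_le_iff[of x "shell x"] by (simp add: shell_le_iff)
  moreover have "shell x \<le> shell y"
  proof (rule ccontr)
    assume "\<not> shell x \<le> shell y"
    then have 1: "shell y \<le> shell x - 1" and 2: "\<not> shell x \<le> shell x - 1" by auto
    from 2 have "j \<le> int (shell x - 1)" using assms(2) by auto
    with *[of "shell x - 1"] 1 2 show False unfolding shell_le_iff by auto
  qed
  ultimately show ?thesis by simp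
qed

text \<open>On a shell \<open>K < n\<close> the exponent 2K - n is below K, so the grid used there
  respects shells; only the unbounded cell mixes several of them.\<close>

lemma cell_shell:
  assumes "y \<in> cell n x" "shell x < n \<or> shell y < n"
  shows "shell y = shell x"
proof -
  have "shell x < n" using assms by (auto simp: cell_def split: if_splits)
  show ?thesis
  proof (cases "shell x = 0")
    case False
    then show ?thesis
      using assms \<open>shell x < n\<close> by (intro shell_eqI[of "2 * int (shell x) - int n"]) (auto simp: cell_def)
  next
    case True
    have "idx (2 * int (shell x) - int n) (y$i) = idx (2 * int (shell x) - int n) (x$i)" for i
      using assms \<open>shell x < n\<close> by (auto simp: cell_def)
    then have "idx 0 (y$i) = idx 0 (x$i)" for i
      using True by (intro idx_coarser[of "2 * int (shell x) - int n" _ _ 0]) auto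
    then have "shell y \<le> 0" using True shell_le_iff[of x 0] shell_le_iff[of y 0] by auto
    with True show ?thesis by (simp del: shell_le_iff)
  qed
qed

lemma cell_refl: "x \<in> cell n x" by (simp add: cell_def)

lemma cell_eq: "y \<in> cell n x \<Longrightarrow> cell n y = cell n x"
  using cell_shell[of y n x] by (cases "shell x < n") (auto simp: cell_def)

lemma cell_Suc_subset: "cell (Suc n) x \<subseteq> cell n x"
proof
  fix y assume y: "y \<in> cell (Suc n) x"
  show "y \<in> cell n x"
  proof (cases "shell x < n")
    case True
    have "idx (2 * int (shell x) - int n - 1) (y$i) = idx (2 * int (shell x) - int n - 1) (x$i)" for i
      using y True by (auto simp: cell_def algebra_simps)
    then have "idx (2 * int (shell x) - int n) (y$i) = idx (2 * int (shell x) - int n) (x$i)" for i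
      by (intro idx_coarser[of "2 * int (shell x) - int n - 1" _ _ "2 * int (shell x) - int n"]) auto
    with True show ?thesis by (auto simp: cell_def)
  next
    case False
    then show ?thesis
      using y cell_shell[OF y] by (cases "shell x = n") (auto simp: cell_def)
  qed
qed

lemma cell_antimono: "n \<le> m \<Longrightarrow> cell m x \<subseteq> cell n x"
  by (induction m rule: dec_induct) (use cell_Suc_subset in blast)+

lemma cell_0: "cell 0 x = UNIV" by (simp add: cell_def)

section \<open>Measure and measurability of squares and cells\<close>

definition square :: "int \<Rightarrow> int^2 \<Rightarrow> (real^2) set" where
  "square j p = {y. \<forall>i. idx j (y$i) = p$i}"

text \<open>Half-open squares are measured by squeezing them between an open and a closed box of
  equal area.\<close>

lemma square_lower_upper:
  fixes p :: "int^2" and j :: int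
  defines "a \<equiv> (\<chi> i. 3 powi j * (of_int (p$i) - 1/2)) :: real^2"
    and "b \<equiv> (\<chi> i. 3 powi j * (of_int (p$i) + 1/2)) :: real^2"
  shows "box a b \<subseteq> square j p" "square j p \<subseteq> cbox a b"
    "emeasure lborel (box a b) = ennreal (9 powi j)" "emeasure lborel (cbox a b) = ennreal (9 powi j)"
proof -
  show "box a b \<subseteq> square j p" "square j p \<subseteq> cbox a b"
    unfolding a_def b_def square_def idx_eq_iff subset_iff mem_box_cart mem_Collect_eq vec_lambda_beta
    by (meson less_imp_le)+
  have le: "a \<bullet> i \<le> b \<bullet> i" and diff: "(b - a) \<bullet> i = 3 powi j" if "i \<in> Basis" for i
    using that by (auto simp: Basis_vec_def inner_axis a_def b_def algebra_simps)
  have "(\<Prod>i\<in>Basis. (b - a) \<bullet> i) = (3 powi j) ^ 2"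
    using diff by simp
  also have "\<dots> = (9 powi j :: real)"
    by (simp add: power2_eq_square flip: power_int_mult_distrib)
  finally have "(\<Prod>i\<in>Basis. (b - a) \<bullet> i) = 9 powi j" .
  then show "emeasure lborel (box a b) = ennreal (9 powi j)" "emeasure lborel (cbox a b) = ennreal (9 powi j)"
    using le by (auto simp: emeasure_lborel_box_eq emeasure_lborel_cbox_eq)
qed

lemma idx_measurable [measurable]: "idx j \<in> borel \<rightarrow>\<^sub>M count_space UNIV"
  unfolding idx_def by measurable

lemma square_sets: "square j p \<in> sets borel"
proof -
  have "square j p = {y. idx j (y$1) = p$1} \<inter> {y. idx j (y$2) = p$2}"
    by (auto simp: square_def forall_2)
  moreover have "{y. idx j (y$i) = c} = (\<lambda>y. y$i) -` {t. idx j t = c} \<inter> space borel" for i :: 2 and c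
    by auto
  moreover have "{t. idx j t = c} \<in> sets borel" for c
    using measurable_sets[OF idx_measurable, of "{c}" j] by (auto simp: vimage_def)
  moreover have "(\<lambda>y. y$i) \<in> borel_measurable borel" for i :: 2
    by (intro borel_measurable_continuous_onI continuous_intros)
  ultimately show ?thesis by (metis measurable_sets sets.Int)
qed

lemma emeasure_square: "emeasure lebesgue (square j p) = ennreal (9 powi j)"
proof (rule antisym)
  let ?a = "(\<chi> i. 3 powi j * (of_int (p$i) - 1/2)) :: real^2"
  let ?b = "(\<chi> i. 3 powi j * (of_int (p$i) + 1/2)) :: real^2"
  have eq: "emeasure lebesgue (square j p) = emeasure lborel (square j p)"
    using square_sets by simp
  show "emeasure lebesgue (square j p) \<le> ennreal (9 powi j)"
    unfolding eq square_lower_upper(4)[of j p, symmetric]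
    by (intro emeasure_mono square_lower_upper) auto
  show "ennreal (9 powi j) \<le> emeasure lebesgue (square j p)"
    unfolding eq square_lower_upper(3)[of j p, symmetric]
    by (intro emeasure_mono square_lower_upper) (auto simp: square_sets)
qed

lemma cell_square: "shell x < n \<Longrightarrow> cell n x = square (2 * int (shell x) - int n) (\<chi> i. idx (2 * int (shell x)
    - int n) (x$i))"
  by (simp add: cell_def square_def)

lemma shell_measurable [measurable]: "shell \<in> borel \<rightarrow>\<^sub>M count_space UNIV"
proof (subst measurable_count_space_eq_countable)
  show "countable (UNIV :: nat set)" by simp
  have le: "{x. shell x \<le> k} \<in> sets borel" for k
    using square_sets[of "int k" 0] by (simp add: square_def shell_le_iff)
  have "shell -` {k} \<inter> space borel = {x. shell x \<le> k} - (if k = 0 then {} else {x. shell x \<le> k - 1})" for k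
    by (auto split: if_splits)
  moreover have "{x. shell x \<le> k} - (if k = 0 then {} else {x. shell x \<le> k - 1}) \<in> sets borel" for k
    using le[of k] le[of "k - 1"] by auto
  ultimately show "shell \<in> space borel \<rightarrow> UNIV \<and> (\<forall>a\<in>UNIV. shell -` {a} \<inter> space borel \<in> sets borel)"
    by auto
qed

lemma cell_sets: "cell n x \<in> sets borel"
proof (cases "shell x < n")
  case True then show ?thesis by (simp add: cell_square square_sets)
next
  case False
  have "{y. n \<le> shell y} = shell -` {n..} \<inter> space borel" by auto
  with False show ?thesis using measurable_sets[OF shell_measurable, of "{n..}"] by (simp add: cell_def)
qed

text \<open>For measurability in two variables: lying in a common cell is then a countable union of
  products.\<close>

lemma countable_cells: "countable (range (cell n))"
proof -
  have "range (cell n) \<subseteq> insert {y. n \<le> shell y} (case_prod (\<lambda>j (a, b). square j (\<chi> i. if i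
      = 1 then a else b)) ` UNIV)"
  proof
    fix c assume "c \<in> range (cell n)"
    then obtain x where c: "c = cell n x" by blast
    show "c \<in> insert {y. n \<le> shell y} (case_prod (\<lambda>j (a, b). square j (\<chi> i. if i = 1 then a else b)) ` UNIV)"
    proof (cases "shell x < n")
      case True
      define j where "j = 2 * int (shell x) - int n"
      have "c = (\<lambda>(j, a, b). square j (\<chi> i. if i = 1 then a else b)) (j, idx j (x$1), idx j (x$2))"
        using cell_square[OF True] by (auto simp: c j_def square_def forall_2)
      then show ?thesis by blast
    qed (simp add: c cell_def)
  qed
  then show ?thesis by (rule countable_subset) auto
qed

section \<open>A Schur test\<close>

lemma ennreal_two_mult_le: "2 * (a * b) \<le> a * a + b * (b::ennreal)"
proof (cases "a = top \<or> b = top")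
  case True
  then show ?thesis by (auto simp: ennreal_mult_eq_top_iff)
next
  case False
  then obtain r s where "a = ennreal r" "b = ennreal s" "0 \<le> r" "0 \<le> s"
    by (metis ennreal_cases)
  then show ?thesis
    using sum_squares_bound[of r s]
    by (simp add: power2_eq_square mult.assoc flip: ennreal_mult ennreal_plus ennreal_numeral)
qed

lemma ennreal_le_of_sq_le:
  fixes a b :: ennreal
  assumes "a * a \<le> b * a" "a < top"
  shows "a \<le> b"
proof (cases "a = 0")
  case False
  then show ?thesis using assms
    by (subst (asm) (2) mult.commute, subst (asm) ennreal_mult_le_mult_iff) auto
qed simp

text \<open>Duality against truncations \<open>h\<close> of the image, for which \<open>\<integral>h\<^sup>2\<close> is finite and can be cancelled.\<close>

lemma (in pair_sigma_finite) schur_test: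
  fixes k :: "'a \<Rightarrow> 'b \<Rightarrow> ennreal" and C :: ennreal
  assumes [measurable]: "case_prod k \<in> borel_measurable (M1 \<Otimes>\<^sub>M M2)" "p \<in> borel_measurable M2"
    and fin: "emeasure M1 (space M1) < top"
    and C: "\<And>x. x \<in> space M1 \<Longrightarrow> (\<integral>\<^sup>+x'. \<integral>\<^sup>+y. k x y * k x' y \<partial>M2 \<partial>M1) \<le> C"
  shows "(\<integral>\<^sup>+x. (\<integral>\<^sup>+y. p y * k x y \<partial>M2)\<^sup>2 \<partial>M1) \<le> C * (\<integral>\<^sup>+y. (p y)\<^sup>2 \<partial>M2)"
proof -
  define G where "G x = (\<integral>\<^sup>+y. p y * k x y \<partial>M2)" for x
  have [measurable]: "G \<in> borel_measurable M1" unfolding G_def by measurable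
  have trunc: "(\<integral>\<^sup>+x. (min (G x) (of_nat j))\<^sup>2 \<partial>M1) \<le> C * (\<integral>\<^sup>+y. (p y)\<^sup>2 \<partial>M2)" for j
  proof -
    define h where "h x = min (G x) (of_nat j)" for x
    have [measurable]: "h \<in> borel_measurable M1" unfolding h_def by measurable
    define X where "X = (\<integral>\<^sup>+x. (h x)\<^sup>2 \<partial>M1)"
    have "X \<le> (\<integral>\<^sup>+x. (of_nat j)\<^sup>2 \<partial>M1)"
      unfolding X_def h_def by (intro nn_integral_mono power_mono) auto
    also have "\<dots> < top"
      using fin by (simp add: ennreal_mult_less_top power_less_top_ennreal ennreal_of_nat_eq_real_of_nat)
    finally have Xfin: "X < top" .
    have "X \<le> (\<integral>\<^sup>+x. h x * G x \<partial>M1)"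
      unfolding X_def power2_eq_square by (intro nn_integral_mono mult_left_mono) (auto simp: h_def)
    also have "\<dots> = (\<integral>\<^sup>+x. \<integral>\<^sup>+y. h x * (p y * k x y) \<partial>M2 \<partial>M1)"
      unfolding G_def by (intro nn_integral_cong nn_integral_cmult[symmetric]) measurable
    also have "\<dots> = (\<integral>\<^sup>+y. \<integral>\<^sup>+x. h x * (p y * k x y) \<partial>M1 \<partial>M2)"
      by (rule Fubini'[symmetric]) measurable
    also have "\<dots> = (\<integral>\<^sup>+y. p y * (\<integral>\<^sup>+x. h x * k x y \<partial>M1) \<partial>M2)"
    proof (intro nn_integral_cong)
      fix y assume [simp]: "y \<in> space M2"
      have "(\<integral>\<^sup>+x. h x * (p y * k x y) \<partial>M1) = (\<integral>\<^sup>+x. p y * (h x * k x y) \<partial>M1)"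
        by (simp add: ac_simps)
      also have "\<dots> = p y * (\<integral>\<^sup>+x. h x * k x y \<partial>M1)"
        by (rule nn_integral_cmult) measurable
      finally show "(\<integral>\<^sup>+x. h x * (p y * k x y) \<partial>M1) = p y * (\<integral>\<^sup>+x. h x * k x y \<partial>M1)" .
    qed
    finally have "X\<^sup>2 \<le> (\<integral>\<^sup>+y. p y * (\<integral>\<^sup>+x. h x * k x y \<partial>M1) \<partial>M2)\<^sup>2"
      by (rule power_mono) simp
    also have "\<dots> \<le> (\<integral>\<^sup>+y. (p y)\<^sup>2 \<partial>M2) * (\<integral>\<^sup>+y. (\<integral>\<^sup>+x. h x * k x y \<partial>M1)\<^sup>2 \<partial>M2)"
      by (rule Cauchy_Schwarz_nn_integral) measurable
    finally have cs: "X\<^sup>2 \<le> (\<integral>\<^sup>+y. (p y)\<^sup>2 \<partial>M2) * (\<integral>\<^sup>+y. (\<integral>\<^sup>+x. h x * k x y \<partial>M1)\<^sup>2 \<partial>M2)" .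
    have "(\<integral>\<^sup>+y. (\<integral>\<^sup>+x. h x * k x y \<partial>M1)\<^sup>2 \<partial>M2) \<le> C * X"
    proof -
      define H where "H x x' = (\<integral>\<^sup>+y. k x y * k x' y \<partial>M2)" for x x'
      have [measurable]: "case_prod H \<in> borel_measurable (M1 \<Otimes>\<^sub>M M1)" unfolding H_def by measurable
      have sym: "H x x' = H x' x" for x x' unfolding H_def by (simp add: mult.commute)
      interpret P11: pair_sigma_finite M1 M1 by unfold_locales
      interpret P21: pair_sigma_finite M2 "M1 \<Otimes>\<^sub>M M1"
        by (intro pair_sigma_finite.intro M2.sigma_finite_measure_axioms sigma_finite_pair_measure
            M1.sigma_finite_measure_axioms)
      have "(\<integral>\<^sup>+y. (\<integral>\<^sup>+x. h x * k x y \<partial>M1)\<^sup>2 \<partial>M2)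
          = (\<integral>\<^sup>+y. \<integral>\<^sup>+x. \<integral>\<^sup>+x'. (h x * k x y) * (h x' * k x' y) \<partial>M1 \<partial>M1 \<partial>M2)"
        unfolding power2_eq_square
      proof (intro nn_integral_cong)
        fix y assume [simp]: "y \<in> space M2"
        have "(\<integral>\<^sup>+x. \<integral>\<^sup>+x'. (h x * k x y) * (h x' * k x' y) \<partial>M1 \<partial>M1)
           = (\<integral>\<^sup>+x. (h x * k x y) * (\<integral>\<^sup>+x'. h x' * k x' y \<partial>M1) \<partial>M1)"
          by (intro nn_integral_cong nn_integral_cmult) measurable
        also have "\<dots> = (\<integral>\<^sup>+x. h x * k x y \<partial>M1) * (\<integral>\<^sup>+x. h x * k x y \<partial>M1)"
          by (rule nn_integral_multc) measurable
        finally show "(\<integral>\<^sup>+x. h x * k x y \<partial>M1) * (\<integral>\<^sup>+x. h x * k x y \<partial>M1)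
           = (\<integral>\<^sup>+x. \<integral>\<^sup>+x'. (h x * k x y) * (h x' * k x' y) \<partial>M1 \<partial>M1)" ..
      qed
      also have "\<dots> = (\<integral>\<^sup>+x. \<integral>\<^sup>+y. \<integral>\<^sup>+x'. (h x * k x y) * (h x' * k x' y) \<partial>M1 \<partial>M2 \<partial>M1)"
        by (rule Fubini') measurable
      also have "\<dots> = (\<integral>\<^sup>+x. \<integral>\<^sup>+x'. \<integral>\<^sup>+y. (h x * k x y) * (h x' * k x' y) \<partial>M2 \<partial>M1 \<partial>M1)"
        by (intro nn_integral_cong Fubini') measurable
      also have "\<dots> = (\<integral>\<^sup>+x. \<integral>\<^sup>+x'. (h x * h x') * H x x' \<partial>M1 \<partial>M1)"
      proof (intro nn_integral_cong)
        fix x x' assume [simp]: "x \<in> space M1" "x' \<in> space M1"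
        have "(\<integral>\<^sup>+y. (h x * k x y) * (h x' * k x' y) \<partial>M2) = (\<integral>\<^sup>+y. (h x * h x') * (k x y * k x' y) \<partial>M2)"
          by (simp add: ac_simps)
        also have "\<dots> = (h x * h x') * H x x'"
          unfolding H_def by (rule nn_integral_cmult) measurable
        finally show "(\<integral>\<^sup>+y. (h x * k x y) * (h x' * k x' y) \<partial>M2) = (h x * h x') * H x x'" .
      qed
      finally have eq: "(\<integral>\<^sup>+y. (\<integral>\<^sup>+x. h x * k x y \<partial>M1)\<^sup>2 \<partial>M2) = \<dots>" .
      \<comment> \<open>\<open>H\<close> is symmetric, so 2ab \<le> a^2 + b^2 bounds the quadratic
        form in \<open>h\<close> by the row integrals of \<open>H\<close>, to which \<open>C\<close>
        applies.\<close>
      have "2 * (\<integral>\<^sup>+x. \<integral>\<^sup>+x'. (h x * h x') * H x x' \<partial>M1 \<partial>M1)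
          = (\<integral>\<^sup>+x. \<integral>\<^sup>+x'. 2 * ((h x * h x') * H x x') \<partial>M1 \<partial>M1)"
      proof -
        have "(\<integral>\<^sup>+x. \<integral>\<^sup>+x'. 2 * ((h x * h x') * H x x') \<partial>M1 \<partial>M1)
            = (\<integral>\<^sup>+x. 2 * (\<integral>\<^sup>+x'. (h x * h x') * H x x' \<partial>M1) \<partial>M1)"
          by (intro nn_integral_cong nn_integral_cmult) measurable
        also have "\<dots> = 2 * (\<integral>\<^sup>+x. \<integral>\<^sup>+x'. (h x * h x') * H x x' \<partial>M1 \<partial>M1)"
          by (rule nn_integral_cmult) measurable
        finally show ?thesis ..
      qed
      also have "\<dots> \<le> (\<integral>\<^sup>+x. \<integral>\<^sup>+x'. (h x)\<^sup>2 * H x x' + (h x')\<^sup>2 * H x x' \<partial>M1 \<partial>M1)"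
        using ennreal_two_mult_le
        by (intro nn_integral_mono) (auto simp: power2_eq_square simp flip: distrib_right mult.assoc intro!:
            mult_right_mono)
      also have "\<dots> = (\<integral>\<^sup>+x. \<integral>\<^sup>+x'. (h x)\<^sup>2 * H x x' \<partial>M1 \<partial>M1) + (\<integral>\<^sup>+x. \<integral>\<^sup>+x'. (h x')\<^sup>2 * H x x' \<partial>M1 \<partial>M1)"
      proof -
        have "(\<integral>\<^sup>+x. \<integral>\<^sup>+x'. (h x)\<^sup>2 * H x x' + (h x')\<^sup>2 * H x x' \<partial>M1 \<partial>M1)
            = (\<integral>\<^sup>+x. (\<integral>\<^sup>+x'. (h x)\<^sup>2 * H x x' \<partial>M1) + (\<integral>\<^sup>+x'. (h x')\<^sup>2 * H x x' \<partial>M1) \<partial>M1)"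
          by (intro nn_integral_cong nn_integral_add) measurable
        also have "\<dots> = (\<integral>\<^sup>+x. \<integral>\<^sup>+x'. (h x)\<^sup>2 * H x x' \<partial>M1 \<partial>M1) + (\<integral>\<^sup>+x. \<integral>\<^sup>+x'. (h x')\<^sup>2 * H x x' \<partial>M1 \<partial>M1)"
          by (rule nn_integral_add) measurable
        finally show ?thesis .
      qed
      also have "(\<integral>\<^sup>+x. \<integral>\<^sup>+x'. (h x')\<^sup>2 * H x x' \<partial>M1 \<partial>M1) = (\<integral>\<^sup>+x'. \<integral>\<^sup>+x. (h x')\<^sup>2 * H x x' \<partial>M1 \<partial>M1)"
        by (rule P11.Fubini') measurable
      also have "\<dots> = (\<integral>\<^sup>+x. \<integral>\<^sup>+x'. (h x)\<^sup>2 * H x x' \<partial>M1 \<partial>M1)"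
        by (simp add: sym)
      also have "(\<integral>\<^sup>+x. \<integral>\<^sup>+x'. (h x)\<^sup>2 * H x x' \<partial>M1 \<partial>M1) = (\<integral>\<^sup>+x. (h x)\<^sup>2 * (\<integral>\<^sup>+x'. H x x' \<partial>M1) \<partial>M1)"
        by (intro nn_integral_cong nn_integral_cmult) measurable
      also have "\<dots> \<le> (\<integral>\<^sup>+x. (h x)\<^sup>2 * C \<partial>M1)"
        using C by (intro nn_integral_mono mult_left_mono) (auto simp: H_def)
      also have "\<dots> = C * X"
        unfolding X_def by (subst mult.commute, rule nn_integral_cmult) measurable
      finally have "2 * (\<integral>\<^sup>+x. \<integral>\<^sup>+x'. (h x * h x') * H x x' \<partial>M1 \<partial>M1) \<le> C * X + C * X"
        by (simp add: add_mono)
      then have "2 * (\<integral>\<^sup>+x. \<integral>\<^sup>+x'. (h x * h x') * H x x' \<partial>M1 \<partial>M1) \<le> 2 * (C * X)"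
        by (simp only: mult_2)
      then show ?thesis unfolding eq
        by (subst (asm) ennreal_mult_le_mult_iff) auto
    qed
    from order_trans[OF cs mult_left_mono[OF this zero_le]]
    have "X * X \<le> (C * (\<integral>\<^sup>+y. (p y)\<^sup>2 \<partial>M2)) * X"
      by (simp add: power2_eq_square ac_simps)
    from ennreal_le_of_sq_le[OF this Xfin] show ?thesis by (simp add: X_def h_def)
  qed
  have "(\<integral>\<^sup>+x. (G x)\<^sup>2 \<partial>M1) = (\<integral>\<^sup>+x. (SUP j. (min (G x) (of_nat j))\<^sup>2) \<partial>M1)"
  proof (intro nn_integral_cong)
    fix x
    have inc: "incseq (\<lambda>j. (min (G x) (of_nat j))\<^sup>2)"
      by (intro incseq_SucI power_mono min.mono) (auto simp: add_increasing)
    have "(\<lambda>j. of_nat j :: ennreal) \<longlonglongrightarrow> top"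
      by (rule of_nat_tendsto_top_ennreal)
    then have lim: "(\<lambda>j. min (G x) (of_nat j)) \<longlonglongrightarrow> min (G x) top"
      by (intro tendsto_intros)
    have "(\<lambda>j. min (G x) (of_nat j) * min (G x) (of_nat j)) \<longlonglongrightarrow> G x * G x"
      using tendsto_mult_ennreal[OF lim lim] by (auto simp: min_def)
    then show "(G x)\<^sup>2 = (SUP j. (min (G x) (of_nat j))\<^sup>2)"
      using LIMSEQ_unique[OF LIMSEQ_SUP[OF inc]] by (simp add: power2_eq_square)
  qed
  also have "\<dots> = (SUP j. \<integral>\<^sup>+x. (min (G x) (of_nat j))\<^sup>2 \<partial>M1)"
    by (intro nn_integral_monotone_convergence_SUP)
      (auto intro!: incseq_SucI le_funI power_mono min.mono simp: add_increasing)
  also have "\<dots> \<le> C * (\<integral>\<^sup>+y. (p y)\<^sup>2 \<partial>M2)"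
    using trunc by (intro SUP_least)
  finally show ?thesis unfolding G_def .
qed

section \<open>Smooth bumps on the line\<close>

primrec Ck1 :: "nat \<Rightarrow> (real \<Rightarrow> real) \<Rightarrow> bool" where
  "Ck1 0 f \<longleftrightarrow> continuous_on UNIV f"
| "Ck1 (Suc k) f \<longleftrightarrow> (\<exists>f'. (\<forall>t. (f has_real_derivative f' t) (at t)) \<and> Ck1 k f')"

definition smooth1 :: "(real \<Rightarrow> real) \<Rightarrow> bool" where
  "smooth1 f \<longleftrightarrow> (\<forall>k. Ck1 k f)"

lemma Ck1_SucD: "Ck1 (Suc k) f \<Longrightarrow> Ck1 k f"
proof (induction k arbitrary: f)
  case 0
  then show ?case unfolding Ck1.simps by (meson continuous_at_imp_continuous_on DERIV_isCont)
next
  case (Suc k)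
  from Suc.prems obtain f' where "\<And>t. (f has_real_derivative f' t) (at t)" "Ck1 (Suc k) f'"
    unfolding Ck1.simps(2)[of "Suc k"] by blast
  with Suc.IH show ?case unfolding Ck1.simps(2)[of k f] by blast
qed

lemma smooth1I:
  assumes "\<And>t. (f has_real_derivative f' t) (at t)" "smooth1 f'"
  shows "smooth1 f"
  using assms unfolding smooth1_def by (metis Ck1.simps(2) Ck1_SucD)

text \<open>Each order of differentiability supplies its own derivative; uniqueness identifies them
  all, so a single derivative is differentiable to every order.\<close>

lemma smooth1D:
  assumes "smooth1 f"
  obtains f' where "\<And>t. (f has_real_derivative f' t) (at t)" "smooth1 f'"
proof -
  have "Ck1 (Suc k) f" for k using assms unfolding smooth1_def by blast
  then obtain D where D: "\<And>k t. (f has_real_derivative D k t) (at t)" "\<And>k. Ck1 k (D k)"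
    unfolding Ck1.simps by metis
  have "D k = D 0" for k using D(1) DERIV_unique by blast
  then have "smooth1 (D 0)" unfolding smooth1_def using D(2) by metis
  with D(1) that show ?thesis by blast
qed

text \<open>Any class of functions closed under differentiation consists of smooth
  functions.\<close>

lemma smooth1_coinduct:
  assumes "P f" and step: "\<And>f. P f \<Longrightarrow> \<exists>f'. (\<forall>t. (f has_real_derivative f' t) (at t)) \<and> P f'"
  shows "smooth1 f"
proof -
  have "Ck1 k f" if "P f" for k f
    using that
  proof (induction k arbitrary: f)
    case 0
    with step show ?case unfolding Ck1.simps by (meson continuous_at_imp_continuous_on DERIV_isCont)
  next
    case (Suc k)
    with step show ?case by (metis Ck1.simps(2))
  qed
  with assms(1) show ?thesis by (simp add: smooth1_def)
qed

lemma smooth1_cont: "smooth1 f \<Longrightarrow> continuous_on UNIV f"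
  unfolding smooth1_def by (metis Ck1.simps(1))

lemma smooth1_affine:
  assumes "smooth1 f" shows "smooth1 (\<lambda>t. a * f (b * t + c))"
proof (rule smooth1_coinduct[where P = "\<lambda>h. \<exists>f a. smooth1 f \<and> h = (\<lambda>t. a * f (b * t + c))"])
  fix h assume "\<exists>f a. smooth1 f \<and> h = (\<lambda>t. a * f (b * t + c))"
  then obtain f a where f: "smooth1 f" and h: "h = (\<lambda>t. a * f (b * t + c))" by blast
  obtain f' where f': "\<And>t. (f has_real_derivative f' t) (at t)" "smooth1 f'" using smooth1D[OF f] by blast
  have "(h has_real_derivative (a * b) * f' (b * t + c)) (at t)" for t
    unfolding h by (auto intro!: derivative_eq_intros DERIV_chain2[OF f'(1)])
  with f'(2) show "\<exists>h'. (\<forall>t. (h has_real_derivative h' t) (at t)) \<and> (\<exists>f a. smooth1 f \<and> h' = (\<lambda>t. a * f (b * t + c)))"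
    by (intro exI[of _ "\<lambda>t. (a * b) * f' (b * t + c)"]) blast
qed (use assms in blast)

lemma Ck1_add:
  "Ck1 k f \<Longrightarrow> Ck1 k g \<Longrightarrow> Ck1 k (\<lambda>t. f t + g t)"
proof (induction k arbitrary: f g)
  case 0 then show ?case by (auto intro: continuous_on_add)
next
  case (Suc k)
  then obtain f' g' where "\<And>t. (f has_real_derivative f' t) (at t)" "\<And>t. (g has_real_derivative g' t) (at t)"
      "Ck1 k f'" "Ck1 k g'" by auto
  with Suc.IH[of f' g'] show ?case by (auto intro!: exI[of _ "\<lambda>t. f' t + g' t"] DERIV_add)
qed

lemma smooth1_add: "smooth1 f \<Longrightarrow> smooth1 g \<Longrightarrow> smooth1 (\<lambda>t. f t + g t)"
  by (simp add: smooth1_def Ck1_add)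

text \<open>The derivative of a product is a sum of two products, so products are not closed under
  differentiation; induction on the order, with both factors smooth, gets by with
  \<open>Ck1_add\<close>.\<close>

lemma smooth1_mult:
  assumes "smooth1 f" "smooth1 g" shows "smooth1 (\<lambda>t. f t * g t)"
proof -
  have "Ck1 k (\<lambda>t. f t * g t)" if "smooth1 f" "smooth1 g" for k f g
    using that
  proof (induction k arbitrary: f g)
    case 0 then show ?case by (auto intro: continuous_on_mult smooth1_cont)
  next
    case (Suc k)
    obtain f' where f': "\<And>t. (f has_real_derivative f' t) (at t)" "smooth1 f'" using smooth1D[OF Suc.prems(1)]
        by blast
    obtain g' where g': "\<And>t. (g has_real_derivative g' t) (at t)" "smooth1 g'" using smooth1D[OF Suc.prems(2)]
        by blast
    have "Ck1 k (\<lambda>t. f' t * g t + g' t * f t)"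
      using Suc f'(2) g'(2) by (intro Ck1_add) auto
    moreover have "((\<lambda>t. f t * g t) has_real_derivative f' t * g t + g' t * f t) (at t)" for t
      by (rule DERIV_mult[OF f'(1) g'(1)])
    ultimately show ?case unfolding Ck1.simps by (intro exI conjI allI)
  qed
  with assms show ?thesis by (simp add: smooth1_def)
qed

text \<open>The class of these functions is closed under differentiation.\<close>

definition flat :: "real poly \<Rightarrow> real \<Rightarrow> real" where
  "flat p t = (if t > 0 then poly p (1/t) * exp (- (1/t)) else 0)"

lemma poly_exp_tendsto_0: "((\<lambda>s. poly p s * exp (- s)) \<longlongrightarrow> 0) (at_top :: real filter)"
proof -
  have "((\<lambda>s. \<Sum>i\<le>degree p. coeff p i * (s ^ i / exp s)) \<longlongrightarrow> (\<Sum>i\<le>degree p. coeff p i * 0)) at_top"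
    by (intro tendsto_intros tendsto_power_div_exp_0)
  then show ?thesis
    by (simp add: poly_altdef exp_minus sum_distrib_right divide_inverse mult.assoc)
qed

text \<open>With s = 1/t one has d/dt = -s^2 d/ds, which turns p(s) exp(-s) into s^2 (p - p')(s)
  exp(-s); the polynomial \<open>[:0,0,1:]\<close> is s^2. At 0 the difference quotient is again a
  polynomial in s times exp(-s).\<close>

lemma flat_deriv: "(flat p has_real_derivative flat ([:0,0,1:] * (p - pderiv p)) t) (at t)"
proof -
  consider "t > 0" | "t < 0" | "t = 0" by linarith
  then show ?thesis
  proof cases
    case 1
    have "((\<lambda>t. poly p (1/t) * exp (- (1/t))) has_real_derivative flat ([:0,0,1:] * (p - pderiv p)) t) (at t)"
      using 1 unfolding flat_def
      by (auto intro!: derivative_eq_intros simp: power2_eq_square field_simps)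
    then show ?thesis
      by (rule has_field_derivative_transform_within_open[of _ _ _ "{0<..}"]) (use 1 in \<open>auto simp: flat_def\<close>)
  next
    case 2
    have "((\<lambda>t. 0) has_real_derivative flat ([:0,0,1:] * (p - pderiv p)) t) (at t)"
      using 2 unfolding flat_def by simp
    then show ?thesis
      by (rule has_field_derivative_transform_within_open[of _ _ _ "{..<0}"]) (use 2 in \<open>auto simp: flat_def\<close>)
  next
    case 3
    have "((\<lambda>h. flat p h / h) \<longlongrightarrow> 0) (at_right 0)"
    proof (rule Lim_transform_eventually)
      show "((\<lambda>h. poly ([:0,1:] * p) (1/h) * exp (- (1/h))) \<longlongrightarrow> 0) (at_right (0::real))"
        using filterlim_compose[OF poly_exp_tendsto_0[of "[:0,1:] * p"] filterlim_inverse_at_top_right]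
        by (simp add: inverse_eq_divide)
      show "\<forall>\<^sub>F h in at_right 0. poly ([:0,1:] * p) (1/h) * exp (- (1/h)) = flat p h / h"
        using eventually_at_right_less[of 0] by eventually_elim (simp add: flat_def field_simps)
    qed
    moreover have "((\<lambda>h. flat p h / h) \<longlongrightarrow> 0) (at_left 0)"
    proof (rule Lim_transform_eventually)
      show "((\<lambda>h. 0) \<longlongrightarrow> 0) (at_left (0::real))" by simp
      show "\<forall>\<^sub>F h in at_left 0. 0 = flat p h / h"
        using eventually_at_leftI[of "-1" 0 "\<lambda>h. 0 = flat p h / h"] by (auto simp: flat_def)
    qed
    ultimately have "((\<lambda>h. flat p h / h) \<longlongrightarrow> 0) (at 0)"
      by (simp add: filterlim_split_at)
    then show ?thesis using 3 by (simp add: DERIV_def flat_def)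
  qed
qed

lemma smooth1_flat: "smooth1 (flat p)"
  by (rule smooth1_coinduct[where P = "\<lambda>f. \<exists>p. f = flat p"]) (use flat_deriv in blast)+

text \<open>The factor \<open>n\<close> sharpens both flanks, so that the bumps tend to the
  indicator of the open interval. At \<open>n = 0\<close> the bump vanishes identically, hence
  \<open>0 < n\<close> and \<open>Suc n\<close> below.\<close>

definition bump :: "real \<Rightarrow> real \<Rightarrow> nat \<Rightarrow> real \<Rightarrow> real" where
  "bump a b n t = flat 1 (real n * (t - a)) * flat 1 (real n * (b - t))"

lemma flat_1: "0 \<le> flat 1 t" "flat 1 t \<le> 1" by (auto simp: flat_def)

lemma bump_bounds: "0 \<le> bump a b n t" "bump a b n t \<le> 1"
  unfolding bump_def using flat_1 by (auto intro: mult_le_one)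

lemma bump_outside: "t \<le> a \<or> b \<le> t \<Longrightarrow> bump a b n t = 0"
  unfolding bump_def flat_def by (auto simp: mult_le_0_iff zero_less_mult_iff)

lemma bump_pos: "a < t \<Longrightarrow> t < b \<Longrightarrow> 0 < n \<Longrightarrow> 0 < bump a b n t"
  unfolding bump_def flat_def by auto

lemma smooth1_bump: "smooth1 (bump a b n)"
proof -
  have "smooth1 (\<lambda>t. (1 * flat 1 (real n * t + (- real n * a))) * (1 * flat 1 (- real n * t + real n * b)))"
    by (intro smooth1_mult smooth1_affine smooth1_flat)
  then show ?thesis unfolding bump_def by (simp add: algebra_simps)
qed

lemma flat_1_scaled_tendsto: "0 < t \<Longrightarrow> (\<lambda>n. flat 1 (real n * t)) \<longlonglongrightarrow> 1"
proof (rule Lim_transform_eventually)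
  assume t: "0 < t"
  have "(\<lambda>n. exp (- (1 / t * (1 / real n)))) \<longlonglongrightarrow> exp (- (1 / t * 0))"
    by (intro tendsto_intros lim_1_over_n)
  then show "(\<lambda>n. exp (- (1 / t * (1 / real n)))) \<longlonglongrightarrow> 1" by simp
  show "\<forall>\<^sub>F n in sequentially. exp (- (1 / t * (1 / real n))) = flat 1 (real n * t)"
    using eventually_gt_at_top[of 0] by eventually_elim (use t in \<open>auto simp: flat_def field_simps\<close>)
qed

lemma bump_tendsto: "(\<lambda>n. bump a b n t) \<longlonglongrightarrow> indicator {a<..<b} t"
proof (cases "a < t \<and> t < b")
  case True
  then have "(\<lambda>n. bump a b n t) \<longlonglongrightarrow> 1 * 1"
    unfolding bump_def by (intro tendsto_intros flat_1_scaled_tendsto) auto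
  with True show ?thesis by simp
next
  case False
  then show ?thesis by (auto simp: bump_outside not_less)
qed

lemma bump_integrable: "bump a b n integrable_on {c..d}"
  by (intro integrable_continuous_interval continuous_on_subset[OF smooth1_cont[OF smooth1_bump]]) auto

definition bumpmass :: "real \<Rightarrow> real \<Rightarrow> nat \<Rightarrow> real" where
  "bumpmass a b n = integral {a..b} (bump a b n)"

lemma bumpmass_tendsto: "a < b \<Longrightarrow> bumpmass a b \<longlonglongrightarrow> b - a"
proof -
  assume "a < b"
  have "(\<lambda>n. integral {a..b} (bump a b n)) \<longlonglongrightarrow> integral {a..b} (indicator {a<..<b})"
    by (rule dominated_convergence(2)[where h = "\<lambda>_. 1"])
      (use bump_integrable bump_tendsto in \<open>simp_all add: bump_bounds integrable_continuous_interval\<close>)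
  also have "integral {a..b} (indicator {a<..<b}) = integral {a..b} (\<lambda>_. 1 :: real)"
    by (rule integral_spike[of "{a,b}"]) auto
  also have "\<dots> = b - a" using \<open>a < b\<close> by simp
  finally show ?thesis unfolding bumpmass_def .
qed

lemma bumpmass_pos: "a < b \<Longrightarrow> 0 < n \<Longrightarrow> 0 < bumpmass a b n"
proof -
  assume *: "a < b" "0 < n"
  have "bumpmass a b n \<noteq> 0"
  proof
    assume "bumpmass a b n = 0"
    then have "bump a b n ((a+b)/2) = 0"
      unfolding bumpmass_def using *
      by (subst (asm) integral_eq_0_iff) (auto simp: bump_bounds intro: continuous_on_subset[OF smooth1_cont[OF
          smooth1_bump]])
    with bump_pos[of a "(a+b)/2" b n] * show False by simp
  qed
  moreover have "0 \<le> bumpmass a b n" unfolding bumpmass_def by (intro integral_nonneg bump_integrable bump_bounds)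
  ultimately show ?thesis by simp
qed

lemma integral_eq_zero:
  assumes "\<And>t. t \<in> S \<Longrightarrow> f t = (0::real)" shows "integral S f = 0"
  using integral_cong[of S f "\<lambda>_. 0"] assms by simp

text \<open>The primitive climbs from 0 to the mass of the bump, so two of them, divided by their
  masses, differ by a function of compact support.\<close>

lemma bump_antiderivative:
  assumes "a < b" "0 < n"
  obtains P where "\<And>t. (P has_real_derivative bump a b n t) (at t)" "smooth1 P"
    "\<And>t. 0 \<le> P t" "\<And>t. P t \<le> bumpmass a b n" "\<And>t. t \<le> a \<Longrightarrow> P t = 0" "\<And>t. b \<le> t \<Longrightarrow> P t = bumpmass a b n"
proof -
  \<comment> \<open>Starting at a - 1 leaves room on the left, so that differentiating the integral
    also works at the point a itself.\<close>
  define P where "P t = integral {a - 1..t} (bump a b n)" for t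
  have low: "P t = 0" if "t \<le> a" for t
    unfolding P_def by (rule integral_eq_zero) (use that in \<open>auto intro: bump_outside\<close>)
  have D: "(P has_real_derivative bump a b n t) (at t)" for t
  proof (cases "t < a")
    case True
    have "((\<lambda>t. 0) has_real_derivative bump a b n t) (at t)"
      using True by (simp add: bump_outside)
    then show ?thesis
      by (rule has_field_derivative_transform_within_open[of _ _ _ "{..<a}"]) (use True low in auto)
  next
    case False
    have "(P has_real_derivative bump a b n t) (at t within {a - 1..t + 1})"
      unfolding P_def using False
      by (intro integral_has_real_derivative continuous_on_subset[OF smooth1_cont[OF smooth1_bump]]) auto
    moreover have "at t within {a - 1..t + 1} = at t"
      using False by (intro at_within_interior) (auto simp: interior_atLeastAtMost_real)
    ultimately show ?thesis by simp
  qed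
  have mono: "P s \<le> P t" if "s \<le> t" for s t
    using that D bump_bounds by (intro DERIV_nonneg_imp_nondecreasing[of s t P]) blast+
  have Pb: "P b = bumpmass a b n"
  proof -
    have "P b = integral {a-1..a} (bump a b n) + integral {a..b} (bump a b n)"
      unfolding P_def using assms by (intro Henstock_Kurzweil_Integration.integral_combine[symmetric]
          bump_integrable) auto
    with low[of a] show ?thesis by (simp add: P_def bumpmass_def)
  qed
  have high: "P t = bumpmass a b n" if "b \<le> t" for t
  proof -
    have "P t = integral {a-1..b} (bump a b n) + integral {b..t} (bump a b n)"
      unfolding P_def using assms that by (intro Henstock_Kurzweil_Integration.integral_combine[symmetric]
          bump_integrable) auto
    moreover have "integral {b..t} (bump a b n) = 0"
      by (rule integral_eq_zero) (auto intro: bump_outside)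
    ultimately show ?thesis using Pb by (simp add: P_def)
  qed
  show ?thesis
  proof (rule that[OF D])
    show "smooth1 P" using D smooth1_bump by (rule smooth1I)
    show "0 \<le> P t" for t using mono[of "min t a" t] low[of "min t a"] by simp
    show "P t \<le> bumpmass a b n" for t using mono[of t "max t b"] high[of "max t b"] by simp
  qed (use low high in auto)
qed

section \<open>Products of functions of one variable as test functions\<close>

lemma tensor_pderiv:
  assumes f: "\<And>t. (f has_real_derivative f' t) (at t)" and g: "\<And>t. (g has_real_derivative g' t) (at t)"
    and "i \<noteq> (k::2)"
  shows "(\<lambda>x. complex_of_real (f (x$i) * g (x$k))) differentiable (at x)"
    "pderiv_at i (\<lambda>x. complex_of_real (f (x$i) * g (x$k))) x = complex_of_real (f' (x$i) * g (x$k))"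
    "pderiv_at k (\<lambda>x. complex_of_real (f (x$i) * g (x$k))) x = complex_of_real (f (x$i) * g' (x$k))"
proof -
  have *: "((\<lambda>x::real^2. f (x$i)) has_derivative (\<lambda>h. f' (x$i) * h$i)) (at x)"
    if "\<And>t. (f has_real_derivative f' t) (at t)" for f f' :: "real \<Rightarrow> real" and i :: 2
    using has_derivative_compose[of "\<lambda>x::real^2. x$i" "\<lambda>h. h$i" x UNIV f "\<lambda>h. f' (x$i) * h"] that[of "x$i"]
      bounded_linear_imp_has_derivative[OF bounded_linear_vec_nth]
    by (auto simp: has_field_derivative_def)
  note fd = *[OF f, of i] and gd = *[OF g, of k]
  have D: "((\<lambda>x. complex_of_real (f (x$i) * g (x$k))) has_derivative
      (\<lambda>h. complex_of_real (f (x$i) * (g' (x$k) * h$k) + f' (x$i) * h$i * g (x$k)))) (at x)"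
    by (rule has_derivative_of_real[OF has_derivative_mult[OF fd gd]])
  then show "(\<lambda>x. complex_of_real (f (x$i) * g (x$k))) differentiable (at x)"
    unfolding differentiable_def by blast
  from frechet_derivative_at[OF D, symmetric] \<open>i \<noteq> k\<close>
  show "pderiv_at i (\<lambda>x. complex_of_real (f (x$i) * g (x$k))) x = complex_of_real (f' (x$i) * g (x$k))"
    "pderiv_at k (\<lambda>x. complex_of_real (f (x$i) * g (x$k))) x = complex_of_real (f (x$i) * g' (x$k))"
    unfolding pderiv_at_def by (auto simp: axis_def)
qed

lemma C_k_tensor:
  assumes "smooth1 f" "smooth1 g" "i \<noteq> (k::2)"
  shows "C_k n (\<lambda>x. complex_of_real (f (x$i) * g (x$k)))"
  using assms(1,2)
proof (induction n arbitrary: f g)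
  case 0
  have "continuous_on UNIV (\<lambda>x::real^2. f (x$i))" if "smooth1 f" for f :: "real \<Rightarrow> real" and i :: 2
    by (rule continuous_on_compose2[OF smooth1_cont[OF that]]) (auto intro: continuous_intros)
  with 0 show ?case by (auto intro!: continuous_intros)
next
  case (Suc n)
  obtain f' where f': "\<And>t. (f has_real_derivative f' t) (at t)" "smooth1 f'" using smooth1D[OF Suc.prems(1)] by blast
  obtain g' where g': "\<And>t. (g has_real_derivative g' t) (at t)" "smooth1 g'" using smooth1D[OF Suc.prems(2)] by blast
  note T = tensor_pderiv[OF f'(1) g'(1) assms(3)]
  have "C_k n (pderiv_at l (\<lambda>x. complex_of_real (f (x$i) * g (x$k))))" for l
  proof -
    have "l = i \<or> l = k" using assms(3) exhaust_2[of l] exhaust_2[of i] exhaust_2[of k] by auto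
    moreover have "pderiv_at i (\<lambda>x. complex_of_real (f (x$i) * g (x$k))) = (\<lambda>x. complex_of_real (f' (x$i) * g (x$k)))"
      "pderiv_at k (\<lambda>x. complex_of_real (f (x$i) * g (x$k))) = (\<lambda>x. complex_of_real (f (x$i) * g' (x$k)))"
      using T(2,3) by blast+
    ultimately show ?thesis using Suc.IH[OF f'(2) Suc.prems(2)] Suc.IH[OF Suc.prems(1) g'(2)] by metis
  qed
  with T(1) show ?case by simp
qed

lemma test_function_tensor:
  assumes "smooth1 f" "smooth1 g" "i \<noteq> (k::2)"
    and "\<And>t. t < a \<or> b < t \<Longrightarrow> f t = 0" "\<And>t. t < c \<or> d < t \<Longrightarrow> g t = 0"
  shows "test_function (\<lambda>x. complex_of_real (f (x$i) * g (x$k)))"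
proof -
  have "{x. complex_of_real (f (x$i) * g (x$k)) \<noteq> 0} \<subseteq> cbox (\<chi> l. if l = i then a else c) (\<chi> l. if l
      = i then b else d)"
  proof
    fix x :: "real^2" assume "x \<in> {x. complex_of_real (f (x$i) * g (x$k)) \<noteq> 0}"
    then have "f (x$i) \<noteq> 0" "g (x$k) \<noteq> 0" by auto
    then have "a \<le> x$i" "x$i \<le> b" "c \<le> x$k" "x$k \<le> d" using assms(4,5) not_less by blast+
    moreover have "l = i \<or> l = k" for l using assms(3) exhaust_2[of l] exhaust_2[of i] exhaust_2[of k] by auto
    ultimately show "x \<in> cbox (\<chi> l. if l = i then a else c) (\<chi> l. if l = i then b else d)"
      using assms(3) by (auto simp: mem_box_cart)
  qed
  then have "bounded {x. complex_of_real (f (x$i) * g (x$k)) \<noteq> 0}"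
    using bounded_cbox bounded_subset by blast
  then show ?thesis using C_k_tensor[OF assms(1-3)] by (simp add: test_function_def)
qed

section \<open>Means over rectangles and weak derivatives\<close>

text \<open>\<open>has_weak_pderiv\<close> for functions instead of classes.\<close>

definition weak_deriv :: "2 \<Rightarrow> (real^2 \<Rightarrow> complex) \<Rightarrow> (real^2 \<Rightarrow> complex) \<Rightarrow> bool" where
  "weak_deriv i u g \<longleftrightarrow> (\<forall>\<phi>. test_function \<phi> \<longrightarrow>
     (\<integral>x. u x * pderiv_at i \<phi> x \<partial>lebesgue) = - (\<integral>x. g x * \<phi> x \<partial>lebesgue))"

text \<open>The coordinates are parameters, so that one argument with \<open>i\<close> as the
  direction of differentiation serves both axes.\<close>

definition slab :: "2 \<Rightarrow> 2 \<Rightarrow> real \<Rightarrow> real \<Rightarrow> real \<Rightarrow> real \<Rightarrow> (real^2) set" where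
  "slab i k a b c d = {x. a < x$i \<and> x$i < b \<and> c < x$k \<and> x$k < d}"

definition cslab :: "2 \<Rightarrow> 2 \<Rightarrow> real \<Rightarrow> real \<Rightarrow> real \<Rightarrow> real \<Rightarrow> (real^2) set" where
  "cslab i k a b c d = {x. a \<le> x$i \<and> x$i \<le> b \<and> c \<le> x$k \<and> x$k \<le> d}"

lemma two_cases: "i \<noteq> (k::2) \<Longrightarrow> l = i \<or> l = k"
  using exhaust_2[of l] exhaust_2[of i] exhaust_2[of k] by auto

lemma slab_eq_box:
  assumes "i \<noteq> k"
  shows "slab i k a b c d = box (\<chi> l. if l = i then a else c) (\<chi> l. if l = i then b else d)"
    "cslab i k a b c d = cbox (\<chi> l. if l = i then a else c) (\<chi> l. if l = i then b else d)"
proof -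
  have "(\<forall>l. P l) \<longleftrightarrow> P i \<and> P k" for P :: "2 \<Rightarrow> bool"
    using two_cases[OF assms] by metis
  then show "slab i k a b c d = box (\<chi> l. if l = i then a else c) (\<chi> l. if l = i then b else d)"
    "cslab i k a b c d = cbox (\<chi> l. if l = i then a else c) (\<chi> l. if l = i then b else d)"
    using assms unfolding slab_def cslab_def set_eq_iff mem_box_cart by auto
qed

lemma slab_sets [measurable]: "i \<noteq> k \<Longrightarrow> slab i k a b c d \<in> sets lebesgue" "i \<noteq> k \<Longrightarrow> cslab i k a b c d \<in> sets lebesgue"
  by (auto simp: slab_eq_box)

lemma cslab_finite: "i \<noteq> k \<Longrightarrow> emeasure lebesgue (cslab i k a b c d) < \<infinity>"
  using fmeasurableD2[OF fmeasurable_cbox] by (simp add: slab_eq_box less_top)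

lemma sq_integrable_set_integrable:
  assumes "sq_integrable u" "S \<in> sets lebesgue" "emeasure lebesgue S < \<infinity>"
  shows "set_integrable lebesgue S u"
  unfolding set_integrable_def
proof (rule Bochner_Integration.integrable_bound)
  have [measurable]: "u \<in> borel_measurable lebesgue" using assms by (simp add: sq_integrable_def)
  have "integrable lebesgue (\<lambda>x. (norm (u x))\<^sup>2)" using assms by (simp add: sq_integrable_def)
  moreover have "integrable lebesgue (indicator S :: _ \<Rightarrow> real)" using assms by simp
  ultimately show "integrable lebesgue (\<lambda>x. indicator S x + (norm (u x))\<^sup>2)" by simp
  show "AE x in lebesgue. norm (indicator S x *\<^sub>R u x) \<le> norm (indicator S x + (norm (u x))\<^sup>2)"
  proof (rule AE_I2)
    fix x
    have "norm (u x) \<le> 1 + (norm (u x))\<^sup>2"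
      using sum_squares_bound[of 1 "norm (u x)"] by (simp add: power2_eq_square) (smt (verit) norm_ge_zero
          zero_le_square)
    then show "norm (indicator S x *\<^sub>R u x) \<le> norm (indicator S x + (norm (u x))\<^sup>2)"
      by (auto simp: indicator_def)
  qed
  show "(\<lambda>x. indicator S x *\<^sub>R u x) \<in> borel_measurable lebesgue" using assms(2) by measurable
qed

lemma bump_meas [measurable]: "bump a b n \<in> borel_measurable borel"
  by (intro borel_measurable_continuous_onI smooth1_cont smooth1_bump)

lemma nth_measurable [measurable]: "(\<lambda>x::real^2. x$i) \<in> borel_measurable borel"
  by (intro borel_measurable_continuous_onI continuous_intros)

lemma nth_measurable' [measurable]: "(\<lambda>x::real^2. x$i) \<in> borel_measurable lebesgue"
  by (rule measurable_completion) simp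

lemma AE_cslab_slab:
  assumes "i \<noteq> k"
  shows "AE x in lebesgue. x \<in> cslab i k a b c d \<longrightarrow> x \<in> slab i k a b c d"
proof -
  have "negligible (cslab i k a b c d - slab i k a b c d)"
    by (simp add: slab_eq_box[OF assms] negligible_frontier_interval)
  then have "AE x in lebesgue. x \<notin> cslab i k a b c d - slab i k a b c d"
    by (intro AE_not_in) (simp add: negligible_iff_null_sets)
  then show ?thesis by eventually_elim auto
qed

lemma set_integral_eq_slab:
  fixes u :: "real^2 \<Rightarrow> complex"
  assumes "i \<noteq> k" and [measurable]: "u \<in> borel_measurable lebesgue" "S \<in> sets lebesgue"
    and "slab i k a b c d \<subseteq> S" "S \<subseteq> cslab i k a b c d"
  shows "(LINT x:S|lebesgue. u x) = (LINT x:slab i k a b c d|lebesgue. u x)"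
proof (rule set_integral_cong_set)
  note [measurable] = slab_sets[OF assms(1)]
  show "set_borel_measurable lebesgue S u" "set_borel_measurable lebesgue (slab i k a b c d) u"
    unfolding set_borel_measurable_def by measurable
  show "AE x in lebesgue. (x \<in> slab i k a b c d) = (x \<in> S)"
    using AE_cslab_slab[OF assms(1)] by eventually_elim (use assms(4,5) in blast)
qed

lemma bump_integral:
  assumes ne: "i \<noteq> k" and u: "sq_integrable u"
  shows "integrable lebesgue (\<lambda>x. u x * complex_of_real (bump a b (Suc n) (x$i) * bump c d (Suc n) (x$k)))"
    "(\<lambda>n. \<integral>x. u x * complex_of_real (bump a b (Suc n) (x$i) * bump c d (Suc n) (x$k)) \<partial>lebesgue)
      \<longlonglongrightarrow> (LINT x:slab i k a b c d|lebesgue. u x)"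
proof -
  have [measurable]: "u \<in> borel_measurable lebesgue" using u by (simp add: sq_integrable_def)
  note [measurable] = slab_sets[OF ne]
  let ?\<phi> = "\<lambda>n x. complex_of_real (bump a b (Suc n) (x$i) * bump c d (Suc n) (x$k))"
  have int: "integrable lebesgue (\<lambda>x. indicator (cslab i k a b c d) x *\<^sub>R u x)"
    using sq_integrable_set_integrable[OF u slab_sets(2)[OF ne] cslab_finite[OF ne]] by (simp add: set_integrable_def)
  have bound: "norm (u x * ?\<phi> n x) \<le> norm (indicator (cslab i k a b c d) x *\<^sub>R u x)" for n x
  proof (cases "x \<in> cslab i k a b c d")
    case True
    have "\<bar>bump a b (Suc n) (x$i)\<bar> * \<bar>bump c d (Suc n) (x$k)\<bar> \<le> 1 * 1"
      using bump_bounds by (intro mult_mono) auto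
    then have "norm (?\<phi> n x) \<le> 1" by (simp add: norm_mult)
    with True show ?thesis by (simp only: norm_mult) (simp add: mult_left_le)
  next
    case False
    then have "bump a b (Suc n) (x$i) = 0 \<or> bump c d (Suc n) (x$k) = 0"
      using bump_outside[of "x$i" a b] bump_outside[of "x$k" c d] unfolding cslab_def by force
    then show ?thesis by auto
  qed
  show "integrable lebesgue (\<lambda>x. u x * ?\<phi> n x)"
    by (rule Bochner_Integration.integrable_bound[OF int]) (use bound in auto)
  have "(\<lambda>n. \<integral>x. u x * ?\<phi> n x \<partial>lebesgue) \<longlonglongrightarrow> (\<integral>x. indicator (slab i k a b c d) x *\<^sub>R u x \<partial>lebesgue)"
  proof (rule integral_dominated_convergence[where w = "\<lambda>x. norm (indicator (cslab i k a b c d) x *\<^sub>R u x)"])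
    show "integrable lebesgue (\<lambda>x. norm (indicator (cslab i k a b c d) x *\<^sub>R u x))"
      using int by (rule integrable_norm)
    show "AE x in lebesgue. (\<lambda>n. u x * ?\<phi> n x) \<longlonglongrightarrow> indicator (slab i k a b c d) x *\<^sub>R u x"
    proof (rule AE_I2)
      fix x :: "real^2"
      have "(\<lambda>n. u x * ?\<phi> n x) \<longlonglongrightarrow> u x * complex_of_real (indicator {a<..<b} (x$i) * indicator {c<..<d} (x$k))"
        by (intro tendsto_intros LIMSEQ_Suc[OF bump_tendsto])
      also have "u x * complex_of_real (indicator {a<..<b} (x$i) * indicator {c<..<d} (x$k))
          = indicator (slab i k a b c d) x *\<^sub>R u x"
        by (auto simp: slab_def indicator_def)
      finally show "(\<lambda>n. u x * ?\<phi> n x) \<longlonglongrightarrow> indicator (slab i k a b c d) x *\<^sub>R u x" .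
    qed
  qed (use bound in auto)
  then show "(\<lambda>n. \<integral>x. u x * ?\<phi> n x \<partial>lebesgue) \<longlonglongrightarrow> (LINT x:slab i k a b c d|lebesgue. u x)"
    by (simp add: set_lebesgue_integral_def)
qed

text \<open>The difference of the normalised indicators of two intervals has a primitive with values in
  \<open>[-1, 1]\<close> that is supported in the hull of the intervals; test with smooth versions of it.\<close>

proposition weak_deriv_slab_mean_diff:
  fixes u g :: "real^2 \<Rightarrow> complex"
  assumes wd: "weak_deriv i u g" and ne: "i \<noteq> k" and u: "sq_integrable u" and g: "sq_integrable g"
    and ab: "a < b" and ab': "a' < b'" and cd: "c < d"
  shows "ennreal (norm ((LINT x:slab i k a b c d|lebesgue. u x) / of_real (b - a)
            - (LINT x:slab i k a' b' c d|lebesgue. u x) / of_real (b' - a')))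
         \<le> (\<integral>\<^sup>+x\<in>cslab i k (min a a') (max b b') c d. ennreal (norm (g x)) \<partial>lebesgue)"
proof -
  have [measurable]: "u \<in> borel_measurable lebesgue" "g \<in> borel_measurable lebesgue"
    using u g by (auto simp: sq_integrable_def)
  note [measurable] = slab_sets[OF ne]
  define D where "D = cslab i k (min a a') (max b b') c d"
  have [measurable]: "D \<in> sets lebesgue" unfolding D_def by measurable
  define m m' where "m n = bumpmass a b (Suc n)" and "m' n = bumpmass a' b' (Suc n)" for n
  have m: "0 < m n" "0 < m' n" for n
    unfolding m_def m'_def using bumpmass_pos ab ab' by auto
  define \<psi> where "\<psi> n t = bump a b (Suc n) t / m n - bump a' b' (Suc n) t / m' n" for n t
  define L where "L n = (\<integral>x. u x * complex_of_real (\<psi> n (x$i) * bump c d (Suc n) (x$k)) \<partial>lebesgue)" for n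
  have bound: "ennreal (norm (L n)) \<le> (\<integral>\<^sup>+x\<in>D. ennreal (norm (g x)) \<partial>lebesgue)" for n
  proof -
    obtain P where P: "\<And>t. (P has_real_derivative bump a b (Suc n) t) (at t)" "smooth1 P"
      "\<And>t. 0 \<le> P t" "\<And>t. P t \<le> m n" "\<And>t. t \<le> a \<Longrightarrow> P t = 0" "\<And>t. b \<le> t \<Longrightarrow> P t = m n"
      using bump_antiderivative[OF ab, of "Suc n"] unfolding m_def by auto
    obtain P' where P': "\<And>t. (P' has_real_derivative bump a' b' (Suc n) t) (at t)" "smooth1 P'"
      "\<And>t. 0 \<le> P' t" "\<And>t. P' t \<le> m' n" "\<And>t. t \<le> a' \<Longrightarrow> P' t = 0" "\<And>t. b' \<le> t \<Longrightarrow> P' t = m' n"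
      using bump_antiderivative[OF ab', of "Suc n"] unfolding m'_def by auto
    define Q where "Q t = P t / m n - P' t / m' n" for t
    have Q: "(Q has_real_derivative \<psi> n t) (at t)" for t
      unfolding Q_def \<psi>_def by (intro DERIV_diff DERIV_cdivide P(1) P'(1))
    have "smooth1 (\<lambda>t. inverse (m n) * P (1 * t + 0) + (- inverse (m' n)) * P' (1 * t + 0))"
      by (intro smooth1_add smooth1_affine P(2) P'(2))
    then have smQ: "smooth1 Q" unfolding Q_def by (simp add: field_simps)
    have Q1: "\<bar>Q t\<bar> \<le> 1" for t
    proof -
      have "0 \<le> P t / m n" "P t / m n \<le> 1" "0 \<le> P' t / m' n" "P' t / m' n \<le> 1"
        using P(3,4)[of t] P'(3,4)[of t] m[of n] by (auto simp: field_simps)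
      then show ?thesis unfolding Q_def by linarith
    qed
    have Q0: "Q t = 0" if "t < min a a' \<or> max b b' < t" for t
      using that P(5,6)[of t] P'(5,6)[of t] m[of n] unfolding Q_def by auto
    define \<phi> where "\<phi> x = complex_of_real (Q (x$i) * bump c d (Suc n) (x$k))" for x :: "real^2"
    have "test_function \<phi>"
      unfolding \<phi>_def by (rule test_function_tensor[where a = "min a a'" and b = "max b b'" and c = c and d
          = d, OF smQ smooth1_bump ne Q0])
        (auto intro: bump_outside)
    obtain B' where B': "\<And>t. (bump c d (Suc n) has_real_derivative B' t) (at t)"
      using smooth1D[OF smooth1_bump] by blast
    have pd: "pderiv_at i \<phi> x = complex_of_real (\<psi> n (x$i) * bump c d (Suc n) (x$k))" for x
      unfolding \<phi>_def using tensor_pderiv(2)[OF Q B' ne] by blast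
    have L: "L n = - (\<integral>x. g x * \<phi> x \<partial>lebesgue)"
      unfolding L_def pd[symmetric] using wd \<open>test_function \<phi>\<close> unfolding weak_deriv_def by blast
    \<comment> \<open>A nonintegrable integrand has integral 0 by convention, so the bound holds in
      that case too.\<close>
    have "ennreal (norm (\<integral>x. g x * \<phi> x \<partial>lebesgue)) \<le> (\<integral>\<^sup>+x. ennreal (norm (g x * \<phi> x)) \<partial>lebesgue)"
      by (cases "integrable lebesgue (\<lambda>x. g x * \<phi> x)")
        (auto intro: integral_norm_bound_ennreal simp: not_integrable_integral_eq)
    also have "\<dots> \<le> (\<integral>\<^sup>+x\<in>D. ennreal (norm (g x)) \<partial>lebesgue)"
    proof (rule nn_integral_mono)
      fix x :: "real^2"
      have "norm (\<phi> x) \<le> indicator D x"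
      proof (cases "x \<in> D")
        case True
        have "\<bar>Q (x$i)\<bar> * \<bar>bump c d (Suc n) (x$k)\<bar> \<le> 1 * 1"
          using Q1 bump_bounds[of c d "Suc n" "x$k"] by (intro mult_mono) auto
        with True show ?thesis unfolding \<phi>_def by (simp add: abs_mult norm_mult)
      next
        case False
        then have "Q (x$i) = 0 \<or> bump c d (Suc n) (x$k) = 0"
          unfolding D_def cslab_def using Q0[of "x$i"] bump_outside[of "x$k" c d] by force
        with False show ?thesis unfolding \<phi>_def by auto
      qed
      then have "norm (g x * \<phi> x) \<le> norm (g x) * indicator D x"
        by (simp add: norm_mult mult_left_mono)
      then have "ennreal (norm (g x * \<phi> x)) \<le> ennreal (norm (g x) * indicator D x)" by (rule ennreal_leI)
      also have "\<dots> = ennreal (norm (g x)) * indicator D x" by (simp add: ennreal_mult ennreal_indicator)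
      finally show "ennreal (norm (g x * \<phi> x)) \<le> ennreal (norm (g x)) * indicator D x" .
    qed
    finally show ?thesis unfolding L by simp
  qed
  define A where "A a b n x = u x * complex_of_real (bump a b (Suc n) (x$i) * bump c d (Suc n) (x$k))" for a b n x
  have A: "integrable lebesgue (A a b n)" "(\<lambda>n. \<integral>x. A a b n x \<partial>lebesgue) \<longlonglongrightarrow> (LINT x:slab i k a b c d|lebesgue. u
      x)" for a b n
    unfolding A_def using bump_integral[OF ne u] by blast+
  have "L n = (\<integral>x. A a b n x / of_real (m n) - A a' b' n x / of_real (m' n) \<partial>lebesgue)" for n
    unfolding L_def \<psi>_def A_def
    by (intro Bochner_Integration.integral_cong) (simp_all add: left_diff_distrib right_diff_distrib)
  moreover have "(\<integral>x. A a b n x / of_real (m n) - A a' b' n x / of_real (m' n) \<partial>lebesgue)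
      = (\<integral>x. A a b n x \<partial>lebesgue) / of_real (m n) - (\<integral>x. A a' b' n x \<partial>lebesgue) / of_real (m' n)" for n
    by (subst Bochner_Integration.integral_diff)
      (auto intro!: integrable_divide A)
  ultimately have "L = (\<lambda>n. (\<integral>x. A a b n x \<partial>lebesgue) / of_real (m n) - (\<integral>x. A a' b' n x \<partial>lebesgue) / of_real
      (m' n))" by (simp add: fun_eq_iff)
  moreover have "m \<longlonglongrightarrow> b - a" "m' \<longlonglongrightarrow> b' - a'"
    unfolding m_def m'_def by (intro LIMSEQ_Suc bumpmass_tendsto ab ab')+
  ultimately have "L \<longlonglongrightarrow> (LINT x:slab i k a b c d|lebesgue. u x) / of_real (b - a)
            - (LINT x:slab i k a' b' c d|lebesgue. u x) / of_real (b' - a')"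
    using ab ab' by (simp only:) (intro tendsto_diff tendsto_divide tendsto_of_real A(2), auto)
  then have "(\<lambda>n. ennreal (norm (L n))) \<longlonglongrightarrow> ennreal (norm ((LINT x:slab i k a b c d|lebesgue. u x) / of_real (b - a)
            - (LINT x:slab i k a' b' c d|lebesgue. u x) / of_real (b' - a')))"
    by (intro tendsto_intros)
  then show ?thesis
    by (rule LIMSEQ_le_const2) (use bound in \<open>auto simp: D_def\<close>)
qed

section \<open>Uniqueness of weak derivatives\<close>

lemma One_nth: "(\<Sum>b\<in>Basis. (b::real^2) $ i) = 1"
proof -
  have "(\<Sum>b\<in>Basis. (b::real^2) $ i) = (\<Sum>b\<in>Basis. (b::real^2) \<bullet> axis i 1)"
    by (simp add: cart_eq_inner_axis)
  also have "\<dots> = (One :: real^2) \<bullet> axis i 1" by (simp only: inner_sum_left)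
  also have "\<dots> = 1" by (rule inner_sum_Basis) (simp add: axis_in_Basis_iff)
  finally show ?thesis .
qed

lemma cbox_One: "cbox x (x + h *\<^sub>R One) = cslab 1 2 (x$1) (x$1 + h) (x$2) (x$2 + h)"
  by (auto simp: mem_box_cart One_nth cslab_def forall_2)

text \<open>Smooth bumps approximate the indicator of every rectangle, so g - g' integrates to 0
  over all of them; the differentiation theorem for integrals then gives 0 almost
  everywhere.\<close>

lemma weak_deriv_unique:
  assumes "weak_deriv i u g" "weak_deriv i u g'" "sq_integrable g" "sq_integrable g'"
  shows "AE x in lebesgue. g x = g' x"
proof -
  define h where "h x = g x - g' x" for x
  have [measurable]: "g \<in> borel_measurable lebesgue" "g' \<in> borel_measurable lebesgue"
    using assms by (auto simp: sq_integrable_def)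
  have int: "set_integrable lebesgue (cslab 1 2 a b c d) v" if "sq_integrable v" for a b c d v
    by (intro sq_integrable_set_integrable that slab_sets cslab_finite) auto
  have ihh: "set_integrable lebesgue (cslab 1 2 a b c d) h" for a b c d
    unfolding h_def using assms by (intro set_integral_diff int)
  have eq: "(\<integral>x. g x * \<phi> x \<partial>lebesgue) = (\<integral>x. g' x * \<phi> x \<partial>lebesgue)" if "test_function \<phi>" for \<phi>
    using assms(1,2)[unfolded weak_deriv_def, rule_format, OF that] by simp
  have zero: "(LINT x:cslab 1 2 a b c d|lebesgue. h x) = 0" for a b c d
  proof -
    let ?\<phi> = "\<lambda>n x. complex_of_real (bump a b (Suc n) (x$1) * bump c d (Suc n) (x$2))"
    have "test_function (?\<phi> n)" for n
      by (rule test_function_tensor[where a = a and b = b and c = c and d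
          = d]) (auto intro: bump_outside smooth1_bump)
    then have "(\<integral>x. g x * ?\<phi> n x \<partial>lebesgue) = (\<integral>x. g' x * ?\<phi> n x \<partial>lebesgue)" for n
      by (rule eq)
    then have "(LINT x:slab 1 2 a b c d|lebesgue. g x) = (LINT x:slab 1 2 a b c d|lebesgue. g' x)"
      using bump_integral(2)[of 1 2 g a b c d] bump_integral(2)[of 1 2 g' a b c d] assms(3,4)
      by (simp only:) (rule LIMSEQ_unique, simp_all)
    then have "(LINT x:cslab 1 2 a b c d|lebesgue. g x) = (LINT x:cslab 1 2 a b c d|lebesgue. g' x)"
      by (subst (1 2) set_integral_eq_slab) (auto simp: slab_def cslab_def intro!: slab_sets)
    then show ?thesis unfolding h_def using int[OF assms(3)] int[OF assms(4)] by (simp add: set_integral_diff)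
  qed
  have hint: "h integrable_on cbox a b" and hz: "integral (cbox a b) h = 0" for a b
  proof -
    have eq: "cbox a b = cslab 1 2 (a$1) (b$1) (a$2) (b$2)"
      by (auto simp: mem_box_cart cslab_def forall_2)
    show "h integrable_on cbox a b" unfolding eq by (rule set_lebesgue_integral_eq_integral(1)[OF ihh])
    show "integral (cbox a b) h = 0" unfolding eq
      using set_lebesgue_integral_eq_integral(2)[OF ihh] zero by metis
  qed
  obtain N where N: "negligible N"
      "\<And>x e. \<lbrakk>x \<notin> N; 0 < e\<rbrakk> \<Longrightarrow> \<exists>d>0. \<forall>t. 0 < t \<and> t < d \<longrightarrow>
         norm (integral (cbox x (x + t *\<^sub>R One)) h /\<^sub>R t ^ DIM(real^2) - h x) < e"
    using integrable_ccontinuous_explicit[OF hint] by blast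
  have "h x = 0" if x: "x \<notin> N" for x
  proof (rule ccontr)
    assume "h x \<noteq> 0"
    then obtain d where "d > 0" "\<forall>t. 0 < t \<and> t < d \<longrightarrow>
         norm (integral (cbox x (x + t *\<^sub>R One)) h /\<^sub>R t ^ DIM(real^2) - h x) < norm (h x)"
      using N(2)[OF x, of "norm (h x)"] by auto
    then have "norm (integral (cbox x (x + (d/2) *\<^sub>R One)) h /\<^sub>R (d/2) ^ DIM(real^2) - h x) < norm (h x)"
      by (auto dest: spec[of _ "d/2"])
    then show False by (simp add: hz)
  qed
  moreover have "AE x in lebesgue. x \<notin> N" using N(1) by (simp add: negligible_iff_null_sets AE_not_in)
  ultimately show ?thesis by (auto simp: h_def)
qed

section \<open>Telescoping of means along the tree\<close>

definition lo :: "int \<Rightarrow> int \<Rightarrow> real" where "lo j p = 3 powi j * (of_int p - 1/2)"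

lemma idx_lo: "idx j t = p \<longleftrightarrow> lo j p \<le> t \<and> t < lo j (p + 1)"
  unfolding idx_eq_iff lo_def by (simp add: add_diff_eq[symmetric] add.commute)

lemma lo_diff: "lo j (p + 1) - lo j p = 3 powi j"
  unfolding lo_def by (simp add: algebra_simps)

lemma lo_mono: "p \<le> q \<Longrightarrow> lo j p \<le> lo j q" unfolding lo_def by simp

lemma le_idx_iff: "p \<le> idx j t \<longleftrightarrow> lo j p \<le> t"
  using idx_lo[of j t "idx j t"] lo_mono[of p "idx j t" j] lo_mono[of "idx j t + 1" p j] by (smt (verit))

lemma idx_le_iff: "idx j t \<le> p \<longleftrightarrow> t < lo j (p + 1)"
  using le_idx_iff[of "p+1" j t] by linarith

lemma lo_Suc: "lo (j + 1) p = lo j (3 * p - 1)"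
  unfolding lo_def by (simp add: power_int_add field_simps)

text \<open>Conformal factor of the inversion, frozen on each shell; its square is the density of
  \<open>warea\<close>.\<close>

definition weight :: "real^2 \<Rightarrow> ennreal" where "weight x = ennreal (1 / 9 ^ shell x)"

abbreviation mass :: "(real^2 \<Rightarrow> ennreal) \<Rightarrow> (real^2) set \<Rightarrow> ennreal" where
  "mass v A \<equiv> \<integral>\<^sup>+x\<in>A. v x \<partial>lebesgue"

abbreviation wmass :: "(real^2 \<Rightarrow> ennreal) \<Rightarrow> (real^2) set \<Rightarrow> ennreal" where
  "wmass p A \<equiv> \<integral>\<^sup>+y\<in>A. p y * weight y \<partial>lebesgue"

abbreviation energy :: "(real^2 \<Rightarrow> ennreal) \<Rightarrow> (real^2) set \<Rightarrow> ennreal" where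
  "energy f A \<equiv> \<integral>\<^sup>+x\<in>A. (f x)\<^sup>2 \<partial>lebesgue"

abbreviation pot_energy :: "(real^2 \<Rightarrow> ennreal) \<Rightarrow> (real^2 \<Rightarrow> complex) \<Rightarrow> (real^2) set \<Rightarrow> ennreal" where
  "pot_energy v u A \<equiv> \<integral>\<^sup>+x\<in>A. v x * (ennreal (norm (u x)))\<^sup>2 \<partial>lebesgue"

abbreviation potential :: "nat \<Rightarrow> (real^2 \<Rightarrow> ennreal) \<Rightarrow> real^2 \<Rightarrow> ennreal" where
  "potential n p x \<equiv> (\<Sum>i. 3 ^ (n + i) * wmass p (cell (n + i) x))"

lemma shell_measurable_lebesgue [measurable]: "shell \<in> lebesgue \<rightarrow>\<^sub>M count_space UNIV"
  by (rule measurable_completion) simp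

lemma weight_measurable [measurable]: "weight \<in> borel_measurable lebesgue"
  unfolding weight_def by measurable

lemma cell_sets_lebesgue [measurable]: "cell n x \<in> sets lebesgue" using cell_sets by simp

lemma square_sets_lebesgue [measurable]: "square j p \<in> sets lebesgue" using square_sets by simp

text \<open>A cell is represented by the mean over a square inside it: a square by itself, an unbounded cell of level \<open>n\<close>
  by its child of side \<open>3\<^sup>n\<^sup>-\<^sup>1\<close> to the right of the removed square.\<close>

definition ref_level :: "nat \<Rightarrow> real^2 \<Rightarrow> int" where
  "ref_level n x = (if shell x < n then 2 * int (shell x) - int n else int n - 1)"

definition ref_index :: "nat \<Rightarrow> real^2 \<Rightarrow> int^2" where
  "ref_index n x = (if shell x < n then (\<chi> i. idx (2 * int (shell x) - int n) (x$i)) else axis 1 1)"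

definition ref :: "nat \<Rightarrow> real^2 \<Rightarrow> (real^2) set" where
  "ref n x = square (ref_level n x) (ref_index n x)"

lemma slab_swap: "slab 2 1 c d a b = slab 1 2 a b c d" "cslab 2 1 c d a b = cslab 1 2 a b c d"
  by (auto simp: slab_def cslab_def)

lemma square_slab:
  "slab 1 2 (lo j (p$1)) (lo j (p$1 + 1)) (lo j (p$2)) (lo j (p$2 + 1)) \<subseteq> square j p"
  "square j p \<subseteq> cslab 1 2 (lo j (p$1)) (lo j (p$1 + 1)) (lo j (p$2)) (lo j (p$2 + 1))"
  by (auto simp: slab_def cslab_def square_def forall_2 idx_lo)

lemma emeasure_cslab:
  assumes "a \<le> b" "c \<le> d"
  shows "emeasure lebesgue (cslab 1 2 a b c d) = ennreal ((b - a) * (d - c))"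
proof -
  let ?a = "(\<chi> l. if l = 1 then a else c) :: real^2" and ?b = "(\<chi> l. if l = 1 then b else d) :: real^2"
  have ne: "cbox ?a ?b \<noteq> {}" using assms by (auto simp: interval_ne_empty_cart)
  have "emeasure lebesgue (cslab 1 2 a b c d) = emeasure lborel (cbox ?a ?b)"
    by (simp add: slab_eq_box)
  also have "\<dots> = ennreal (measure lborel (cbox ?a ?b))"
    by (intro emeasure_eq_ennreal_measure) (use emeasure_lborel_cbox_finite[of ?a ?b] in auto)
  also have "measure lborel (cbox ?a ?b) = (b - a) * (d - c)"
    using content_cbox_cart[OF ne] by (simp add: UNIV_2)
  finally show ?thesis .
qed

text \<open>All that is used of a Sobolev function: \<open>f\<close> majorises the gradient in the
  sense of differences of means over rectangles. Everything up to the count of functionals is proved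
  for such pairs, without weak derivatives.\<close>

locale grad_pair =
  fixes u :: "real^2 \<Rightarrow> complex" and f :: "real^2 \<Rightarrow> ennreal"
  assumes u: "sq_integrable u" and f [measurable]: "f \<in> borel_measurable lebesgue"
    and fin: "(\<integral>\<^sup>+x. (f x)\<^sup>2 \<partial>lebesgue) < \<infinity>"
    and slab_diff: "\<And>i k a b a' b' c d. i \<noteq> k \<Longrightarrow> a < b \<Longrightarrow> a' < b' \<Longrightarrow> c < d \<Longrightarrow>
       ennreal (norm ((LINT x:slab i k a b c d|lebesgue. u x) / of_real (b - a)
            - (LINT x:slab i k a' b' c d|lebesgue. u x) / of_real (b' - a')))
         \<le> (\<integral>\<^sup>+x\<in>cslab i k (min a a') (max b b') c d. f x \<partial>lebesgue)"
begin

section \<open>Differences of means over rectangles and squares\<close>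

definition slab_mean :: "real \<Rightarrow> real \<Rightarrow> real \<Rightarrow> real \<Rightarrow> complex" where
  "slab_mean a b c d = (LINT x:slab 1 2 a b c d|lebesgue. u x) / of_real ((b - a) * (d - c))"

definition ref_mean :: "nat \<Rightarrow> real^2 \<Rightarrow> complex" where
  "ref_mean n x = (LINT y:ref n x|lebesgue. u y) / of_real (9 powi ref_level n x)"

lemma nn_integral_cslab_le:
  assumes "slab 1 2 a b c d \<subseteq> S" "S \<in> sets lebesgue"
  shows "(\<integral>\<^sup>+x\<in>cslab 1 2 a b c d. f x \<partial>lebesgue) \<le> mass f S"
proof (rule nn_integral_mono_AE)
  show "AE x in lebesgue. f x * indicator (cslab 1 2 a b c d) x \<le> f x * indicator S x"
    using AE_cslab_slab[of 1 2 a b c d, simplified] by eventually_elim (use assms in \<open>auto simp: indicator_def\<close>)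
qed

lemma norm_quotient_le:
  fixes z :: complex
  assumes "0 < l" "l \<le> h" "ennreal (norm z) \<le> c"
  shows "ennreal (norm (z / of_real h)) \<le> ennreal (1 / l) * c"
proof -
  have "norm (z / of_real h) \<le> (1 / l) * norm z" using assms by (simp add: norm_divide frac_le)
  then have "ennreal (norm (z / of_real h)) \<le> ennreal (1 / l) * ennreal (norm z)"
    using assms by (subst ennreal_mult[symmetric]) (auto intro: ennreal_leI)
  also have "\<dots> \<le> ennreal (1 / l) * c" using assms by (intro mult_left_mono) auto
  finally show ?thesis .
qed

lemma slab_mean_diff_1:
  assumes "a < b" "a' < b'" "c < d" "0 < l" "l \<le> d - c"
    "slab 1 2 (min a a') (max b b') c d \<subseteq> S" "S \<in> sets lebesgue"
  shows "ennreal (norm (slab_mean a b c d - slab_mean a' b' c d)) \<le> ennreal (1 / l) * mass f S"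
proof -
  have "slab_mean a b c d - slab_mean a' b' c d = ((LINT x:slab 1 2 a b c d|lebesgue. u x) / of_real (b - a)
      - (LINT x:slab 1 2 a' b' c d|lebesgue. u x) / of_real (b' - a')) / of_real (d - c)"
    unfolding slab_mean_def by (simp add: diff_divide_distrib)
  then show ?thesis
    using assms order_trans[OF slab_diff[of 1 2 a b a' b' c d] nn_integral_cslab_le, of S]
    by (simp only:) (intro norm_quotient_le, auto)
qed

lemma slab_mean_diff_2:
  assumes "a < b" "c < d" "c' < d'" "0 < l" "l \<le> b - a"
    "slab 1 2 a b (min c c') (max d d') \<subseteq> S" "S \<in> sets lebesgue"
  shows "ennreal (norm (slab_mean a b c d - slab_mean a b c' d')) \<le> ennreal (1 / l) * mass f S"
proof -
  have "slab_mean a b c d - slab_mean a b c' d' = ((LINT x:slab 1 2 a b c d|lebesgue. u x) / of_real (d - c)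
      - (LINT x:slab 1 2 a b c' d'|lebesgue. u x) / of_real (d' - c')) / of_real (b - a)"
    unfolding slab_mean_def by (simp add: diff_divide_distrib mult.commute)
  then show ?thesis
    using assms order_trans[OF slab_diff[of 2 1 c d c' d' a b, unfolded slab_swap] nn_integral_cslab_le, of S]
    by (simp only:) (intro norm_quotient_le, auto)
qed

lemma ennreal_norm_triangle: "ennreal (norm (x - z)) \<le> ennreal (norm (x - y)) + ennreal (norm (y - (z::complex)))"
  by (simp add: dist_triangle flip: dist_norm ennreal_plus)

text \<open>Two moves at right angles through the rectangle (a',b') x (c,d): hence two swept strips
  in the hypotheses and the factor 2.\<close>

lemma slab_mean_diff:
  assumes "0 < l" "l \<le> b - a" "l \<le> b' - a'" "l \<le> d - c" "l \<le> d' - c'" "S \<in> sets lebesgue"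
    "slab 1 2 (min a a') (max b b') c d \<subseteq> S" "slab 1 2 a' b' (min c c') (max d d') \<subseteq> S"
  shows "ennreal (norm (slab_mean a b c d - slab_mean a' b' c' d')) \<le> ennreal (2 / l) * mass f S"
proof -
  have "ennreal (norm (slab_mean a b c d - slab_mean a' b' c' d'))
      \<le> ennreal (norm (slab_mean a b c d - slab_mean a' b' c d)) + ennreal (norm (slab_mean a' b' c d
          - slab_mean a' b' c' d'))"
    by (rule ennreal_norm_triangle)
  also have "\<dots> \<le> ennreal (1 / l) * mass f S + ennreal (1 / l) * mass f S"
    using assms by (intro add_mono slab_mean_diff_1 slab_mean_diff_2) auto
  also have "\<dots> = ennreal (2 / l) * mass f S"
    using assms(1) by (simp flip: distrib_right ennreal_plus)
  finally show ?thesis .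
qed

definition square_mean :: "int \<Rightarrow> int \<Rightarrow> int \<Rightarrow> complex" where
  "square_mean j p q = slab_mean (lo j p) (lo j (p + 1)) (lo j q) (lo j (q + 1))"

lemma square_mean_eq: "(LINT y:square j p|lebesgue. u y) / of_real (9 powi j) = square_mean j (p$1) (p$2)"
proof -
  have "(LINT y:square j p|lebesgue. u y) = (LINT y:slab 1 2 (lo j (p$1)) (lo j (p$1
      + 1)) (lo j (p$2)) (lo j (p$2 + 1))|lebesgue. u y)"
    using u square_slab by (intro set_integral_eq_slab) (auto simp: sq_integrable_def)
  moreover have "(9::real) powi j = (lo j (p$1+1) - lo j (p$1)) * (lo j (p$2+1) - lo j (p$2))"
    unfolding lo_diff by (simp flip: power_int_mult_distrib)
  ultimately show ?thesis unfolding square_mean_def slab_mean_def by simp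
qed

lemma ref_mean_eq: "ref_mean n x = (if shell x < n then square_mean (2 * int (shell x)
    - int n) (idx (2 * int (shell x) - int n) (x$1)) (idx (2 * int (shell x) - int n) (x$2))
    else square_mean (int n - 1) 1 0)"
  unfolding ref_mean_def ref_def square_mean_eq by (simp add: ref_level_def ref_index_def axis_def)

text \<open>The L-shaped route in terms of indices: along row \<open>q\<close> to column
  \<open>p'\<close>, then along that column to row \<open>q'\<close>.\<close>

lemma square_mean_diff:
  assumes "S \<in> sets lebesgue"
    "\<And>x. \<lbrakk>min p p' \<le> idx j (x$1); idx j (x$1) \<le> max p p'; idx j (x$2) = q\<rbrakk> \<Longrightarrow> x \<in> S"
    "\<And>x. \<lbrakk>idx j (x$1) = p'; min q q' \<le> idx j (x$2); idx j (x$2) \<le> max q q'\<rbrakk> \<Longrightarrow> x \<in> S"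
  shows "ennreal (norm (square_mean j p q - square_mean j p' q')) \<le> ennreal (2 / 3 powi j) * mass f S"
  unfolding square_mean_def
proof (rule slab_mean_diff)
  have mm: "min (lo j p) (lo j p') = lo j (min p p')" "max (lo j (p + 1)) (lo j (p' + 1)) = lo j (max p p'
      + 1)" for p p'
    using lo_mono[of p p' j] lo_mono[of p' p j] lo_mono[of "p+1" "p'+1" j] lo_mono[of "p'+1" "p+1" j]
    by (auto simp: min_def max_def)
  show "slab 1 2 (min (lo j p) (lo j p')) (max (lo j (p + 1)) (lo j (p' + 1))) (lo j q) (lo j (q + 1)) \<subseteq> S"
    unfolding mm slab_def using assms(2) by (auto simp: le_idx_iff idx_le_iff idx_lo)
  show "slab 1 2 (lo j p') (lo j (p' + 1)) (min (lo j q) (lo j q')) (max (lo j (q + 1)) (lo j (q' + 1))) \<subseteq> S"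
    unfolding mm slab_def using assms(3) by (auto simp: le_idx_iff idx_le_iff idx_lo)
qed (use assms(1) in \<open>auto simp: lo_diff\<close>)

text \<open>Inserting the weight costs 9^m when shells up to \<open>m\<close> are reached, so the
  routes between reference squares must stay in low shells.\<close>

lemma integral_cell_weight:
  assumes "S \<subseteq> cell n x" "\<And>y. y \<in> S \<Longrightarrow> shell y \<le> m" "S \<in> sets lebesgue"
  shows "mass f S \<le> ennreal (9 ^ m) * wmass f (cell n x)"
proof -
  have "mass f S \<le> (\<integral>\<^sup>+y. ennreal (9 ^ m) * (f y * weight y * indicator (cell n x) y) \<partial>lebesgue)"
  proof (rule nn_integral_mono)
    fix y :: "real^2"
    show "f y * indicator S y \<le> ennreal (9 ^ m) * (f y * weight y * indicator (cell n x) y)"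
    proof (cases "y \<in> S")
      case True
      have "1 \<le> 9 ^ m * (1 / 9 ^ shell y :: real)"
        using power_increasing[OF assms(2)[OF True], of "9::real"] by (simp add: field_simps)
      then have "1 \<le> ennreal (9 ^ m) * weight y"
        unfolding weight_def by (subst ennreal_mult[symmetric]) auto
      then have "f y * 1 \<le> f y * (ennreal (9 ^ m) * weight y)" by (rule mult_left_mono) simp
      with True assms(1) show ?thesis by (auto simp: indicator_def ac_simps)
    qed simp
  qed
  also have "\<dots> = ennreal (9 ^ m) * wmass f (cell n x)"
    by (rule nn_integral_cmult) measurable
  finally show ?thesis .
qed

text \<open>The cases are a square and its child, an unbounded cell and a square of its innermost
  shell, and two consecutive unbounded cells. They give the factors 6, 12 and 54. The last is 2 * 3
  * 9: reference side 3^(n-1), and a route that reaches one shell further.\<close>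

lemma ref_mean_step:
  "ennreal (norm (ref_mean n x - ref_mean (Suc n) x)) \<le> 54 * 3 ^ n * wmass f (cell n x)"
proof -
  have *: "ennreal (norm (ref_mean n x - ref_mean (Suc n) x)) \<le> 54 * 3 ^ n * wmass f (cell n x)"
    if "ennreal (norm (ref_mean n x - ref_mean (Suc n) x)) \<le> ennreal c * mass f S" "0 \<le> c"
      "S \<subseteq> cell n x" "\<And>y. y \<in> S \<Longrightarrow> shell y \<le> m" "S \<in> sets lebesgue" "c * 9 ^ m \<le> 54 * 3 ^ n" for c S m
  proof -
    have "ennreal (norm (ref_mean n x - ref_mean (Suc n) x)) \<le> ennreal c * (ennreal (9 ^ m) * wmass f (cell n x))"
      by (rule order_trans[OF that(1)]) (intro mult_left_mono integral_cell_weight that(3,4,5), auto)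
    also have "\<dots> = ennreal (c * 9 ^ m) * wmass f (cell n x)"
      using that(2) by (simp add: ennreal_mult mult.assoc)
    also have "\<dots> \<le> ennreal (54 * 3 ^ n) * wmass f (cell n x)"
      using that(6) by (intro mult_right_mono ennreal_leI) auto
    also have "ennreal (54 * 3 ^ n) = 54 * 3 ^ n"
      by (simp add: ennreal_mult flip: ennreal_power)
    finally show ?thesis .
  qed
  consider "shell x < n" | "shell x = n" | "n < shell x" by linarith
  then show ?thesis
  proof cases
    case 1
    define j where "j = 2 * int (shell x) - int (Suc n)"
    have j1: "2 * int (shell x) - int n = j + 1" by (simp add: j_def)
    define P where "P = idx (j+1) (x$1)"
    define Q where "Q = idx (j+1) (x$2)"
    define p where "p = idx j (x$1)"
    define q where "q = idx j (x$2)"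
    have Pp: "P = (p + 1) div 3" "Q = (q + 1) div 3" unfolding P_def Q_def p_def q_def by (auto simp: idx_plus1)
    have cell: "cell n x = {y. idx (j+1) (y$1) = P \<and> idx (j+1) (y$2) = Q}"
      using 1 by (auto simp: cell_def j1 forall_2 P_def Q_def)
    have ref_mean: "ref_mean n x = square_mean (j+1) P Q" "ref_mean (Suc n) x = square_mean j p q"
      using 1 unfolding ref_mean_eq j1 by (auto simp: P_def Q_def p_def q_def j_def)
    have b: "lo (j+1) P \<le> lo j p" "lo j (p+1) \<le> lo (j+1) (P+1)" "lo (j+1) Q \<le> lo j q" "lo j (q+1) \<le> lo (j+1) (Q+1)"
      unfolding lo_Suc Pp by (intro lo_mono; presburger)+
    show ?thesis
    proof (rule *[where m = "shell x"])
      show "ennreal (norm (ref_mean n x - ref_mean (Suc n) x)) \<le> ennreal (2 / 3 powi j) * mass f (cell n x)"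
        unfolding ref_mean unfolding square_mean_def
      proof (rule slab_mean_diff)
        show "slab 1 2 (min (lo (j+1) P) (lo j p)) (max (lo (j+1) (P+1)) (lo j (p+1))) (lo (j+1) Q) (lo (j+1)
            (Q+1)) \<subseteq> cell n x"
          using b unfolding cell slab_def idx_lo by (auto simp: min_def max_def)
        show "slab 1 2 (lo j p) (lo j (p+1)) (min (lo (j+1) Q) (lo j q)) (max (lo (j+1) (Q+1)) (lo j (q+1))) \<subseteq>
            cell n x"
          using b unfolding cell slab_def idx_lo by (auto simp: min_def max_def)
      qed (auto simp: lo_diff power_int_add)
      show "shell y \<le> shell x" if "y \<in> cell n x" for y using cell_shell[OF that] 1 by simp
      have "(9::real) ^ shell x = (3 ^ shell x)\<^sup>2"
        by (simp add: power2_eq_square flip: power_mult_distrib)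
      then have "2 / 3 powi j * 9 ^ shell x = (6 * 3 ^ n :: real)"
        unfolding j_def by (simp add: power_int_diff power_int_add power_int_mult field_simps)
      then show "2 / 3 powi j * 9 ^ shell x \<le> (54 * 3 ^ n :: real)" by simp
    qed auto
  next
    case 2
    define j where "j = int n - 1"
    define p where "p = idx j (x$1)"
    define q where "q = idx j (x$2)"
    define S where "S = {y. shell y = n}"
    have S: "S \<in> sets lebesgue"
    proof -
      have "S = shell -` {n} \<inter> space lebesgue" by (auto simp: S_def)
      then show ?thesis using measurable_sets[OF shell_measurable_lebesgue, of "{n}"] by simp
    qed
    have S_iff: "y \<in> S \<longleftrightarrow> (idx j (y$1) + 1) div 3 = 0 \<and> (idx j (y$2) + 1) div 3 = 0 \<and> (n
        = 0 \<or> idx j (y$1) \<noteq> 0 \<or> idx j (y$2) \<noteq> 0)" for y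
    proof -
      have "shell y = n \<longleftrightarrow> shell y \<le> n \<and> (n = 0 \<or> \<not> shell y \<le> n - 1)" by auto
      moreover have "shell y \<le> n \<longleftrightarrow> (idx j (y$1) + 1) div 3 = 0 \<and> (idx j (y$2) + 1) div 3 = 0"
        unfolding shell_le_iff j_def forall_2 using idx_plus1[of "int n - 1"] by simp
      moreover have "shell y \<le> n - 1 \<longleftrightarrow> idx j (y$1) = 0 \<and> idx j (y$2) = 0" if "n \<noteq> 0"
        using that unfolding shell_le_iff j_def forall_2 by (simp add: of_nat_diff)
      ultimately show ?thesis unfolding S_def mem_Collect_eq by (cases "n = 0") auto
    qed
    have "x \<in> S" using 2 by (simp add: S_def)
    then have pq: "p \<in> {-1,0,1}" "q \<in> {-1,0,1}" "n = 0 \<or> p \<noteq> 0 \<or> q \<noteq> 0"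
      unfolding S_iff p_def[symmetric] q_def[symmetric] by auto
    have d3: "(r + 1) div 3 = 0 \<longleftrightarrow> -1 \<le> r \<and> r \<le> 1" for r :: int by auto
    have ref_mean: "ref_mean n x = square_mean j 1 0" "ref_mean (Suc n) x = square_mean j p q"
      using 2 unfolding ref_mean_eq by (auto simp: p_def q_def j_def)
    \<comment> \<open>The squares of shell \<open>n\<close> have indices in {-1,0,1}^2, without the
      centre unless n = 0, and the route to the reference square (1,0) has to avoid that removed
      centre. Only from (-1,0) is the L-shaped route blocked; a detour over (-1,1) doubles the
      constant.\<close>
    have main: "ennreal (norm (square_mean j 1 0 - square_mean j p q)) \<le> ennreal (4 / 3 powi j) * mass f S"
    proof -
      have two: "ennreal (norm (square_mean j a b - square_mean j a' b')) \<le> ennreal (4 / 3 powi j) * mass f S"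
        if "ennreal (norm (square_mean j a b - square_mean j a' b')) \<le> ennreal (2 / 3 powi j) * mass f S" for a
            b a' b'
        by (rule order_trans[OF that]) (intro mult_right_mono ennreal_leI divide_right_mono; simp)
      have row: "ennreal (norm (square_mean j 1 0 - square_mean j p' q')) \<le> ennreal (2 / 3 powi j) * mass f S"
        if "p' \<in> {-1,0,1}" "q' \<in> {-1,1}" for p' q'
      proof -
        have "ennreal (norm (square_mean j p' q' - square_mean j 1 0)) \<le> ennreal (2 / 3 powi j) * mass f S"
          using that by (intro square_mean_diff S) (auto simp: S_iff d3)
        then show ?thesis by (simp add: norm_minus_commute)
      qed
      consider "q \<noteq> 0" | "n = 0" "q = 0" | "q = 0" "p = 1" | "q = 0" "p = -1" using pq by auto
      then show ?thesis
      proof cases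
        case 1 then show ?thesis using pq by (intro two row) auto
      next
        case 2 then show ?thesis using pq by (intro two square_mean_diff S) (auto simp: S_iff d3)
      next
        case 3 then show ?thesis by simp
      next
        case 4
        have "ennreal (norm (square_mean j 1 0 - square_mean j p q)) \<le> ennreal (norm (square_mean j 1 0
            - square_mean j (-1) 1)) + ennreal (norm (square_mean j (-1) 1 - square_mean j p q))"
          by (rule ennreal_norm_triangle)
        also have "\<dots> \<le> ennreal (2 / 3 powi j) * mass f S + ennreal (2 / 3 powi j) * mass f S"
          using 4 by (intro add_mono row square_mean_diff S) (auto simp: S_iff d3)
        also have "\<dots> = ennreal (4 / 3 powi j) * mass f S"
          by (simp flip: distrib_right ennreal_plus)
        finally show ?thesis .
      qed
    qed
    show ?thesis
    proof (rule *[where m = n and S = S and c = "4 / 3 powi j"])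
      show "ennreal (norm (ref_mean n x - ref_mean (Suc n) x)) \<le> ennreal (4 / 3 powi j) * mass f S"
        using main unfolding ref_mean .
      show "S \<subseteq> cell n x" using 2 by (auto simp: S_def cell_def)
      have "4 / 3 powi j * 9 ^ n = (12 * 3 ^ n :: real)"
        unfolding j_def by (simp add: power_int_diff field_simps flip: power_mult_distrib)
      then show "4 / 3 powi j * 9 ^ n \<le> (54 * 3 ^ n :: real)" by simp
    qed (auto simp: S_def S)
  next
    case 3
    define j where "j = int n - 1"
    \<comment> \<open>The two reference squares have sides 3^(n-1) and 3^n; they and the strips
      swept between them lie in shells n and n + 1.\<close>
    define S where "S = {y. n \<le> shell y \<and> shell y \<le> Suc n}"
    have S: "S \<in> sets lebesgue"
    proof -
      have "S = shell -` {n..Suc n} \<inter> space lebesgue" by (auto simp: S_def)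
      then show ?thesis using measurable_sets[OF shell_measurable_lebesgue, of "{n..Suc n}"] by simp
    qed
    have ref_mean: "ref_mean n x = square_mean j 1 0" "ref_mean (Suc n) x = square_mean (j+1) 1 0"
      using 3 unfolding ref_mean_eq by (auto simp: j_def)
    have inS: "y \<in> S" if "1 \<le> idx j (y$1)" "idx (j + 1) (y$1) \<le> 1" "idx (j+1) (y$2) = 0" for y
    proof -
      have "n = 0 \<or> \<not> shell y \<le> n - 1"
        using that(1) unfolding shell_le_iff j_def by (cases n) (auto intro!: exI[of _ 1])
      moreover have "0 \<le> idx (j+1) (y$1)" using that(1) by (simp add: idx_plus1)
      then have "idx (j + 1 + 1) (y$1) = 0 \<and> idx (j + 1 + 1) (y$2) = 0"
        unfolding idx_plus1[of "j+1"] using that by auto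
      then have "shell y \<le> Suc n" unfolding shell_le_iff forall_2 j_def by (simp add: algebra_simps)
      ultimately show ?thesis unfolding S_def by auto
    qed
    show ?thesis
    proof (rule *[where m = "Suc n" and S = S and c = "2 / 3 powi j"])
      show "ennreal (norm (ref_mean n x - ref_mean (Suc n) x)) \<le> ennreal (2 / 3 powi j) * mass f S"
        unfolding ref_mean unfolding square_mean_def
      proof (rule slab_mean_diff)
        have b: "lo j 1 \<le> lo (j+1) 1" "lo j (1+1) \<le> lo (j+1) (1+1)" "lo (j+1) 0 \<le> lo j 0" "lo j (0+1)
            \<le> lo (j+1) (0+1)"
          unfolding lo_Suc by (intro lo_mono; simp)+
        show "slab 1 2 (min (lo j 1) (lo (j + 1) 1)) (max (lo j (1 + 1)) (lo (j + 1) (1 + 1))) (lo j 0) (lo j (0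
            + 1)) \<subseteq> S"
          using b by (auto simp: slab_def le_idx_iff idx_le_iff idx_lo intro!: inS)
        show "slab 1 2 (lo (j + 1) 1) (lo (j + 1) (1 + 1)) (min (lo j 0) (lo (j + 1) 0)) (max (lo j (0
            + 1)) (lo (j + 1) (0 + 1))) \<subseteq> S"
          using b by (auto simp: slab_def le_idx_iff idx_le_iff idx_lo intro!: inS)
      qed (auto simp: lo_def power_int_add algebra_simps S)
      show "S \<subseteq> cell n x" using 3 by (auto simp: S_def cell_def)
      have "2 / 3 powi j * 9 ^ Suc n = (54 * 3 ^ n :: real)"
        unfolding j_def by (simp add: power_int_diff field_simps flip: power_mult_distrib)
      then show "2 / 3 powi j * 9 ^ Suc n \<le> (54 * 3 ^ n :: real)" by simp
    qed (auto simp: S_def S)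
  qed
qed

text \<open>The differentiation theorem in the library concerns squares with lower left corner \<open>x\<close>. Their means differ
  from those over the cells by \<open>O(l\<^sup>-\<^sup>1 \<integral>\<^sub>D f) = O((\<integral>\<^sub>D f\<^sup>2)\<^sup>1\<^sup>/\<^sup>2)\<close>, which vanishes as \<open>D\<close> shrinks to \<open>x\<close>.\<close>

lemma ref_mean_tendsto: "AE x in lebesgue. (\<lambda>m. ref_mean m x) \<longlonglongrightarrow> u x"
proof -
  have ih: "set_integrable lebesgue (cslab 1 2 a b c d) u" for a b c d
    by (intro sq_integrable_set_integrable u slab_sets cslab_finite) auto
  have "u integrable_on cbox a b" for a b
  proof -
    have "cbox a b = cslab 1 2 (a$1) (b$1) (a$2) (b$2)"
      by (auto simp: mem_box_cart cslab_def forall_2)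
    then show ?thesis using set_lebesgue_integral_eq_integral(1)[OF ih] by simp
  qed
  then obtain N where N: "negligible N"
      "\<And>x e. \<lbrakk>x \<notin> N; 0 < e\<rbrakk> \<Longrightarrow> \<exists>d>0. \<forall>t. 0 < t \<and> t < d \<longrightarrow>
         norm (integral (cbox x (x + t *\<^sub>R One)) u /\<^sub>R t ^ DIM(real^2) - u x) < e"
    using integrable_ccontinuous_explicit[of u] by blast
  have "(\<lambda>m. ref_mean m x) \<longlonglongrightarrow> u x" if x: "x \<notin> N" for x
  proof -
    define l where "l m = (3::real) powi (2 * int (shell x) - int m)" for m
    have l_pos: "0 < l m" for m by (simp add: l_def)
    have "l = (\<lambda>m. 3 ^ (2 * shell x) * (1/3) ^ m)"
      unfolding l_def by (rule ext) (simp add: power_int_diff power_int_mult power_mult power_one_over)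
    moreover have "(\<lambda>m. 3 ^ (2 * shell x) * (1/3) ^ m :: real) \<longlonglongrightarrow> 3 ^ (2 * shell x) * 0"
      by (intro tendsto_intros LIMSEQ_power_zero) auto
    ultimately have l0: "l \<longlonglongrightarrow> 0" by simp
    define A where "A m = slab_mean (x$1) (x$1 + l m) (x$2) (x$2 + l m)" for m
    have A_eq: "integral (cbox x (x + t *\<^sub>R One)) u /\<^sub>R t ^ DIM(real^2) = slab_mean (x$1) (x$1 + t) (x$2) (x$2
        + t)" if "0 < t" for t
    proof -
      have "integral (cbox x (x + t *\<^sub>R One)) u = (LINT y:cslab 1 2 (x$1) (x$1 + t) (x$2) (x$2 + t)|lebesgue. u y)"
        unfolding cbox_One using set_lebesgue_integral_eq_integral(2)[OF ih] by simp
      also have "\<dots> = (LINT y:slab 1 2 (x$1) (x$1 + t) (x$2) (x$2 + t)|lebesgue. u y)"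
        using u by (intro set_integral_eq_slab slab_sets) (auto simp: sq_integrable_def slab_def cslab_def)
      finally show ?thesis unfolding slab_mean_def
        by (simp add: power2_eq_square scaleR_conv_of_real divide_inverse mult.commute)
    qed
    have "A \<longlonglongrightarrow> u x"
    proof (rule LIMSEQ_I)
      fix e :: real assume "0 < e"
      from N(2)[OF x this] obtain d where d: "d > 0"
        "\<And>t. 0 < t \<Longrightarrow> t < d \<Longrightarrow> norm (integral (cbox x (x + t *\<^sub>R One)) u /\<^sub>R t ^ DIM(real^2) - u x) < e" by blast
      from order_tendstoD(2)[OF l0 d(1)] obtain n0 where "\<And>m. n0 \<le> m \<Longrightarrow> l m < d"
        by (auto simp: eventually_sequentially)
      then have "norm (A m - u x) < e" if "n0 \<le> m" for m
        using d(2)[OF l_pos[of m]] that A_eq[OF l_pos[of m]] by (simp add: A_def)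
      then show "\<exists>n0. \<forall>m\<ge>n0. norm (A m - u x) < e" by blast
    qed
    moreover have "(\<lambda>m. ref_mean m x - A m) \<longlonglongrightarrow> 0"
    proof -
      define D where "D m = cslab 1 2 (x$1 - l m) (x$1 + l m) (x$2 - l m) (x$2 + l m)" for m
      have D[measurable]: "D m \<in> sets lebesgue" for m unfolding D_def by (intro slab_sets) simp
      \<comment> \<open>Cauchy-Schwarz on the square \<open>D m\<close> of side 2l turns the factor
        2/l into (2/l)^2 * (2l)^2 = 16.\<close>
      have bound: "ennreal ((norm (ref_mean m x - A m))\<^sup>2) \<le> 16 * energy f (D m)" if m: "shell x < m" for m
      proof -
        define j where "j = 2 * int (shell x) - int m"
        define p where "p = idx j (x$1)"
        define q where "q = idx j (x$2)"
        have lj: "l m = 3 powi j" by (simp add: l_def j_def)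
        have ref_mean: "ref_mean m x = square_mean j p q" using m by (simp add: ref_mean_eq p_def q_def j_def)
        have b: "lo j p \<le> x$1" "x$1 < lo j (p+1)" "lo j q \<le> x$2" "x$2 < lo j (q+1)"
          using idx_lo[of j "x$1" p] idx_lo[of j "x$2" q] by (auto simp: p_def q_def)
        have d: "lo j (p+1) = lo j p + l m" "lo j (q+1) = lo j q + l m"
          using lo_diff[of j p] lo_diff[of j q] unfolding lj by linarith+
        have "ennreal (norm (ref_mean m x - A m)) \<le> ennreal (2 / l m) * mass f (D m)"
          unfolding ref_mean A_def unfolding square_mean_def
          by (rule slab_mean_diff) (use b d l_pos[of m] in \<open>auto simp: D_def slab_def cslab_def min_def max_def
              split: if_splits\<close>)
        then have "(ennreal (norm (ref_mean m x - A m)))\<^sup>2 \<le> (ennreal (2 / l m))\<^sup>2 * (mass f (D m))\<^sup>2"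
          by (metis power_mono power_mult_distrib zero_le)
        also have "(mass f (D m))\<^sup>2 = (\<integral>\<^sup>+y. (f y * indicator (D m) y) * indicator (D m) y \<partial>lebesgue)\<^sup>2"
          by (intro arg_cong[where f = "\<lambda>t. t\<^sup>2"] nn_integral_cong) (auto simp: indicator_def)
        also have "(ennreal (2 / l m))\<^sup>2 * \<dots> \<le> (ennreal (2 / l m))\<^sup>2 * ((\<integral>\<^sup>+y. (f y * indicator (D m) y)\<^sup>2
            \<partial>lebesgue) * (\<integral>\<^sup>+y. (indicator (D m) y)\<^sup>2 \<partial>lebesgue))"
          by (intro mult_left_mono Cauchy_Schwarz_nn_integral) measurable
        also have "(\<integral>\<^sup>+y. (f y * indicator (D m) y)\<^sup>2 \<partial>lebesgue) = energy f (D m)"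
          by (intro nn_integral_cong) (auto simp: indicator_def)
        also have "(\<integral>\<^sup>+y. (indicator (D m) y)\<^sup>2 \<partial>lebesgue) = emeasure lebesgue (D m)"
          by (simp add: power2_eq_square flip: indicator_inter_arith)
        also have "\<dots> = ennreal (4 * (l m)\<^sup>2)"
          unfolding D_def using l_pos[of m] by (subst emeasure_cslab) (auto simp: power2_eq_square algebra_simps)
        also have "(ennreal (2 / l m))\<^sup>2 * ((energy f (D m)) * ennreal (4 * (l m)\<^sup>2))
            = ennreal ((2 / l m)\<^sup>2 * (4 * (l m)\<^sup>2)) * energy f (D m)"
          using l_pos[of m] by (simp add: ennreal_mult ennreal_power ac_simps)
        also have "(2 / l m)\<^sup>2 * (4 * (l m)\<^sup>2) = 16"
          using l_pos[of m] by (simp add: power2_eq_square field_simps)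
        finally show ?thesis by (simp add: ennreal_power)
      qed
      have "(\<lambda>m. \<integral>\<^sup>+y\<in>D m. (f y)\<^sup>2 \<partial>lebesgue) \<longlonglongrightarrow> (\<integral>\<^sup>+y. 0 \<partial>(lebesgue :: (real^2) measure))"
      proof (rule nn_integral_dominated_convergence[where w = "\<lambda>y. (f y)\<^sup>2"])
        have "AE y in lebesgue. y \<notin> {x}"
          by (intro AE_not_in) (simp add: negligible_iff_null_sets[symmetric])
        then show "AE y in lebesgue. (\<lambda>m. (f y)\<^sup>2 * indicator (D m) y) \<longlonglongrightarrow> 0"
        proof eventually_elim
          case (elim y)
          then obtain i where "y$i \<noteq> x$i" by (auto simp: vec_eq_iff)
          then have "\<forall>\<^sub>F m in sequentially. l m < \<bar>y$i - x$i\<bar>" by (intro order_tendstoD(2)[OF l0]) auto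
          then have "\<forall>\<^sub>F m in sequentially. (f y)\<^sup>2 * indicator (D m) y = 0"
            by eventually_elim (use exhaust_2[of i] in \<open>auto simp: D_def cslab_def indicator_def\<close>)
          then show ?case by (rule tendsto_eventually)
        qed
      qed (use fin in \<open>auto simp: indicator_def\<close>)
      then have "(\<lambda>m. 16 * energy f (D m)) \<longlonglongrightarrow> 16 * 0"
        by (intro ennreal_tendsto_cmult) auto
      then have lim0: "(\<lambda>m. 16 * energy f (D m)) \<longlonglongrightarrow> 0" by simp
      have "\<forall>\<^sub>F m in sequentially. ennreal ((norm (ref_mean m x - A m))\<^sup>2) \<le> 16 * energy f (D m)"
        using eventually_gt_at_top[of "shell x"] by eventually_elim (rule bound)
      then have "(\<lambda>m. ennreal ((norm (ref_mean m x - A m))\<^sup>2)) \<longlonglongrightarrow> 0"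
        by (intro tendsto_sandwich[OF _ _ tendsto_const lim0]) auto
      then have "(\<lambda>m. (norm (ref_mean m x - A m))\<^sup>2) \<longlonglongrightarrow> 0"
        by (subst (asm) ennreal_tendsto_0_iff) auto
      then have "(\<lambda>m. sqrt ((norm (ref_mean m x - A m))\<^sup>2)) \<longlonglongrightarrow> sqrt 0" by (intro tendsto_intros)
      then show ?thesis by (simp add: tendsto_norm_zero_iff)
    qed
    ultimately have "(\<lambda>m. A m + (ref_mean m x - A m)) \<longlonglongrightarrow> u x + 0" by (intro tendsto_add)
    then show ?thesis by simp
  qed
  moreover have "AE x in lebesgue. x \<notin> N" using N(1) by (intro AE_not_in) (simp add: negligible_iff_null_sets)
  ultimately show ?thesis by auto
qed

text \<open>\<open>ref_mean_step\<close> is summed from level n on and the means converge to u(x);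
  the exceptional set is that of the convergence, hence common to all n.\<close>

lemma pointwise:
  "AE x in lebesgue. \<forall>n. ennreal (norm (u x - ref_mean n x))
     \<le> 54 * potential n f x"
  using ref_mean_tendsto
proof eventually_elim
  case (elim x)
  show ?case
  proof
    fix n
    let ?b = "\<lambda>i. 54 * 3 ^ (n + i) * wmass f (cell (n + i) x)"
    have "ennreal (norm (ref_mean (n + k) x - ref_mean n x)) \<le> (\<Sum>i<k. ?b i)" for k
    proof (induction k)
      case (Suc k)
      have "ennreal (norm (ref_mean (n + Suc k) x - ref_mean n x)) \<le> ennreal (norm (ref_mean (n + Suc k) x
          - ref_mean (n + k) x)) + ennreal (norm (ref_mean (n + k) x - ref_mean n x))"
        by (rule ennreal_norm_triangle)
      also have "\<dots> \<le> ?b k + (\<Sum>i<k. ?b i)"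
        using ref_mean_step[of "n + k" x] Suc by (intro add_mono) (auto simp: norm_minus_commute)
      finally show ?case by (simp add: add.commute)
    qed simp
    then have le: "ennreal (norm (ref_mean (n + k) x - ref_mean n x)) \<le> (\<Sum>i. ?b i)" for k
      by (rule order_trans) (rule sum_le_suminf, auto)
    have "(\<lambda>k. ennreal (norm (ref_mean (n + k) x - ref_mean n x))) \<longlonglongrightarrow> ennreal (norm (u x - ref_mean n x))"
      using LIMSEQ_ignore_initial_segment[OF elim, of n] by (intro tendsto_intros) (simp add: add.commute)
    then have "ennreal (norm (u x - ref_mean n x)) \<le> (\<Sum>i. ?b i)"
      by (rule LIMSEQ_le_const2) (use le in blast)
    also have "\<dots> = 54 * potential n f x"
      unfolding mult.assoc by simp
    finally show "ennreal (norm (u x - ref_mean n x)) \<le> \<dots>" .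
  qed
qed

end

section \<open>The potential operator\<close>

lemma sigma_finite_lebesgue: "sigma_finite_measure (lebesgue :: 'a::euclidean_space measure)"
proof
  show "\<exists>A::'a set set. countable A \<and> A \<subseteq> sets lebesgue \<and> \<Union>A = space lebesgue \<and> (\<forall>a\<in>A. emeasure lebesgue a \<noteq> \<infinity>)"
  proof (intro exI[of _ "range (\<lambda>n::nat. cball 0 (real n))"] conjI ballI)
    show "\<Union>(range (\<lambda>n::nat. cball (0::'a) (real n))) = space lebesgue"
      using real_arch_simple by auto
  qed (use emeasure_lborel_cball_finite in \<open>auto simp: less_top\<close>)
qed

interpretation lebesgue: sigma_finite_measure "lebesgue :: (real^2) measure"
  by (rule sigma_finite_lebesgue)

interpretation lebesgue_pair: pair_sigma_finite "lebesgue :: (real^2) measure" "lebesgue :: (real^2) measure" ..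

interpretation lborel_lebesgue: pair_sigma_finite "lborel :: real measure" "lebesgue :: (real^2) measure" ..

text \<open>Tonelli, with one of the sums read as an integral against counting measure.\<close>

lemma ennreal_suminf_swap: "(\<Sum>i. \<Sum>j. f i j) = (\<Sum>j. \<Sum>i. f i j :: ennreal)"
  for f :: "nat \<Rightarrow> nat \<Rightarrow> ennreal"
  by (subst (1 2) nn_integral_count_space_nat[symmetric], subst nn_integral_suminf[symmetric])
    (auto simp: nn_integral_count_space_nat)

lemma suminf_geometric_third: "(\<Sum>j. ennreal ((1/3) ^ j)) = ennreal (3/2)"
proof -
  have "(\<Sum>j. ennreal ((1/3) ^ j)) = ennreal (\<Sum>j. (1/3::real) ^ j)"
    by (intro suminf_ennreal2 summable_geometric) auto
  also have "(\<Sum>j. (1/3::real) ^ j) = 3/2"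
    by (subst suminf_geometric) auto
  finally show ?thesis .
qed

lemma suminf_geometric_ninth: "(\<Sum>j. ennreal ((1/9) ^ j)) = ennreal (9/8)"
proof -
  have "(\<Sum>j. ennreal ((1/9) ^ j)) = ennreal (\<Sum>j. (1/9::real) ^ j)"
    by (intro suminf_ennreal2 summable_geometric) auto
  also have "(\<Sum>j. (1/9::real) ^ j) = 9/8"
    by (subst suminf_geometric) auto
  finally show ?thesis .
qed

text \<open>For a fixed smaller index the larger one runs through a geometric series of sum 3/2.
  Both orders of i and j give 3, the diagonal being counted twice.\<close>

lemma sum_min_geometric:
  fixes e :: "nat \<Rightarrow> ennreal"
  shows "(\<Sum>i. \<Sum>j. e (min i j) * ennreal ((1/3) ^ (max i j - min i j))) \<le> 3 * (\<Sum>i. e i)"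
proof -
  define c where "c i j = (if i \<le> j then e i * ennreal ((1/3) ^ (j - i)) else 0)" for i j :: nat
  have c: "(\<Sum>j. c i j) = ennreal (3/2) * e i" for i
  proof -
    have "(\<Sum>j. c i j) = (\<Sum>j. c i (j + i)) + (\<Sum>j<i. c i j)"
      by (rule suminf_offset) auto
    also have "\<dots> = (\<Sum>j. e i * ennreal ((1/3) ^ j))" by (simp add: c_def)
    also have "\<dots> = e i * ennreal (3/2)" unfolding ennreal_suminf_cmult suminf_geometric_third ..
    finally show ?thesis by (simp add: mult.commute)
  qed
  have "(\<Sum>i. \<Sum>j. e (min i j) * ennreal ((1/3) ^ (max i j - min i j))) \<le> (\<Sum>i. \<Sum>j. c i j + c j i)"
    by (intro suminf_le allI) (auto simp: c_def min_def max_def)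
  also have "\<dots> = (\<Sum>i. \<Sum>j. c i j) + (\<Sum>i. \<Sum>j. c j i)"
    by (simp add: suminf_add[symmetric])
  also have "(\<Sum>i. \<Sum>j. c j i) = (\<Sum>i. \<Sum>j. c i j)" by (rule ennreal_suminf_swap)
  also have "(\<Sum>i. \<Sum>j. c i j) + (\<Sum>i. \<Sum>j. c i j) = (ennreal (3/2) + ennreal (3/2)) * (\<Sum>i. e i)"
    unfolding c ennreal_suminf_cmult distrib_right ..
  also have "ennreal (3/2) + ennreal (3/2) = 3" by (simp flip: ennreal_plus)
  finally show ?thesis .
qed

section \<open>Area in the spherical weight\<close>

definition warea :: "(real^2) set \<Rightarrow> ennreal" where
  "warea E = (\<integral>\<^sup>+x\<in>E. (weight x)\<^sup>2 \<partial>lebesgue)"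

lemma warea_mono: "A \<subseteq> B \<Longrightarrow> warea A \<le> warea B"
  unfolding warea_def by (intro nn_integral_mono) (auto simp: indicator_def)

lemma warea_union: "A \<in> sets lebesgue \<Longrightarrow> B \<in> sets lebesgue \<Longrightarrow> A \<inter> B = {} \<Longrightarrow> warea (A \<union> B) = warea A + warea B"
  unfolding warea_def by (subst nn_integral_add[symmetric]) (auto simp: indicator_def intro!: nn_integral_cong)

lemma emeasure_cell:
  "shell x < n \<Longrightarrow> emeasure lebesgue (cell n x) = ennreal (9 powi (2 * int (shell x) - int n))"
  by (simp add: cell_square emeasure_square)

lemma weight_sq: "(weight x)\<^sup>2 = ennreal (1 / 9 ^ (2 * shell x))"
  unfolding weight_def power_even_eq by (simp add: ennreal_power power_divide)

lemma warea_square_cell: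
  assumes "shell x < n"
  shows "warea (cell n x) = ennreal ((1/9) ^ n)"
proof -
  have "warea (cell n x) = (\<integral>\<^sup>+y. ennreal (1 / 9 ^ (2 * shell x)) * indicator (cell n x) y \<partial>lebesgue)"
    unfolding warea_def using cell_shell[of _ n x] assms
    by (intro nn_integral_cong) (auto simp: weight_sq indicator_def)
  also have "\<dots> = ennreal (1 / 9 ^ (2 * shell x)) * ennreal (9 powi (2 * int (shell x) - int n))"
    by (subst nn_integral_cmult_indicator) (simp_all only: emeasure_cell[OF assms] cell_sets_lebesgue)
  also have "\<dots> = ennreal ((1/9) ^ n)"
    by (subst ennreal_mult[symmetric]) (auto simp: power_int_diff power_int_mult power_mult power_one_over)
  finally show ?thesis .
qed

text \<open>For an unbounded cell, shell n + k lies in a central square of area 9^(n+k) and has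
  density 9^(-2(n+k)); the sum over k is 9/8 * 9^-n.\<close>

lemma warea_cell_le: "warea (cell n x) \<le> ennreal (2 * (1/9) ^ n)"
proof (cases "shell x < n")
  case True
  then show ?thesis by (simp add: warea_square_cell)
next
  case False
  have Q: "emeasure lebesgue {y. shell y \<le> k} = ennreal (9 ^ k)" for k
    using emeasure_square[of "int k" 0] by (simp add: square_def shell_le_iff)
  have [measurable]: "{y. shell y \<le> k} \<in> sets lebesgue" for k
    using square_sets_lebesgue[of "int k" 0] by (simp add: square_def shell_le_iff)
  have "warea (cell n x) \<le> (\<integral>\<^sup>+y. (\<Sum>k. ennreal (1 / 9 ^ (2 * (n + k))) * indicator {y. shell y \<le> n + k} y) \<partial>lebesgue)"
    unfolding warea_def
  proof (intro nn_integral_mono)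
    fix y :: "real^2"
    show "(weight y)\<^sup>2 * indicator (cell n x) y \<le> (\<Sum>k. ennreal (1 / 9 ^ (2 * (n + k))) * indicator {y. shell y
        \<le> n + k} y)"
    proof (cases "y \<in> cell n x")
      case True
      with False have "n \<le> shell y" by (simp add: cell_def)
      then have "(weight y)\<^sup>2 * indicator (cell n x) y = ennreal (1 / 9 ^ (2 * (n + (shell y
          - n)))) * indicator {y. shell y \<le> n + (shell y - n)} y"
        using True by (simp add: weight_sq)
      also have "\<dots> \<le> (\<Sum>k. ennreal (1 / 9 ^ (2 * (n + k))) * indicator {y. shell y \<le> n + k} y)"
        using sum_le_suminf[OF summableI, of "{shell y - n}" "\<lambda>k. ennreal (1 / 9 ^ (2 * (n
            + k))) * indicator {y. shell y \<le> n + k} y"]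
        by simp
      finally show ?thesis .
    qed simp
  qed
  also have "\<dots> = (\<Sum>k. ennreal (1 / 9 ^ (2 * (n + k))) * ennreal (9 ^ (n + k)))"
    by (subst nn_integral_suminf, measurable, subst nn_integral_cmult_indicator) (auto simp: Q)
  also have "\<dots> = (\<Sum>k. ennreal ((1/9) ^ n) * ennreal ((1/9) ^ k))"
  proof (intro suminf_cong)
    fix k
    have "1 / 9 ^ (2 * (n + k)) * 9 ^ (n + k) = ((1/9) ^ n * (1/9) ^ k :: real)"
      by (simp add: power_even_eq power2_eq_square power_add power_one_over)
    then show "ennreal (1 / 9 ^ (2 * (n + k))) * ennreal (9 ^ (n + k)) = ennreal ((1/9) ^ n) * ennreal ((1/9) ^ k)"
      by (simp flip: ennreal_mult)
  qed
  also have "\<dots> = ennreal ((1/9) ^ n * (9/8))"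
    unfolding ennreal_suminf_cmult suminf_geometric_ninth by (subst ennreal_mult) auto
  also have "\<dots> \<le> ennreal (2 * (1/9) ^ n)" by (intro ennreal_leI) simp
  finally show ?thesis .
qed

lemma cell_rel_measurable: "{z. snd z \<in> cell n (fst z)} \<in> sets (lebesgue \<Otimes>\<^sub>M lebesgue)"
proof -
  have "{z. snd z \<in> cell n (fst z)} = (\<Union>c\<in>range (cell n). c \<times> c)"
  proof (intro equalityI subsetI)
    fix z :: "(real^2) \<times> (real^2)"
    assume "z \<in> {z. snd z \<in> cell n (fst z)}"
    then show "z \<in> (\<Union>c\<in>range (cell n). c \<times> c)"
      using cell_refl by (intro UN_I[of "cell n (fst z)"]) (auto simp: mem_Times_iff)
  next
    fix z :: "(real^2) \<times> (real^2)"
    assume "z \<in> (\<Union>c\<in>range (cell n). c \<times> c)"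
    then show "z \<in> {z. snd z \<in> cell n (fst z)}" using cell_eq by (auto simp: mem_Times_iff)
  qed
  moreover have "(\<Union>c\<in>range (cell n). c \<times> c) \<in> sets (lebesgue \<Otimes>\<^sub>M lebesgue)"
    by (rule sets.countable_UN'[OF countable_cells]) auto
  ultimately show ?thesis by simp
qed

lemma indicator_cell_measurable [measurable]:
  "(\<lambda>(x, y). indicator (cell n x) y :: ennreal) \<in> borel_measurable (lebesgue \<Otimes>\<^sub>M lebesgue)"
proof -
  have "(indicator {z. snd z \<in> cell n (fst z)} :: _ \<Rightarrow> ennreal) \<in> borel_measurable (lebesgue \<Otimes>\<^sub>M lebesgue)"
    by (intro borel_measurable_indicator cell_rel_measurable)
  also have "(indicator {z. snd z \<in> cell n (fst z)} :: _ \<Rightarrow> ennreal) = (\<lambda>(x, y). indicator (cell n x) y)"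
    by (auto simp: fun_eq_iff indicator_def)
  finally show ?thesis .
qed

text \<open>Of the order of 1 / distance in the spherical picture when finite: the deepest common
  level k contributes 3^k and dominates the sum.\<close>

definition kernel :: "nat \<Rightarrow> real^2 \<Rightarrow> real^2 \<Rightarrow> ennreal" where
  "kernel n x y = (\<Sum>i. 3 ^ (n + i) * indicator (cell (n + i) x) y)"

definition levels :: "nat \<Rightarrow> real^2 \<Rightarrow> real^2 \<Rightarrow> ennreal" where
  "levels n x y = (\<Sum>i. indicator (cell (n + i) x) y)"

lemma kernel_measurable [measurable]: "case_prod (kernel n) \<in> borel_measurable (lebesgue \<Otimes>\<^sub>M lebesgue)"
  unfolding kernel_def by measurable

lemma levels_measurable [measurable]: "case_prod (levels n) \<in> borel_measurable (lebesgue \<Otimes>\<^sub>M lebesgue)"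
  unfolding levels_def by measurable

text \<open>Cells of levels i and j around \<open>x\<close> and \<open>x'\<close> meet only if both
  points share the coarser one, and then inside the finer one, of area about 9^-max. Against 3^i *
  3^j this leaves 3^-(max - min), so the double sum collapses to one over common levels: composing
  two kernels 1 / distance gives a logarithm.\<close>

lemma kernel_kernel_le:
  "(\<integral>\<^sup>+y. (kernel n x y * weight y) * (kernel n x' y * weight y) \<partial>lebesgue) \<le> 6 * levels n x x'"
proof -
  let ?I = "\<lambda>i x y. indicator (cell (n + i) x) y :: ennreal"
  have "(\<integral>\<^sup>+y. (kernel n x y * weight y) * (kernel n x' y * weight y) \<partial>lebesgue)
     = (\<integral>\<^sup>+y. (\<Sum>i. \<Sum>j. 3 ^ (n + i) * 3 ^ (n + j) * (?I i x y * ?I j x' y * (weight y)\<^sup>2)) \<partial>lebesgue)"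
  proof (intro nn_integral_cong)
    fix y :: "real^2"
    have "(kernel n x y * weight y) * (kernel n x' y * weight y)
        = (\<Sum>i. (3 ^ (n + i) * ?I i x y) * (kernel n x' y * (weight y)\<^sup>2))"
      unfolding ennreal_suminf_multc by (simp add: kernel_def power2_eq_square ac_simps)
    also have "\<dots> = (\<Sum>i. \<Sum>j. (3 ^ (n + i) * ?I i x y) * ((3 ^ (n + j) * ?I j x' y) * (weight y)\<^sup>2))"
      unfolding kernel_def ennreal_suminf_multc[symmetric] ennreal_suminf_cmult[symmetric] ..
    finally show "(kernel n x y * weight y) * (kernel n x' y * weight y)
       = (\<Sum>i. \<Sum>j. 3 ^ (n + i) * 3 ^ (n + j) * (?I i x y * ?I j x' y * (weight y)\<^sup>2))"
      by (simp add: ac_simps)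
  qed
  also have "\<dots> = (\<Sum>i. \<Sum>j. 3 ^ (n + i) * 3 ^ (n + j) * (\<integral>\<^sup>+y. ?I i x y * ?I j x' y * (weight y)\<^sup>2 \<partial>lebesgue))"
    by (simp add: nn_integral_suminf nn_integral_cmult)
  also have "\<dots> \<le> (\<Sum>i. \<Sum>j. 2 * (?I (min i j) x x' * ennreal ((1/3) ^ (max i j - min i j))))"
  proof (intro suminf_le allI summableI)
    fix i j
    have "(\<integral>\<^sup>+y. ?I i x y * ?I j x' y * (weight y)\<^sup>2 \<partial>lebesgue)
        \<le> ?I (min i j) x x' * ennreal (2 * (1/9) ^ (n + max i j))"
    proof (cases "x' \<in> cell (n + min i j) x")
      case True
      have "(\<integral>\<^sup>+y. ?I i x y * ?I j x' y * (weight y)\<^sup>2 \<partial>lebesgue) \<le> warea (cell (n + max i j) (if i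
          \<le> j then x' else x))"
        unfolding warea_def by (intro nn_integral_mono) (auto simp: indicator_def max_def)
      also have "\<dots> \<le> ennreal (2 * (1/9) ^ (n + max i j))" by (rule warea_cell_le)
      finally show ?thesis using True by simp
    next
      case False
      have "?I i x y * ?I j x' y = 0" for y
      proof (rule ccontr)
        assume "?I i x y * ?I j x' y \<noteq> 0"
        then have "y \<in> cell (n + i) x" "y \<in> cell (n + j) x'" by (auto simp: indicator_def split: if_splits)
        then have "y \<in> cell (n + min i j) x" "y \<in> cell (n + min i j) x'"
          using cell_antimono[of "n + min i j" "n + i" x] cell_antimono[of "n + min i j" "n + j" x'] by auto
        with False show False using cell_eq cell_refl by metis
      qed
      then have "(\<integral>\<^sup>+y. ?I i x y * ?I j x' y * (weight y)\<^sup>2 \<partial>lebesgue) = (\<integral>\<^sup>+y. 0 \<partial>(lebesgue :: (real^2) measure))"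
        by (intro nn_integral_cong) simp
      then show ?thesis by simp
    qed
    then have "3 ^ (n + i) * 3 ^ (n + j) * (\<integral>\<^sup>+y. ?I i x y * ?I j x' y * (weight y)\<^sup>2 \<partial>lebesgue)
        \<le> 3 ^ (n + i) * 3 ^ (n + j) * (?I (min i j) x x' * ennreal (2 * (1/9) ^ (n + max i j)))"
      by (intro mult_left_mono) auto
    also have "\<dots> = ennreal (3 ^ (n + i) * 3 ^ (n + j) * (2 * (1/9) ^ (n + max i j))) * ?I (min i j) x x'"
      by (simp add: ennreal_mult ac_simps flip: ennreal_power)
    also have "3 ^ (n + i) * 3 ^ (n + j) * (2 * (1/9) ^ (n + max i j)) = (2 * (1/3) ^ (max i j - min i j) :: real)"
    proof -
      define d where "d = max i j - min i j"
      have d: "max i j = min i j + d" by (simp add: d_def)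
      have "(3::real) ^ (n + i) * 3 ^ (n + j) = 3 ^ (n + min i j) * 3 ^ (n + max i j)"
        by (auto simp: min_def max_def)
      also have "\<dots> * (2 * (1/9) ^ (n + max i j)) = 2 * (1/3) ^ d"
      proof -
        have 9: "(1/9::real) ^ k = (1/3) ^ k * (1/3) ^ k" for k by (simp flip: power_mult_distrib)
        have 3: "(3::real) ^ k * (1/3) ^ k = 1" for k by (simp flip: power_mult_distrib)
        have "3 ^ (n + min i j) * 3 ^ (n + max i j) * (2 * (1/9) ^ (n + max i j))
          = 2 * (3 ^ (n + min i j) * (1/3) ^ (n + max i j)) * (3 ^ (n + max i j) * (1/3::real) ^ (n + max i j))"
          unfolding 9 by (simp only: ac_simps)
        also have "\<dots> = 2 * (3 ^ (n + min i j) * (1/3) ^ (n + min i j)) * (1/3) ^ d"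
          unfolding 3 unfolding d add.assoc[symmetric] power_add[of _ "n + min i j" d]
              by (simp only: ac_simps mult_1_right) (simp only: 3 mult_1_right mult_1_left)
        also have "\<dots> = 2 * (1/3) ^ d" unfolding 3 by simp
        finally show ?thesis .
      qed
      finally show ?thesis by (simp add: d_def)
    qed
    finally show "3 ^ (n + i) * 3 ^ (n + j) * (\<integral>\<^sup>+y. ?I i x y * ?I j x' y * (weight y)\<^sup>2 \<partial>lebesgue)
        \<le> 2 * (?I (min i j) x x' * ennreal ((1/3) ^ (max i j - min i j)))"
      by (simp add: ennreal_mult ac_simps)
  qed
  also have "\<dots> = 2 * (\<Sum>i. \<Sum>j. ?I (min i j) x x' * ennreal ((1/3) ^ (max i j - min i j)))"
    by simp
  also have "\<dots> \<le> 2 * (3 * (\<Sum>i. ?I i x x'))"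
    by (intro mult_left_mono sum_min_geometric) simp
  also have "\<dots> = 6 * levels n x x'" by (simp add: levels_def mult.assoc[symmetric])
  finally show ?thesis .
qed

text \<open>The Schur test for the operator from L2 of Lebesgue measure to L2 of the measure with
  density \<open>v\<close> on \<open>E\<close>, so that only the mass of \<open>v\<close> inside
  \<open>E\<close> enters the constant.\<close>

lemma potential_bound:
  fixes v p :: "real^2 \<Rightarrow> ennreal"
  assumes [measurable]: "v \<in> borel_measurable lebesgue" "p \<in> borel_measurable lebesgue" "E \<in> sets lebesgue"
    and C: "\<And>x. x \<in> E \<Longrightarrow> (\<integral>\<^sup>+y\<in>E. v y * levels n x y \<partial>lebesgue) \<le> C"
    and fin: "mass v E < top"
  shows "(\<integral>\<^sup>+x\<in>E. v x * (potential n p x)\<^sup>2 \<partial>lebesgue)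
    \<le> 6 * C * (\<integral>\<^sup>+y. (p y)\<^sup>2 \<partial>lebesgue)"
proof -
  define N where "N = density lebesgue (\<lambda>x. v x * indicator E x)"
  have [measurable_cong, simp]: "sets N = sets lebesgue" "space N = UNIV" by (auto simp: N_def)
  have N_fin: "emeasure N (space N) < top"
    unfolding N_def using fin by (simp add: emeasure_density)
  interpret N: finite_measure N using N_fin by (intro finite_measureI) auto
  interpret P: pair_sigma_finite N "lebesgue :: (real^2) measure" ..
  define k where "k x y = indicator E x * (kernel n x y * weight y)" for x y
  have [measurable]: "case_prod k \<in> borel_measurable (N \<Otimes>\<^sub>M lebesgue)"
    unfolding k_def by measurable
  have nnN: "(\<integral>\<^sup>+x. g x \<partial>N) = (\<integral>\<^sup>+x. v x * indicator E x * g x \<partial>lebesgue)" if "g \<in> borel_measurable lebesgue" for g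
    unfolding N_def using that by (intro nn_integral_density) measurable
  have "(\<integral>\<^sup>+x. (\<integral>\<^sup>+y. p y * k x y \<partial>lebesgue)\<^sup>2 \<partial>N) \<le> (6 * C) * (\<integral>\<^sup>+y. (p y)\<^sup>2 \<partial>lebesgue)"
  proof (rule P.schur_test)
    fix x :: "real^2"
    show "(\<integral>\<^sup>+x'. \<integral>\<^sup>+y. k x y * k x' y \<partial>lebesgue \<partial>N) \<le> 6 * C"
    proof (cases "x \<in> E")
      case True
      have "(\<integral>\<^sup>+x'. \<integral>\<^sup>+y. k x y * k x' y \<partial>lebesgue \<partial>N) \<le> (\<integral>\<^sup>+x'. 6 * levels n x x' \<partial>N)"
      proof (intro nn_integral_mono)
        fix x' :: "real^2"
        have "(\<integral>\<^sup>+y. k x y * k x' y \<partial>lebesgue) \<le> (\<integral>\<^sup>+y. (kernel n x y * weight y) * (kernel n x' y * weight y)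
            \<partial>lebesgue)"
          by (intro nn_integral_mono) (auto simp: k_def indicator_def)
        also have "\<dots> \<le> 6 * levels n x x'" by (rule kernel_kernel_le)
        finally show "(\<integral>\<^sup>+y. k x y * k x' y \<partial>lebesgue) \<le> 6 * levels n x x'" .
      qed
      also have "\<dots> = (\<integral>\<^sup>+x'. 6 * ((v x' * levels n x x') * indicator E x') \<partial>lebesgue)"
        by (subst nnN) (measurable, simp add: ac_simps)
      also have "\<dots> = 6 * (\<integral>\<^sup>+x'\<in>E. v x' * levels n x x' \<partial>lebesgue)"
        by (rule nn_integral_cmult) measurable
      also have "\<dots> \<le> 6 * C" by (intro mult_left_mono C True) simp
      finally show ?thesis .
    qed (simp add: k_def)
  qed (use N_fin in measurable)
  moreover have "(\<integral>\<^sup>+x. (\<integral>\<^sup>+y. p y * k x y \<partial>lebesgue)\<^sup>2 \<partial>N)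
    = (\<integral>\<^sup>+x. v x * indicator E x * (\<integral>\<^sup>+y. p y * k x y \<partial>lebesgue)\<^sup>2 \<partial>lebesgue)"
    by (rule nnN) measurable
  moreover have "v x * indicator E x * (\<integral>\<^sup>+y. p y * k x y \<partial>lebesgue)\<^sup>2
     = (v x * (potential n p x)\<^sup>2) * indicator E x" for x
  proof (cases "x \<in> E")
    case True
    have "(\<integral>\<^sup>+y. p y * k x y \<partial>lebesgue) = (\<integral>\<^sup>+y. (\<Sum>i. 3 ^ (n + i) * (p y * weight y * indicator (cell (n
        + i) x) y)) \<partial>lebesgue)"
    proof (intro nn_integral_cong)
      fix y
      have "p y * k x y = (p y * weight y) * (\<Sum>i. 3 ^ (n + i) * indicator (cell (n + i) x) y)"
        using True by (simp add: k_def kernel_def ac_simps)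
      also have "\<dots> = (\<Sum>i. 3 ^ (n + i) * (p y * weight y * indicator (cell (n + i) x) y))"
        unfolding ennreal_suminf_cmult[symmetric] by (simp add: ac_simps)
      finally show "p y * k x y = (\<Sum>i. 3 ^ (n + i) * (p y * weight y * indicator (cell (n + i) x) y))" .
    qed
    also have "\<dots> = potential n p x"
      by (simp add: nn_integral_suminf nn_integral_cmult)
    finally show ?thesis using True by simp
  qed simp
  ultimately show ?thesis by simp
qed

section \<open>A superadditive functional of \<open>L log L\<close> type\<close>

text \<open>The clause \<open>0 < s\<close> removes the negative half-line, on which
  \<open>ennreal s\<close> is 0, so that layer-cake integrals may run over all reals. As an integral
  it is ready for Fubini and visibly additive in \<open>E\<close>.\<close>

definition dist_fun :: "(real^2 \<Rightarrow> ennreal) \<Rightarrow> (real^2) set \<Rightarrow> real \<Rightarrow> ennreal" where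
  "dist_fun v E s = (\<integral>\<^sup>+x\<in>E. (if 0 < s \<and> ennreal s < v x then 1 else 0) \<partial>lebesgue)"

text \<open>The summand \<open>t\<close> is the largest integral of \<open>v\<close> over a subset of \<open>E\<close> of measure \<open>warea E 9\<^sup>-\<^sup>t\<^sup>-\<^sup>1\<close>.
  The bound by \<open>warea E\<close> instead of a constant makes the functional superadditive.\<close>

definition LlogL :: "(real^2 \<Rightarrow> ennreal) \<Rightarrow> (real^2) set \<Rightarrow> ennreal" where
  "LlogL v E = 2 * (\<integral>\<^sup>+x\<in>E. v x * of_nat (1 + shell x) \<partial>lebesgue)
    + (\<Sum>t. \<integral>\<^sup>+s. min (dist_fun v E s) (warea E * ennreal ((1/9) ^ Suc t)) \<partial>lborel)"

lemma dist_fun_measurable [measurable]: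
  assumes [measurable]: "v \<in> borel_measurable lebesgue" "E \<in> sets lebesgue"
  shows "dist_fun v E \<in> borel_measurable borel"
proof -
  have "dist_fun v E \<in> borel_measurable lborel" unfolding dist_fun_def by measurable
  then show ?thesis by simp
qed

lemma dist_fun_mono: "A \<subseteq> B \<Longrightarrow> dist_fun v A s \<le> dist_fun v B s"
  unfolding dist_fun_def by (intro nn_integral_mono) (auto simp: indicator_def)

lemma dist_fun_le_emeasure: "A \<in> sets lebesgue \<Longrightarrow> dist_fun v A s \<le> emeasure lebesgue A"
proof -
  assume "A \<in> sets lebesgue"
  have "dist_fun v A s \<le> (\<integral>\<^sup>+x. indicator A x \<partial>lebesgue)"
    unfolding dist_fun_def by (intro nn_integral_mono) (auto simp: indicator_def)
  also have "\<dots> = emeasure lebesgue A" by (rule nn_integral_indicator) fact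
  finally show ?thesis .
qed

lemma dist_fun_union:
  assumes [measurable]: "v \<in> borel_measurable lebesgue" "A \<in> sets lebesgue" "B \<in> sets lebesgue" and "A \<inter> B = {}"
  shows "dist_fun v (A \<union> B) s = dist_fun v A s + dist_fun v B s"
  unfolding dist_fun_def using assms(4)
  by (subst nn_integral_add[symmetric]) (auto simp: indicator_def intro!: nn_integral_cong)

lemma emeasure_below: "emeasure lborel {s::real. 0 < s \<and> ennreal s < c} = c"
proof (cases c)
  case (real r)
  then have "{s::real. 0 < s \<and> ennreal s < c} = {0<..<r}" by (auto simp: ennreal_less_iff)
  then show ?thesis using real by simp
next
  case top
  have "(SUP n::nat. ennreal (real n)) \<le> emeasure lborel {0::real<..}"
  proof (rule SUP_least)
    fix n :: nat
    have "ennreal (real n) = emeasure lborel {0<..<real n}" by simp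
    also have "\<dots> \<le> emeasure lborel {0::real<..}" by (rule emeasure_mono) auto
    finally show "ennreal (real n) \<le> emeasure lborel {0::real<..}" .
  qed
  then have "emeasure lborel {0::real<..} = top"
    by (simp add: ennreal_SUP_of_nat_eq_top top_unique flip: ennreal_of_nat_eq_real_of_nat)
  moreover have "{s::real. 0 < s \<and> ennreal s < c} = {0<..}" using top by auto
  ultimately show ?thesis using top by simp
qed

lemma layer_cake:
  assumes [measurable]: "v \<in> borel_measurable lebesgue" "A \<in> sets lebesgue"
  shows "mass v A = (\<integral>\<^sup>+s. dist_fun v A s \<partial>lborel)"
proof -
  have "(\<integral>\<^sup>+s. dist_fun v A s \<partial>lborel)
      = (\<integral>\<^sup>+x. \<integral>\<^sup>+s. (if 0 < s \<and> ennreal s < v x then 1 else 0) * indicator A x \<partial>lborel \<partial>lebesgue)"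
    unfolding dist_fun_def by (rule lborel_lebesgue.Fubini'[symmetric]) measurable
  also have "\<dots> = mass v A"
  proof (intro nn_integral_cong)
    fix x :: "real^2"
    have "(\<integral>\<^sup>+s. (if 0 < s \<and> ennreal s < v x then 1 else 0) * indicator A x \<partial>lborel)
        = (\<integral>\<^sup>+s. indicator {s. 0 < s \<and> ennreal s < v x} s * indicator A x \<partial>lborel)"
      by (intro nn_integral_cong) (auto simp: indicator_def)
    also have "\<dots> = (\<integral>\<^sup>+s. indicator {s. 0 < s \<and> ennreal s < v x} s \<partial>lborel) * indicator A x"
      by (rule nn_integral_multc) measurable
    also have "\<dots> = v x * indicator A x" by (simp add: emeasure_below)
    finally show "(\<integral>\<^sup>+s. (if 0 < s \<and> ennreal s < v x then 1 else 0) * indicator A x \<partial>lborel) = v x * indicator A x" .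
  qed
  finally show ?thesis ..
qed

lemma integral_le_LlogL: "mass v E \<le> LlogL v E"
proof -
  have "mass v E \<le> (\<integral>\<^sup>+x\<in>E. v x * of_nat (1 + shell x) \<partial>lebesgue)"
    by (intro nn_integral_mono mult_right_mono) (auto simp: distrib_left)
  also have "\<dots> \<le> 2 * (\<integral>\<^sup>+x\<in>E. v x * of_nat (1 + shell x) \<partial>lebesgue)"
    using mult_right_mono[of 1 2 "\<integral>\<^sup>+x\<in>E. v x * of_nat (1 + shell x) \<partial>lebesgue"] by simp
  also have "\<dots> \<le> LlogL v E" unfolding LlogL_def by simp
  finally show ?thesis .
qed

lemma LlogL_mono: "A \<subseteq> B \<Longrightarrow> LlogL v A \<le> LlogL v B"
  unfolding LlogL_def
  by (intro add_mono mult_left_mono suminf_le allI nn_integral_mono min.mono mult_right_mono dist_fun_mono warea_mono)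
    (auto simp: indicator_def)

text \<open>min(a,b) + min(c,d) \<le> min(a+c, b+d), and both arguments of the minimum are additive
  in the set, as is the first term.\<close>

lemma LlogL_superadditive:
  assumes [measurable]: "v \<in> borel_measurable lebesgue" "A \<in> sets lebesgue" "B \<in> sets lebesgue" and dj: "A \<inter> B = {}"
  shows "LlogL v A + LlogL v B \<le> LlogL v (A \<union> B)"
proof -
  let ?L = "\<lambda>E. (\<integral>\<^sup>+x\<in>E. v x * of_nat (1 + shell x) \<partial>lebesgue)"
  let ?m = "\<lambda>E t s. min (dist_fun v E s) (warea E * ennreal ((1/9) ^ Suc t))"
  have L: "?L (A \<union> B) = ?L A + ?L B"
    using dj by (subst nn_integral_add[symmetric]) (auto simp: indicator_def intro!: nn_integral_cong)
  have "(\<integral>\<^sup>+s. ?m A t s \<partial>lborel) + (\<integral>\<^sup>+s. ?m B t s \<partial>lborel) \<le> (\<integral>\<^sup>+s. ?m (A \<union> B) t s \<partial>lborel)" for t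
  proof -
    have "(\<integral>\<^sup>+s. ?m A t s \<partial>lborel) + (\<integral>\<^sup>+s. ?m B t s \<partial>lborel) = (\<integral>\<^sup>+s. ?m A t s + ?m B t s \<partial>lborel)"
      by (rule nn_integral_add[symmetric]) measurable
    also have "\<dots> \<le> (\<integral>\<^sup>+s. ?m (A \<union> B) t s \<partial>lborel)"
    proof (intro nn_integral_mono)
      fix s :: real
      have "?m A t s + ?m B t s \<le> min (dist_fun v A s + dist_fun v B s) (warea A * ennreal ((1/9) ^ Suc t)
          + warea B * ennreal ((1/9) ^ Suc t))"
        by (intro min.boundedI add_mono) auto
      also have "\<dots> = ?m (A \<union> B) t s"
        using dj by (simp only: dist_fun_union warea_union assms distrib_right)
      finally show "?m A t s + ?m B t s \<le> ?m (A \<union> B) t s" .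
    qed
    finally show ?thesis .
  qed
  then have "(\<Sum>t. \<integral>\<^sup>+s. ?m A t s \<partial>lborel) + (\<Sum>t. \<integral>\<^sup>+s. ?m B t s \<partial>lborel) \<le> (\<Sum>t. \<integral>\<^sup>+s. ?m (A \<union> B) t s \<partial>lborel)"
    by (subst suminf_add) (auto intro!: suminf_le)
  then show ?thesis unfolding LlogL_def L by (simp add: distrib_left add_mono ac_simps)
qed

lemma LlogL_sum_le:
  assumes v [measurable]: "v \<in> borel_measurable lebesgue" and "finite I"
    and "\<And>i. i \<in> I \<Longrightarrow> A i \<in> sets lebesgue" "disjoint_family_on A I"
  shows "(\<Sum>i\<in>I. LlogL v (A i)) \<le> LlogL v (\<Union>i\<in>I. A i)"
  using assms(2-)
proof (induction I rule: finite_induct)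
  case (insert i I)
  have "(\<Sum>i\<in>insert i I. LlogL v (A i)) = LlogL v (A i) + (\<Sum>i\<in>I. LlogL v (A i))" using insert by simp
  also have "\<dots> \<le> LlogL v (A i) + LlogL v (\<Union>i\<in>I. A i)"
    using insert by (intro add_left_mono insert.IH) (auto simp: disjoint_family_on_def)
  also have "\<dots> \<le> LlogL v (A i \<union> (\<Union>i\<in>I. A i))"
    using insert by (intro LlogL_superadditive v sets.finite_UN) (auto simp: disjoint_family_on_def)
  finally show ?case by simp
qed simp

text \<open>Past the first 2 * shell y + 1 levels a common cell forces equal shells, so the offset
  may be rewritten with \<open>shell x\<close>. It then makes the cell around x a square of Lebesgue
  measure 9^(-n-1-t), passing from spherical to Lebesgue scale; the early levels are paid for by the
  factor \<open>1 + shell\<close> in \<open>LlogL\<close>.\<close>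

lemma levels_le:
  "levels n x y \<le> of_nat (2 * shell y + 1) + (\<Sum>t. indicator (cell (n + 2 * shell x + 1 + t) x) y)"
proof -
  define k where "k = 2 * shell y + 1"
  have "levels n x y = (\<Sum>t. indicator (cell (n + (t + k)) x) y) + (\<Sum>i<k. indicator (cell (n + i) x) y)"
    unfolding levels_def by (rule suminf_offset) auto
  also have "\<dots> \<le> (\<Sum>t. indicator (cell (n + 2 * shell x + 1 + t) x) y) + (\<Sum>i<k. 1)"
  proof (intro add_mono suminf_le allI sum_mono)
    fix t
    show "indicator (cell (n + (t + k)) x) y \<le> (indicator (cell (n + 2 * shell x + 1 + t) x) y :: ennreal)"
    proof (cases "y \<in> cell (n + (t + k)) x")
      case True
      then have "shell y = shell x" by (rule cell_shell) (simp add: k_def)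
      with True have "y \<in> cell (n + 2 * shell x + 1 + t) x" by (simp add: k_def ac_simps)
      then show ?thesis by (simp add: indicator_def)
    qed simp
  qed (auto simp: indicator_def)
  finally show ?thesis by (simp add: k_def ac_simps)
qed

text \<open>By the layer cake, the mass of v on E inside S t is governed by the distribution
  function cut off at the measure of S t. \<open>WE\<close> says that \<open>E\<close> is not much
  smaller than a cell of level n, so this cut-off may be replaced by the one in
  \<open>LlogL\<close>, at the price of 9.\<close>

lemma levels_integral_le_LlogL:
  assumes v [measurable]: "v \<in> borel_measurable lebesgue" and E [measurable]: "E \<in> sets lebesgue"
    and WE: "ennreal ((1/9) ^ n) \<le> 9 * warea E"
  shows "(\<integral>\<^sup>+y\<in>E. v y * levels n x y \<partial>lebesgue) \<le> 9 * LlogL v E"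
proof -
  let ?L = "\<integral>\<^sup>+x\<in>E. v x * of_nat (1 + shell x) \<partial>lebesgue"
  define S where "S t = cell (n + 2 * shell x + 1 + t) x" for t
  have S [measurable]: "S t \<in> sets lebesgue" for t unfolding S_def by measurable
  have "(\<integral>\<^sup>+y\<in>E. v y * levels n x y \<partial>lebesgue)
      \<le> (\<integral>\<^sup>+y. 2 * (v y * of_nat (1 + shell y) * indicator E y) + (\<Sum>t. v y * indicator (E \<inter> S t) y) \<partial>lebesgue)"
  proof (intro nn_integral_mono)
    fix y :: "real^2"
    show "v y * levels n x y * indicator E y \<le> 2 * (v y * of_nat (1 + shell y) * indicator E y)
        + (\<Sum>t. v y * indicator (E \<inter> S t) y)"
    proof (cases "y \<in> E")
      case True
      have "v y * levels n x y \<le> v y * (2 * of_nat (1 + shell y) + (\<Sum>t. indicator (S t) y))"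
        by (intro mult_left_mono order_trans[OF levels_le] add_mono)
          (auto simp: S_def intro!: order_trans[OF _ add_increasing])
      with True show ?thesis by (simp add: distrib_left indicator_inter_arith ac_simps)
    qed simp
  qed
  also have "\<dots> = (\<integral>\<^sup>+y. 2 * (v y * of_nat (1 + shell y) * indicator E y) \<partial>lebesgue)
      + (\<integral>\<^sup>+y. (\<Sum>t. v y * indicator (E \<inter> S t) y) \<partial>lebesgue)"
    by (rule nn_integral_add) measurable
  also have "(\<integral>\<^sup>+y. 2 * (v y * of_nat (1 + shell y) * indicator E y) \<partial>lebesgue) = 2 * ?L"
    by (rule nn_integral_cmult) measurable
  also have "(\<integral>\<^sup>+y. (\<Sum>t. v y * indicator (E \<inter> S t) y) \<partial>lebesgue) = (\<Sum>t. \<integral>\<^sup>+y\<in>E \<inter> S t. v y \<partial>lebesgue)"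
    by (rule nn_integral_suminf) measurable
  also have "(\<Sum>t. \<integral>\<^sup>+y\<in>E \<inter> S t. v y \<partial>lebesgue) \<le> (\<Sum>t. 9 * (\<integral>\<^sup>+s. min (dist_fun v E s) (warea E * ennreal ((1/9)
      ^ Suc t)) \<partial>lborel))"
  proof (intro suminf_le allI summableI)
    fix t
    have "mass v (E \<inter> S t) = (\<integral>\<^sup>+s. dist_fun v (E \<inter> S t) s \<partial>lborel)"
      by (rule layer_cake) measurable
    also have "\<dots> \<le> (\<integral>\<^sup>+s. 9 * min (dist_fun v E s) (warea E * ennreal ((1/9) ^ Suc t)) \<partial>lborel)"
    proof (intro nn_integral_mono)
      fix s :: real
      have "dist_fun v (E \<inter> S t) s \<le> dist_fun v E s" by (rule dist_fun_mono) auto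
      also have "\<dots> \<le> 9 * dist_fun v E s" using mult_right_mono[of 1 9 "dist_fun v E s"] by simp
      finally have 1: "dist_fun v (E \<inter> S t) s \<le> 9 * dist_fun v E s" .
      have "dist_fun v (E \<inter> S t) s \<le> dist_fun v (S t) s" by (rule dist_fun_mono) auto
      also have "\<dots> \<le> emeasure lebesgue (S t)" by (rule dist_fun_le_emeasure) measurable
      also have "\<dots> = ennreal ((1/9) ^ n * (1/9) ^ Suc t)"
      proof -
        have "2 * int (shell x) - int (n + 2 * shell x + 1 + t) = - int (n + Suc t)" by simp
        then have "(9::real) powi (2 * int (shell x) - int (n + 2 * shell x + 1 + t)) = (1/9) ^ (n + Suc t)"
          by (simp only: power_int_minus power_int_of_nat power_one_over inverse_eq_divide)
        then show ?thesis unfolding S_def by (subst emeasure_cell) (auto simp: power_add)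
      qed
      also have "\<dots> = ennreal ((1/9) ^ n) * ennreal ((1/9) ^ Suc t)" by (rule ennreal_mult) auto
      also have "\<dots> \<le> 9 * warea E * ennreal ((1/9) ^ Suc t)" by (intro mult_right_mono WE) simp
      finally have 2: "dist_fun v (E \<inter> S t) s \<le> 9 * (warea E * ennreal ((1/9) ^ Suc t))" by (simp only: mult.assoc)
      show "dist_fun v (E \<inter> S t) s \<le> 9 * min (dist_fun v E s) (warea E * ennreal ((1/9) ^ Suc t))"
        using 1 2 by (simp only: min_def split: if_splits) simp
    qed
    also have "\<dots> = 9 * (\<integral>\<^sup>+s. min (dist_fun v E s) (warea E * ennreal ((1/9) ^ Suc t)) \<partial>lborel)"
      by (rule nn_integral_cmult) measurable
    finally show "mass v (E \<inter> S t) \<le> 9 * (\<integral>\<^sup>+s. min (dist_fun v E s) (warea E * ennreal ((1/9) ^ Suc t)) \<partial>lborel)" .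
  qed
  also have "2 * ?L \<le> 9 * (2 * ?L)" using mult_right_mono[of 1 9 "2 * ?L"] by simp
  finally show ?thesis unfolding LlogL_def by (simp add: distrib_left add_mono)
qed

text \<open>Absolute continuity, uniform over all cells of a level. The integrand of the first term
  is cut at a multiple of \<open>weight\<close>^2; in the series, term t on a small cell is compared
  with term t + m on the plane, leaving a tail. This is what ends the recursion in
  \<open>controls_heavy\<close>.\<close>

lemma LlogL_cell_small:
  assumes v [measurable]: "v \<in> borel_measurable lebesgue" and fin: "LlogL v UNIV < top" and c: "0 < c"
  obtains n0 where "\<And>n x. n0 \<le> n \<Longrightarrow> LlogL v (cell n x) \<le> c"
proof -
  obtain r where r: "0 < r" "ennreal r + ennreal r \<le> c"
  proof (cases c)
    case (real q)
    with c have "0 < q" by auto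
    with real that[of "q/2"] show ?thesis by (simp flip: ennreal_plus)
  next
    case top with that[of 1] show ?thesis by simp
  qed
  define h where "h x = 2 * (v x * of_nat (1 + shell x))" for x
  have [measurable]: "h \<in> borel_measurable lebesgue" unfolding h_def by measurable
  have h_eq: "2 * (\<integral>\<^sup>+x\<in>E. v x * of_nat (1 + shell x) \<partial>lebesgue) = mass h E"
    if [measurable]: "E \<in> sets lebesgue" for E
    unfolding h_def by (subst nn_integral_cmult[symmetric]) (auto simp: ac_simps)
  have h_fin: "(\<integral>\<^sup>+x. h x \<partial>lebesgue) < top"
    using fin h_eq[of UNIV] unfolding LlogL_def by (simp add: less_top)
  have "\<exists>j::nat. (\<integral>\<^sup>+x. h x - of_nat j * (weight x)\<^sup>2 \<partial>lebesgue) < ennreal (r/2)"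
  proof -
    have "(\<lambda>j::nat. \<integral>\<^sup>+x. h x - of_nat j * (weight x)\<^sup>2 \<partial>lebesgue) \<longlonglongrightarrow> (\<integral>\<^sup>+x. 0 \<partial>(lebesgue :: (real^2) measure))"
    proof (rule nn_integral_dominated_convergence[where w = h])
      have "AE x in lebesgue. h x \<noteq> \<infinity>"
        using h_fin by (intro nn_integral_PInf_AE) auto
      then show "AE x in lebesgue. (\<lambda>j. h x - of_nat j * (weight x)\<^sup>2) \<longlonglongrightarrow> 0"
      proof eventually_elim
        case (elim x)
        then obtain q where q: "h x = ennreal q" "0 \<le> q" by (cases "h x") auto
        obtain j0 :: nat where j0: "q * 9 ^ (2 * shell x) \<le> real j0" using real_arch_simple by blast
        have "h x - of_nat j * (weight x)\<^sup>2 = 0" if "j0 \<le> j" for j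
        proof -
          have "q * 9 ^ (2 * shell x) \<le> real j" using that j0 by linarith
          then have "q \<le> real j * (1 / 9 ^ (2 * shell x))" by (simp add: field_simps)
          then have "h x \<le> ennreal (real j * (1 / 9 ^ (2 * shell x)))" unfolding q(1) by (rule ennreal_leI)
          also have "\<dots> = of_nat j * (weight x)\<^sup>2"
            unfolding weight_sq by (subst ennreal_mult) (auto simp: ennreal_of_nat_eq_real_of_nat)
          finally show ?thesis by (simp add: diff_eq_0_ennreal q)
        qed
        then show ?case by (intro tendsto_eventually eventually_sequentiallyI[of j0])
      qed
    qed (use h_fin in \<open>auto simp: diff_le_self_ennreal\<close>)
    from order_tendstoD(2)[OF this, of "ennreal (r/2)"] r(1) show ?thesis
      by (auto simp: eventually_sequentially)
  qed
  then obtain j :: nat where j: "(\<integral>\<^sup>+x. h x - of_nat j * (weight x)\<^sup>2 \<partial>lebesgue) < ennreal (r/2)" by blast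
  have "(\<lambda>n. real j * (2 * (1/9) ^ n)) \<longlonglongrightarrow> real j * (2 * 0)"
    by (intro tendsto_intros LIMSEQ_power_zero) auto
  then have "\<forall>\<^sub>F n in sequentially. real j * (2 * (1/9) ^ n) < r/2"
    by (rule order_tendstoD) (use r in auto)
  then obtain n1 where n1: "\<And>n. n1 \<le> n \<Longrightarrow> real j * (2 * (1/9) ^ n) < r/2" by (auto simp: eventually_sequentially)
  define b where "b t = (\<integral>\<^sup>+s. min (dist_fun v UNIV s) (warea UNIV * ennreal ((1/9) ^ Suc t)) \<partial>lborel)" for t
  have b_fin: "suminf b < top" using fin unfolding LlogL_def b_def by (simp add: less_top)
  have "(\<lambda>m. \<Sum>t<m. b t) \<longlonglongrightarrow> suminf b" by (rule summable_LIMSEQ) simp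
  have "\<exists>m. (\<Sum>t. b (t + m)) \<le> ennreal r"
  proof (cases "suminf b = 0")
    case True
    then have "b t = 0" for t by (simp add: suminf_eq_zero_iff)
    then show ?thesis by simp
  next
    case False
    then have "suminf b - ennreal r < suminf b" using b_fin r(1) by (intro ennreal_between) (auto simp:
        zero_less_iff_neq_zero)
    from order_tendstoD(1)[OF \<open>(\<lambda>m. \<Sum>t<m. b t) \<longlonglongrightarrow> suminf b\<close> this]
    obtain m where m: "suminf b - ennreal r < (\<Sum>t<m. b t)" by (auto simp: eventually_sequentially)
    have split: "suminf b = (\<Sum>t. b (t + m)) + (\<Sum>t<m. b t)" by (rule suminf_offset) simp
    have "suminf b \<le> (\<Sum>t<m. b t) + ennreal r" using less_imp_le[OF m] by (simp add: ennreal_minus_le_iff add.commute)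
    then have "(\<Sum>t<m. b t) + (\<Sum>t. b (t + m)) \<le> (\<Sum>t<m. b t) + ennreal r"
      unfolding split by (simp add: add.commute)
    moreover have "(\<Sum>t<m. b t) \<noteq> top"
      using b_fin unfolding split by (auto simp: less_top)
    ultimately have "(\<Sum>t. b (t + m)) \<le> ennreal r"
      using ennreal_add_left_cancel_le[of "\<Sum>t<m. b t" "\<Sum>t. b (t + m)" "ennreal r"]
      unfolding infinity_ennreal_def by blast
    then show ?thesis by blast
  qed
  then obtain m where m: "(\<Sum>t. b (t + m)) \<le> ennreal r" by blast
  show ?thesis
  \<comment> \<open>The 2 absorbs the factor in \<open>warea_cell_le\<close> and the lower bound 1/9
    for the weighted area of the plane: 2 * 9^-(m+2) \<le> 1/9 * 9^-m.\<close>
  proof (rule that[of "max n1 (m + 2)"])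
    fix n and x :: "real^2" assume n: "max n1 (m + 2) \<le> n"
    have "2 * (\<integral>\<^sup>+y\<in>cell n x. v y * of_nat (1 + shell y) \<partial>lebesgue) \<le> ennreal r"
    proof -
      have "2 * (\<integral>\<^sup>+y\<in>cell n x. v y * of_nat (1 + shell y) \<partial>lebesgue) = mass h (cell n x)"
        by (rule h_eq) measurable
      also have "\<dots> \<le> (\<integral>\<^sup>+y. (h y - of_nat j * (weight y)\<^sup>2) + of_nat j * ((weight y)\<^sup>2 * indicator (cell n x) y)
          \<partial>lebesgue)"
      proof (intro nn_integral_mono)
        fix y :: "real^2"
        have "h y \<le> (h y - of_nat j * (weight y)\<^sup>2) + of_nat j * (weight y)\<^sup>2"
          using ennreal_minus_le_iff[of "h y" "of_nat j * (weight y)\<^sup>2" "h y - of_nat j * (weight y)\<^sup>2"]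
          by (simp add: add.commute)
        then show "h y * indicator (cell n x) y \<le> (h y - of_nat j * (weight y)\<^sup>2)
            + of_nat j * ((weight y)\<^sup>2 * indicator (cell n x) y)"
          by (auto simp: indicator_def)
      qed
      also have "\<dots> = (\<integral>\<^sup>+y. h y - of_nat j * (weight y)\<^sup>2 \<partial>lebesgue) + of_nat j * warea (cell n x)"
        unfolding warea_def by (simp add: nn_integral_add nn_integral_cmult)
      also have "\<dots> \<le> ennreal (r/2) + of_nat j * ennreal (2 * (1/9) ^ n)"
        using j by (intro add_mono mult_left_mono warea_cell_le) auto
      also have "of_nat j * ennreal (2 * (1/9) ^ n) = ennreal (real j * (2 * (1/9) ^ n))"
        by (subst ennreal_mult) (auto simp: ennreal_of_nat_eq_real_of_nat)
      also have "ennreal (r/2) + \<dots> \<le> ennreal (r/2) + ennreal (r/2)"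
        using n1[of n] n by (intro add_left_mono ennreal_leI) auto
      also have "\<dots> = ennreal r" using r by (simp flip: ennreal_plus)
      finally show ?thesis .
    qed
    moreover have "(\<Sum>t. \<integral>\<^sup>+s. min (dist_fun v (cell n x) s) (warea (cell n x) * ennreal ((1/9) ^ Suc t))
        \<partial>lborel) \<le> (\<Sum>t. b (t + m))"
      unfolding b_def
    proof (intro suminf_le allI summableI nn_integral_mono min.mono dist_fun_mono)
      fix t
      have shell0: "shell 0 = 0" using shell_le_iff[of 0 0] by (simp add: idx_def)
      have W1: "ennreal (1/9) \<le> warea UNIV"
        using warea_square_cell[of 0 1] warea_mono[of "cell 1 0" UNIV] shell0 by simp
      obtain d where d: "n = m + 2 + d" using n le_Suc_ex[of "m + 2" n] by auto
      have "warea (cell n x) * ennreal ((1/9) ^ Suc t) \<le> ennreal (2 * (1/9) ^ n) * ennreal ((1/9) ^ Suc t)"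
        by (intro mult_right_mono warea_cell_le) simp
      also have "\<dots> = ennreal (2 * (1/9) ^ n * (1/9) ^ Suc t)" by (rule ennreal_mult[symmetric]) auto
      also have "(2::real) * (1/9) ^ n * (1/9) ^ Suc t \<le> (1/9) * (1/9) ^ Suc (t + m)"
      proof -
        have "2 * (1/9) ^ n * (1/9) ^ Suc t = (2/9 * (1/9) ^ d) * ((1/9) * (1/9::real) ^ Suc (t + m))"
          unfolding d by (simp add: power_add)
        also have "\<dots> \<le> 1 * ((1/9) * (1/9) ^ Suc (t + m))"
          using power_le_one[of "1/9::real" d] by (intro mult_right_mono) auto
        finally show ?thesis by simp
      qed
      then have "ennreal (2 * (1/9) ^ n * (1/9) ^ Suc t) \<le> ennreal ((1/9) * (1/9) ^ Suc (t + m))"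
          by (rule ennreal_leI)
      also have "\<dots> = ennreal (1/9) * ennreal ((1/9) ^ Suc (t + m))" by (rule ennreal_mult) auto
      also have "\<dots> \<le> warea UNIV * ennreal ((1/9) ^ Suc (t + m))" by (intro mult_right_mono W1) simp
      finally show "warea (cell n x) * ennreal ((1/9) ^ Suc t) \<le> warea UNIV * ennreal ((1/9) ^ Suc (t + m))" .
    qed auto
    ultimately have "LlogL v (cell n x) \<le> ennreal r + ennreal r"
      unfolding LlogL_def using m by (intro add_mono) auto
    then show "LlogL v (cell n x) \<le> c" using r(2) by simp
  qed
qed

section \<open>Comparison with the rearrangement\<close>

text \<open>Monotonicity extends a superlevel set of \<open>Vs\<close> to the left and
  right-continuity to the right, so it is open in the positive half-line. The value
  \<open>Vs 0\<close> is arbitrary and concerns the origin alone.\<close>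

lemma rearrangement_measurable:
  assumes "is_rearrangement V Vs"
  shows "(\<lambda>x::real^2. Vs (norm x)) \<in> borel_measurable lebesgue"
proof (rule borel_measurableI_greater)
  fix a :: ennreal
  define S where "S = {r. 0 < r \<and> a < Vs r}"
  have "open S"
    unfolding open_dist
  proof
    fix r assume r: "r \<in> S"
    then have "continuous (at_right r) Vs" using assms by (auto simp: S_def is_rearrangement_def)
    then have "\<forall>\<^sub>F t in at_right r. a < Vs t"
      using r unfolding continuous_within S_def by (intro order_tendstoD(1)) auto
    then obtain b where b: "b > r" "\<And>t. r < t \<Longrightarrow> t < b \<Longrightarrow> a < Vs t"
      unfolding eventually_at_right_field by blast
    show "\<exists>e>0. \<forall>t. dist t r < e \<longrightarrow> t \<in> S"
    proof (intro exI[of _ "min r (b - r)"] conjI allI impI)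
      show "0 < min r (b - r)" using r b by (simp add: S_def)
      fix t assume t: "dist t r < min r (b - r)"
      then have "0 < t" "t < b" by (auto simp: dist_real_def)
      show "t \<in> S"
      proof (cases "r < t")
        case True with b(2)[OF True \<open>t < b\<close>] \<open>0 < t\<close> show ?thesis by (simp add: S_def)
      next
        case False
        then have "Vs r \<le> Vs t" using assms \<open>0 < t\<close> unfolding is_rearrangement_def by auto
        then show ?thesis using r \<open>0 < t\<close> by (auto simp: S_def)
      qed
    qed
  qed
  then have "open (norm -` S :: (real^2) set)"
    by (intro open_vimage) (auto intro: continuous_intros)
  moreover have "{x \<in> space lebesgue. a < Vs (norm (x::real^2))} = norm -` S \<union> (if a < Vs 0 then {0} else {})"
    by (auto simp: S_def)
  ultimately show "{x \<in> space lebesgue. a < Vs (norm (x::real^2))} \<in> sets lebesgue" by auto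
qed

lemma dist_fun_eq_emeasure:
  assumes [measurable]: "v \<in> borel_measurable lebesgue" "A \<in> sets lebesgue" and "0 < s"
  shows "dist_fun v A s = emeasure lebesgue (A \<inter> {x. ennreal s < v x})"
proof -
  have "{x \<in> space lebesgue. ennreal s < v x} \<in> sets lebesgue" by measurable
  then have "A \<inter> {x. ennreal s < v x} \<in> sets lebesgue" by auto
  then have "emeasure lebesgue (A \<inter> {x. ennreal s < v x}) = (\<integral>\<^sup>+x. indicator (A \<inter> {x. ennreal s < v x}) x \<partial>lebesgue)"
    by (rule nn_integral_indicator[symmetric])
  also have "\<dots> = dist_fun v A s"
    unfolding dist_fun_def using \<open>0 < s\<close> by (intro nn_integral_cong) (auto simp: indicator_def)
  finally show ?thesis ..
qed

text \<open>If x lies in the smallest of N + 1 balls, then N + 1 \<le> log_3 (1/|x|) \<le> ln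
  (1/|x|) because ln 3 \<ge> 1; otherwise the last term vanishes.\<close>

lemma sum_indicator_ball_le:
  assumes "x \<noteq> 0"
  shows "(\<Sum>t<N. indicator (ball 0 ((1/3) ^ Suc t)) x) \<le> ennreal (ln_plus (1 / norm (x::real^2)))"
proof (induction N)
  case (Suc N)
  show ?case
  proof (cases "x \<in> ball 0 ((1/3) ^ Suc N)")
    case True
    then have "norm x < (1/3) ^ Suc N" by simp
    then have "3 ^ Suc N \<le> 1 / norm x" using assms by (simp add: field_simps)
    then have "ln (3 ^ Suc N) \<le> ln (1 / norm x)" using assms by (subst ln_le_cancel_iff) auto
    moreover have "1 \<le> ln (3::real)" using exp_le ln_ge_iff[of 3 1] by simp
    then have "real (Suc N) * 1 \<le> real (Suc N) * ln 3" by (intro mult_left_mono) auto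
    ultimately have "real (Suc N) \<le> ln_plus (1 / norm x)"
      unfolding ln_plus_def by (simp only: ln_realpow le_max_iff_disj mult_1_right) linarith
    then have le: "ennreal (real (Suc N)) \<le> ennreal (ln_plus (1 / norm x))" by (rule ennreal_leI)
    have "(\<Sum>t<Suc N. indicator (ball 0 ((1/3) ^ Suc t)) x) \<le> (\<Sum>t<Suc N. 1 :: ennreal)"
      by (intro sum_mono) (auto simp: indicator_def)
    also have "\<dots> = ennreal (real (Suc N))" by (simp add: ennreal_of_nat_eq_real_of_nat del: of_nat_Suc)
    also note le
    finally show ?thesis .
  next
    case False
    then have "indicator (ball 0 ((1/3) ^ Suc N)) x = (0 :: ennreal)" by (simp add: indicator_def)
    with Suc show ?thesis by simp
  qed
qed simp

text \<open>Up to the origin, the superlevel sets of Vs(|x|) are centred discs, so each lies in the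
  ball \<open>B t\<close> or contains it. Cutting their measure off at that of \<open>B t\<close>
  amounts to intersecting with \<open>B t\<close>, and the cut-off in \<open>LlogL\<close> is
  smaller still, since the plane has weighted area at most 2 \<le> pi.\<close>

lemma rearrangement_bound:
  assumes [measurable]: "V \<in> borel_measurable lebesgue" and R: "is_rearrangement V Vs"
  shows "(\<Sum>t. \<integral>\<^sup>+s. min (dist_fun (\<lambda>x. ennreal (V x)) UNIV s) (warea UNIV * ennreal ((1/9) ^ Suc t)) \<partial>lborel)
    \<le> (\<integral>\<^sup>+x. Vs (norm x) * ennreal (ln_plus (1 / norm x)) \<partial>(lebesgue :: (real^2) measure))"
proof -
  define g where "g x = Vs (norm x)" for x :: "real^2"
  have g [measurable]: "g \<in> borel_measurable lebesgue" unfolding g_def by (rule rearrangement_measurable[OF R])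
  define B where "B t = ball (0::real^2) ((1/3) ^ Suc t)" for t
  have B [measurable]: "B t \<in> sets lebesgue" for t unfolding B_def by simp
  have "(\<Sum>t. \<integral>\<^sup>+s. min (dist_fun (\<lambda>x. ennreal (V x)) UNIV s) (warea UNIV * ennreal ((1/9) ^ Suc t)) \<partial>lborel)
      \<le> (\<Sum>t. \<integral>\<^sup>+s. dist_fun g (B t) s \<partial>lborel)"
  proof (intro suminf_le allI summableI nn_integral_mono)
    fix t and s :: real
    show "min (dist_fun (\<lambda>x. ennreal (V x)) UNIV s) (warea UNIV * ennreal ((1/9) ^ Suc t)) \<le> dist_fun g (B t) s"
    proof (cases "0 < s")
      case False
      then have "dist_fun (\<lambda>x. ennreal (V x)) UNIV s = 0" by (simp add: dist_fun_def)
      then show ?thesis by simp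
    next
      case True
      have dV: "dist_fun (\<lambda>x. ennreal (V x)) UNIV s = emeasure lebesgue {x. ennreal s < g x}"
      proof -
        have "dist_fun (\<lambda>x. ennreal (V x)) UNIV s = emeasure lebesgue {x. s < V x}"
          using True by (subst dist_fun_eq_emeasure) (auto simp: ennreal_less_iff)
        also have "\<dots> = emeasure lebesgue {x. ennreal s < g x}"
          using R True unfolding is_rearrangement_def g_def by simp
        finally show ?thesis .
      qed
      have dg: "dist_fun g (B t) s = emeasure lebesgue (B t \<inter> {x. ennreal s < g x})"
        using True by (subst dist_fun_eq_emeasure) auto
      have ms: "{x. ennreal s < g x} \<in> sets lebesgue"
      proof -
        have "{x \<in> space lebesgue. ennreal s < g x} \<in> sets lebesgue" by measurable
        then show ?thesis by simp
      qed
      show ?thesis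
      proof (cases "{x. ennreal s < g x} \<subseteq> B t")
        case True
        then have "B t \<inter> {x. ennreal s < g x} = {x. ennreal s < g x}" by auto
        then show ?thesis unfolding dV dg by simp
      next
        case False
        then obtain z where "ennreal s < g z" "z \<notin> B t" by auto
        then have z: "ennreal s < g z" "(1/3) ^ Suc t \<le> norm z"
          by (simp_all only: B_def mem_ball_0 not_less)
        have "B t - {0} \<subseteq> B t \<inter> {x. ennreal s < g x}"
        proof
          fix x assume x: "x \<in> B t - {0}"
          then have "0 < norm x" "norm x \<le> norm z" using z(2) by (auto simp: B_def)
          then have "Vs (norm z) \<le> Vs (norm x)" using R unfolding is_rearrangement_def by blast
          with z x show "x \<in> B t \<inter> {x. ennreal s < g x}" by (auto simp: g_def)
        qed
        then have "emeasure lebesgue (B t - {0}) \<le> dist_fun g (B t) s"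
          unfolding dg using ms by (intro emeasure_mono) auto
        moreover have "emeasure lebesgue (B t - {0}) = emeasure lebesgue (B t)"
          by (intro emeasure_Diff_null_set) (auto simp: negligible_iff_null_sets[symmetric])
        moreover have "emeasure lebesgue (B t) = ennreal (pi * ((1/3) ^ Suc t)\<^sup>2)"
          unfolding B_def by (rule emeasure_disc) simp
        moreover have "warea UNIV * ennreal ((1/9) ^ Suc t) \<le> ennreal (pi * ((1/3) ^ Suc t)\<^sup>2)"
        proof -
          have "warea UNIV * ennreal ((1/9) ^ Suc t) \<le> ennreal 2 * ennreal ((1/9) ^ Suc t)"
            using warea_cell_le[of 0 0] by (intro mult_right_mono) (auto simp: cell_0)
          also have "\<dots> = ennreal (2 * (1/9) ^ Suc t)" by (rule ennreal_mult[symmetric]) auto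
          also have "\<dots> \<le> ennreal (pi * ((1/3) ^ Suc t)\<^sup>2)"
          proof (rule ennreal_leI)
            have "((1/3::real) ^ Suc t)\<^sup>2 = (1/9) ^ Suc t"
              by (simp only: power2_eq_square power_mult_distrib[symmetric]) simp
            then show "2 * (1/9) ^ Suc t \<le> pi * ((1/3) ^ Suc t)\<^sup>2"
              using pi_ge_two by (simp only: mult_right_mono zero_le_power)
          qed
          finally show ?thesis .
        qed
        ultimately show ?thesis by (simp add: min.coboundedI2)
      qed
    qed
  qed
  also have "\<dots> = (\<Sum>t. \<integral>\<^sup>+x\<in>B t. g x \<partial>lebesgue)"
    by (intro suminf_cong layer_cake[symmetric]) measurable
  also have "\<dots> = (\<integral>\<^sup>+x. (\<Sum>t. g x * indicator (B t) x) \<partial>lebesgue)"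
    by (rule nn_integral_suminf[symmetric]) measurable
  also have "\<dots> \<le> (\<integral>\<^sup>+x. Vs (norm x) * ennreal (ln_plus (1 / norm x)) \<partial>(lebesgue :: (real^2) measure))"
  proof (rule nn_integral_mono_AE)
    have "AE x in lebesgue. x \<notin> {0::real^2}"
      by (intro AE_not_in) (simp add: negligible_iff_null_sets[symmetric])
    then show "AE x in lebesgue. (\<Sum>t. g x * indicator (B t) x) \<le> Vs (norm x) * ennreal (ln_plus (1 / norm x))"
    proof eventually_elim
      case (elim x)
      have "(\<Sum>t. indicator (B t) x) \<le> ennreal (ln_plus (1 / norm x))"
        unfolding B_def using elim by (intro suminf_le_const sum_indicator_ball_le) auto
      then show ?case unfolding ennreal_suminf_cmult g_def by (rule mult_left_mono) simp
    qed
  qed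
  finally show ?thesis .
qed

text \<open>For K = shell x \<ge> 1 the point lies outside the central square of side 3^(K-1), so
  3^(K-1) \<le> 2|x| \<le> (2+|x|)^2; with 9 \<le> (2+|x|)^4 this gives the exponent 6, and 12 = 2 *
  6.\<close>

lemma shell_le_ln: "2 * (1 + real (shell x)) \<le> 12 * ln (2 + norm (x::real^2))"
proof -
  have pos: "0 < 2 + norm x" using norm_ge_zero[of x] by linarith
  have four: "2 ^ k \<le> (2 + norm x) ^ k" for k by (intro power_mono) auto
  have "3 ^ (1 + shell x) \<le> (2 + norm x) ^ 6"
  proof (cases "shell x = 0")
    case True
    then show ?thesis using four[of 6] by simp
  next
    case False
    then obtain k where k: "shell x = Suc k" using not0_implies_Suc by blast
    then have "\<not> shell x \<le> k" by simp
    then obtain i where i: "idx (int k) (x$i) \<noteq> 0" unfolding shell_le_iff by blast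
    have "3 ^ k \<le> 2 * norm x"
    proof -
      have "\<bar>x$i\<bar> \<le> norm x" by (rule component_le_norm_cart)
      moreover have "3 ^ k \<le> 2 * \<bar>x$i\<bar>" using i unfolding idx_eq_iff by (auto simp: abs_if)
      ultimately show ?thesis by linarith
    qed
    also have "2 * norm x \<le> (2 + norm x) ^ 2" by (simp add: power2_sum)
    finally have "3 ^ k * 9 \<le> (2 + norm x) ^ 2 * (2 + norm x) ^ 4"
      using four[of 4] by (intro mult_mono) auto
    then show ?thesis unfolding k by (simp flip: power_add)
  qed
  then have "ln (3 ^ (1 + shell x)) \<le> ln ((2 + norm x) ^ 6)" using pos by (subst ln_le_cancel_iff) auto
  then have "real (1 + shell x) * ln 3 \<le> 6 * ln (2 + norm x)"
    using pos by (simp only: ln_realpow zero_less_numeral)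
  moreover have "1 \<le> ln (3::real)" using exp_le ln_ge_iff[of 3 1] by simp
  then have "real (1 + shell x) * 1 \<le> real (1 + shell x) * ln 3" by (intro mult_left_mono) auto
  ultimately have "real (1 + shell x) \<le> 6 * ln (2 + norm x)" by (simp only: mult_1_right)
  then show ?thesis by simp
qed

lemma LlogL_UNIV_le:
  assumes [measurable]: "V \<in> borel_measurable lebesgue" and R: "is_rearrangement V Vs"
  shows "LlogL (\<lambda>x. ennreal (V x)) UNIV
    \<le> 12 * ((\<integral>\<^sup>+x. ennreal (V x * ln (2 + norm x)) \<partial>lebesgue)
         + (\<integral>\<^sup>+x. Vs (norm x) * ennreal (ln_plus (1 / norm x)) \<partial>(lebesgue :: (real^2) measure)))"
    (is "_ \<le> 12 * (?A + ?B)")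
proof -
  have [measurable]: "(\<lambda>x::real^2. norm x) \<in> borel_measurable lebesgue"
    by (rule measurable_completion) simp
  have "2 * (\<integral>\<^sup>+x\<in>UNIV. ennreal (V x) * of_nat (1 + shell x) \<partial>lebesgue)
      = (\<integral>\<^sup>+x. 2 * (ennreal (V x) * of_nat (1 + shell x)) \<partial>lebesgue)"
    by (subst nn_integral_cmult) auto
  also have "\<dots> \<le> (\<integral>\<^sup>+x. 12 * ennreal (V x * ln (2 + norm x)) \<partial>lebesgue)"
  proof (intro nn_integral_mono)
    fix x :: "real^2"
    have ln0: "0 \<le> ln (2 + norm x)" by (intro ln_ge_zero) (use norm_ge_zero[of x] in linarith)
    have "2 * (ennreal (V x) * of_nat (1 + shell x)) = ennreal (V x) * ennreal (2 * (1 + real (shell x)))"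
    proof -
      have "(2::ennreal) * of_nat (1 + shell x) = ennreal (2 * (1 + real (shell x)))"
        unfolding ennreal_of_nat_eq_real_of_nat by (subst ennreal_mult) auto
      then show ?thesis by (simp only: ac_simps)
    qed
    also have "\<dots> \<le> ennreal (V x) * ennreal (12 * ln (2 + norm x))"
      by (intro mult_left_mono ennreal_leI shell_le_ln) simp
    also have "\<dots> = 12 * ennreal (V x * ln (2 + norm x))"
      using ln0 by (simp add: ennreal_mult'' ac_simps)
    finally show "2 * (ennreal (V x) * of_nat (1 + shell x)) \<le> 12 * ennreal (V x * ln (2 + norm x))" .
  qed
  also have "\<dots> = 12 * ?A" by (rule nn_integral_cmult) measurable
  finally have "LlogL (\<lambda>x. ennreal (V x)) UNIV \<le> 12 * ?A + ?B"
    unfolding LlogL_def by (intro add_mono rearrangement_bound assms)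
  also have "\<dots> \<le> 12 * (?A + ?B)"
    using mult_right_mono[of 1 12 ?B] by (simp add: distrib_left add_mono)
  finally show ?thesis .
qed

section \<open>Stopping cells\<close>

lemma idx_center: "idx j (3 powi j * of_int q) = q"
  unfolding idx_eq_iff by (simp add: algebra_simps)

text \<open>Every cell has at least two children that are squares, and at most one of them is the
  cell of \<open>y\<close>. The bound on \<open>shell z\<close> is what makes the child around z a
  square.\<close>

lemma ex_subsquare_avoiding:
  "\<exists>z\<in>cell n x. shell z \<le> n \<and> z \<notin> cell (Suc n) y"
proof -
  have "\<exists>z\<in>cell n x. \<exists>w\<in>cell n x. shell z \<le> n \<and> shell w \<le> n \<and> w \<notin> cell (Suc n) z"
  proof (cases "shell x < n")
    case True
    define j where "j = 2 * int (shell x) - int (Suc n)"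
    have j1: "2 * int (shell x) - int n = j + 1" by (simp add: j_def)
    \<comment> \<open>\<open>z 0\<close> and \<open>z 1\<close> are the centres of the middle child
      and of its neighbour in the first coordinate direction.\<close>
    define z where "z d = (\<chi> i. 3 powi j * of_int (3 * idx (j + 1) (x$i) + (if i
        = 1 then d else 0)) :: real^2)" for d :: int
    have iz: "idx j (z d $ i) = 3 * idx (j + 1) (x$i) + (if i = 1 then d else 0)" for d i
      unfolding z_def by (simp only: vec_lambda_beta idx_center)
    have mem: "z d \<in> cell n x" if "d \<in> {0, 1}" for d
    proof -
      have "idx (j + 1) (z d $ i) = idx (j + 1) (x $ i)" for i
        using iz[of d i] idx_plus1[of j "z d $ i"] that by auto
      with True show ?thesis unfolding cell_def j1 by simp
    qed
    have sh: "shell (z d) = shell x" if "d \<in> {0, 1}" for d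
      using cell_shell[OF mem[OF that]] True by simp
    have "z 1 \<notin> cell (Suc n) (z 0)"
    proof
      assume "z 1 \<in> cell (Suc n) (z 0)"
      then have "\<forall>i. idx j (z 1 $ i) = idx j (z 0 $ i)"
        using True sh[of 0] unfolding cell_def j_def by simp
      then show False using iz[of 1 1] iz[of 0 1] by auto
    qed
    with mem sh True show ?thesis
      by (intro bexI[of _ "z 0"] bexI[of _ "z 1"] conjI) auto
  next
    case False
    define j where "j = int n - 1"
    have j1: "int n = j + 1" by (simp add: j_def)
    \<comment> \<open>Centres of the two squares next to the central one along the positive
      axes.\<close>
    define z where "z k = (\<chi> i. 3 powi j * of_int (if i = k then 1 else 0) :: real^2)" for k :: 2
    have iz: "idx j (z k $ i) = (if i = k then 1 else 0)" for k i
      unfolding z_def by (simp only: vec_lambda_beta idx_center)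
    have le: "shell (z k) \<le> n" for k
      unfolding shell_le_iff j1 idx_plus1 iz by simp
    have "n \<le> shell (z k)" for k
    proof (cases n)
      case (Suc n')
      then have "j = int n'" by (simp add: j_def)
      then have "idx (int n') (z k $ k) \<noteq> 0" using iz[of k k] by simp
      then have "\<not> shell (z k) \<le> n'" unfolding shell_le_iff by blast
      then show ?thesis using Suc by simp
    qed simp
    then have sh: "shell (z k) = n" for k using le[of k] by (simp add: le_antisym)
    then have "z k \<in> cell n x" for k using False by (simp add: cell_def)
    moreover have "z 2 \<notin> cell (Suc n) (z 1)"
    proof -
      have "2 * int n - int (Suc n) = j" by (simp add: j_def)
      then show ?thesis unfolding cell_def sh by (auto simp: iz dest: spec[of _ 1])
    qed
    ultimately show ?thesis using le by blast
  qed
  then obtain z w where zw: "z \<in> cell n x" "w \<in> cell n x" "shell z \<le> n" "shell w \<le> n" "w \<notin> cell (Suc n) z" by blast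
  show ?thesis
  proof (cases "z \<in> cell (Suc n) y")
    case True
    then have "w \<notin> cell (Suc n) y" using zw(5) cell_eq by blast
    with zw show ?thesis by blast
  qed (use zw in blast)
qed

text \<open>What remains after removing a deeper cell still contains a whole child, of area
  9^-(n+1). This supplies the area hypothesis of \<open>levels_integral_le_LlogL\<close> for
  annuli.\<close>

lemma warea_diff_ge:
  assumes "n < m"
  shows "ennreal ((1/9) ^ n) \<le> 9 * warea (cell n x - cell m y)"
proof -
  obtain z where z: "z \<in> cell n x" "shell z \<le> n" "z \<notin> cell (Suc n) y"
    using ex_subsquare_avoiding[of n x y] by blast
  have "cell (Suc n) z \<subseteq> cell n x" using z(1) cell_Suc_subset cell_eq by blast
  moreover have "cell (Suc n) z \<inter> cell m y = {}"
  proof (rule ccontr)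
    assume "cell (Suc n) z \<inter> cell m y \<noteq> {}"
    then obtain w where "w \<in> cell (Suc n) z" "w \<in> cell (Suc n) y"
      using cell_antimono[of "Suc n" m y] assms by auto
    then show False using z(3) cell_eq cell_refl by metis
  qed
  ultimately have "warea (cell (Suc n) z) \<le> warea (cell n x - cell m y)" by (intro warea_mono) auto
  then have "9 * ennreal ((1/9) ^ Suc n) \<le> 9 * warea (cell n x - cell m y)"
    using z(2) by (intro mult_left_mono) (simp_all add: warea_square_cell)
  moreover have "9 * ennreal ((1/9) ^ Suc n) = ennreal ((1/9) ^ n)"
    by (simp flip: ennreal_mult' ennreal_numeral)
  ultimately show ?thesis by simp
qed

lemma warea_cell_ge: "ennreal ((1/9) ^ n) \<le> 9 * warea (cell n x)"
  using warea_diff_ge[of n "Suc n" x x] mult_left_mono[OF warea_mono[of "cell n x - cell (Suc n) x" "cell n x"], of 9]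
  by (auto intro: order_trans)

definition children :: "nat \<Rightarrow> real^2 \<Rightarrow> (real^2) set set" where
  "children n x = cell (Suc n) ` cell n x"

lemma children_Union: "\<Union>(children n x) = cell n x"
proof
  show "\<Union>(children n x) \<subseteq> cell n x"
  proof
    fix z assume "z \<in> \<Union>(children n x)"
    then obtain y where "y \<in> cell n x" "z \<in> cell (Suc n) y" by (auto simp: children_def)
    then show "z \<in> cell n x" using cell_Suc_subset[of n y] cell_eq[of y n x] by auto
  qed
qed (use cell_refl in \<open>auto simp: children_def\<close>)

lemma children_disjoint: "c \<in> children n x \<Longrightarrow> d \<in> children n x \<Longrightarrow> c \<noteq> d \<Longrightarrow> c \<inter> d = {}"
  unfolding children_def using cell_eq by (metis disjoint_iff imageE)

lemma children_sets: "c \<in> children n x \<Longrightarrow> c \<in> sets lebesgue"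
  unfolding children_def by (auto simp: cell_sets)

text \<open>A square has nine subsquares; an unbounded cell has eight squares and one unbounded
  child. Only at n = 0, where no centre is removed, can there be nine squares and the unbounded one.
  Nine is exactly what \<open>controls_branch\<close> can afford.\<close>

lemma card_children:
  shows "finite (children n x)" "card (children n x) \<le> 10" "1 \<le> n \<Longrightarrow> card (children n x) \<le> 9"
proof -
  define Q where "Q j = (\<lambda>(p, q). {z::real^2. idx j (z$1) = p \<and> idx j (z$2) = q})" for j
  have "\<exists>I j. children n x \<subseteq> insert {z. Suc n \<le> shell z} (Q j ` I) \<and> finite I \<and> card I \<le> 9 \<and> (1
      \<le> n \<longrightarrow> (children n x \<subseteq> Q j ` I \<or> card I \<le> 8))"
  proof (cases "shell x < n")
    case True
    define j where "j = 2 * int (shell x) - int (Suc n)"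
    have j1: "2 * int (shell x) - int n = j + 1" by (simp add: j_def)
    define I where "I = {3 * idx (j+1) (x$1) - 1..3 * idx (j+1) (x$1) + 1} \<times> {3 * idx (j+1) (x$2)
        - 1..3 * idx (j+1) (x$2) + 1}"
    have "children n x \<subseteq> Q j ` I"
    proof
      fix c assume "c \<in> children n x"
      then obtain y where y: "y \<in> cell n x" "c = cell (Suc n) y" by (auto simp: children_def)
      have sh: "shell y = shell x" using cell_shell[OF y(1)] True by simp
      have div3: "(q + 1) div 3 = p \<Longrightarrow> 3 * p - 1 \<le> q \<and> q \<le> 3 * p + 1" for p q :: int by presburger
      have e: "(idx j (y$i) + 1) div 3 = idx (j+1) (x$i)" for i
        using y(1) True unfolding cell_def j1 idx_plus1[of j "y$i" for i, symmetric] by auto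
      have "(idx j (y$1), idx j (y$2)) \<in> I"
        using div3[OF e[of 1]] div3[OF e[of 2]] unfolding I_def by auto
      moreover have "c = Q j (idx j (y$1), idx j (y$2))"
        unfolding y(2) Q_def cell_def sh using True by (auto simp: forall_2 j_def)
      ultimately show "c \<in> Q j ` I" by blast
    qed
    moreover have "finite I" "card I \<le> 9" unfolding I_def by (auto simp: card_cartesian_product)
    ultimately show ?thesis by (intro exI[of _ I] exI[of _ j]) auto
  next
    case False
    define j where "j = int n - 1"
    have j1: "int n = j + 1" by (simp add: j_def)
    define I where "I = {-1..1::int} \<times> {-1..1::int} - (if n = 0 then {} else {(0,0)})"
    have "children n x \<subseteq> insert {z. Suc n \<le> shell z} (Q j ` I)"
    proof
      fix c assume "c \<in> children n x"
      then obtain y where y: "y \<in> cell n x" "c = cell (Suc n) y" by (auto simp: children_def)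
      show "c \<in> insert {z. Suc n \<le> shell z} (Q j ` I)"
      proof (cases "Suc n \<le> shell y")
        case True then show ?thesis by (simp add: y(2) cell_def)
      next
        case f: False
        with y(1) False have sh: "shell y = n" by (auto simp: cell_def)
        then have "\<forall>i. idx (j+1) (y$i) = 0" using shell_le_iff[of y n] by (simp add: j1)
        then have "idx j (y$i) \<in> {-1..1}" for i unfolding idx_plus1 by (auto dest!: spec[of _ i])
        moreover have "(idx j (y$1), idx j (y$2)) \<noteq> (0, 0)" if "n \<noteq> 0"
        proof -
          have "\<not> shell y \<le> n - 1" using sh that by simp
          then show ?thesis unfolding shell_le_iff forall_2 j_def using that by (simp add: of_nat_diff)
        qed
        ultimately have "(idx j (y$1), idx j (y$2)) \<in> I" unfolding I_def by auto
        moreover have "c = Q j (idx j (y$1), idx j (y$2))"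
          unfolding y(2) Q_def cell_def sh by (auto simp: forall_2 j_def)
        ultimately show ?thesis by blast
      qed
    qed
    moreover have "finite I" unfolding I_def by auto
    moreover have "card ({-1..1::int} \<times> {-1..1::int}) = 9" by (simp add: card_cartesian_product)
    then have "card I = (if n = 0 then 9 else 8)" unfolding I_def by (auto simp: card_Diff_subset)
    ultimately show ?thesis by (intro exI[of _ I] exI[of _ j]) auto
  qed
  then obtain I j where I: "children n x \<subseteq> insert {z. Suc n \<le> shell z} (Q j ` I)" "finite I" "card I \<le> 9"
    "1 \<le> n \<longrightarrow> (children n x \<subseteq> Q j ` I \<or> card I \<le> 8)" by blast
  have fin: "finite (insert {z. Suc n \<le> shell z} (Q j ` I))" using I(2) by simp
  have cI: "card (Q j ` I) \<le> card I" by (rule card_image_le[OF I(2)])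
  have ci: "card (insert {z. Suc n \<le> shell z} (Q j ` I)) \<le> Suc (card I)"
    using cI card_insert_le_m1[of "Suc (card I)" "Q j ` I"] by simp
  show "finite (children n x)" using fin I(1) by (rule finite_subset[rotated])
  show "card (children n x) \<le> 10" using card_mono[OF fin I(1)] ci I(3) by linarith
  show "card (children n x) \<le> 9" if "1 \<le> n"
  proof (cases "children n x \<subseteq> Q j ` I")
    case True
    then show ?thesis using card_mono[OF finite_imageI[OF I(2)] True] cI I(3) by linarith
  next
    case False
    then show ?thesis using card_mono[OF fin I(1)] ci I(4) that by linarith
  qed
qed

lemma ref_cong: "y \<in> cell n x \<Longrightarrow> ref n y = ref n x"
  using cell_shell[of y n x]
  by (cases "shell x < n") (auto simp: ref_def ref_level_def ref_index_def cell_def)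

section \<open>Energy estimates on cells and annuli\<close>

lemma ennreal_sum_sq_le:
  fixes q :: "'a \<Rightarrow> ennreal"
  shows "(\<Sum>i\<in>I. q i)\<^sup>2 \<le> of_nat (card I) * (\<Sum>i\<in>I. (q i)\<^sup>2)"
proof -
  have "2 * (\<Sum>i\<in>I. q i)\<^sup>2 = (\<Sum>i\<in>I. \<Sum>j\<in>I. 2 * (q i * q j))"
    by (simp only: power2_eq_square sum_product) (simp only: sum_distrib_left)
  also have "\<dots> \<le> (\<Sum>i\<in>I. \<Sum>j\<in>I. (q i)\<^sup>2 + (q j)\<^sup>2)"
    unfolding power2_eq_square by (intro sum_mono ennreal_two_mult_le)
  also have "\<dots> = 2 * (of_nat (card I) * (\<Sum>i\<in>I. (q i)\<^sup>2))"
    by (simp add: sum.distrib sum_distrib_left mult_2)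
  finally show ?thesis by (subst (asm) ennreal_mult_le_mult_iff) auto
qed

lemma ennreal_add_sq_le: "(a + b)\<^sup>2 \<le> 2 * a\<^sup>2 + 2 * (b::ennreal)\<^sup>2"
proof -
  have "(a + b)\<^sup>2 = a\<^sup>2 + b\<^sup>2 + (a * b + a * b)"
    by (simp add: power2_eq_square distrib_left distrib_right ac_simps)
  also have "a * b + a * b = 2 * (a * b)" by (rule mult_2[symmetric])
  also have "a\<^sup>2 + b\<^sup>2 + 2 * (a * b) \<le> a\<^sup>2 + b\<^sup>2 + (a\<^sup>2 + b\<^sup>2)"
    unfolding power2_eq_square by (intro add_left_mono ennreal_two_mult_le)
  finally show ?thesis by (simp add: mult_2 ac_simps)
qed

text \<open>The square of a term of \<open>potential\<close>, for sets that need not be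
  cells.\<close>

definition flux :: "nat \<Rightarrow> (real^2) set \<Rightarrow> (real^2 \<Rightarrow> ennreal) \<Rightarrow> ennreal" where
  "flux n A f = (3 ^ n * wmass f A)\<^sup>2"

text \<open>An annulus sees the gradient inside the removed cell only through its \<open>flux\<close>. Keeping the flux on the
  left-hand side allows the estimates for nested annuli to be added without counting energy twice.\<close>

definition controls :: "(real^2 \<Rightarrow> ennreal) \<Rightarrow> nat \<Rightarrow> (real^2) set \<Rightarrow> (real^2) set set \<Rightarrow> bool" where
  "controls v n A G \<longleftrightarrow> (\<forall>u f. grad_pair u f \<longrightarrow> (\<forall>r\<in>G. (LINT y:r|lebesgue. u y) = 0) \<longrightarrow>
     5 * pot_energy v u A + flux n A f \<le> 5 * energy f A)"

text \<open>The number is \<open>10 \<cdot> 54\<^sup>3\<close>: the factor \<open>54\<close> of \<open>pointwise\<close> enters squared, and \<open>potential_bound\<close>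
  together with \<open>levels_integral_le_LlogL\<close> contributes another \<open>6 \<cdot> 9\<close>.\<close>

definition threshold :: ennreal where "threshold = ennreal (1 / 1574640)"

lemma controls_mono: "controls v n A G \<Longrightarrow> G \<subseteq> G' \<Longrightarrow> controls v n A G'"
  unfolding controls_def by blast

text \<open>Cauchy-Schwarz; the square of 3^n cancels the area 9^-n and leaves the 2 of
  \<open>warea_cell_le\<close>.\<close>

lemma flux_le:
  assumes f [measurable]: "f \<in> borel_measurable lebesgue" and [measurable]: "A \<in> sets lebesgue" and "A \<subseteq> cell n x"
  shows "flux n A f \<le> 2 * energy f A"
proof -
  have "(wmass f A)\<^sup>2 = (\<integral>\<^sup>+y. (f y * indicator A y) * (weight y * indicator A y) \<partial>lebesgue)\<^sup>2"
    by (intro arg_cong[where f = "\<lambda>t. t\<^sup>2"] nn_integral_cong) (auto simp: indicator_def)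
  also have "\<dots> \<le> (\<integral>\<^sup>+y. (f y * indicator A y)\<^sup>2 \<partial>lebesgue) * (\<integral>\<^sup>+y. (weight y * indicator A y)\<^sup>2 \<partial>lebesgue)"
    by (rule Cauchy_Schwarz_nn_integral) measurable
  also have "(\<integral>\<^sup>+y. (f y * indicator A y)\<^sup>2 \<partial>lebesgue) = energy f A"
    by (intro nn_integral_cong) (auto simp: indicator_def)
  also have "(\<integral>\<^sup>+y. (weight y * indicator A y)\<^sup>2 \<partial>lebesgue) = warea A"
    unfolding warea_def by (intro nn_integral_cong) (auto simp: indicator_def)
  also have "energy f A * warea A \<le> energy f A * ennreal (2 * (1/9) ^ n)"
    using order_trans[OF warea_mono[OF assms(3)] warea_cell_le] by (intro mult_left_mono) auto
  finally have "flux n A f \<le> (3 ^ n)\<^sup>2 * ((energy f A) * ennreal (2 * (1/9) ^ n))"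
    unfolding flux_def power_mult_distrib by (intro mult_left_mono) auto
  also have "\<dots> = ((3 ^ n)\<^sup>2 * ennreal (2 * (1/9) ^ n)) * energy f A" by (simp add: ac_simps)
  also have "(3 ^ n)\<^sup>2 * ennreal (2 * (1/9) ^ n) = 2"
  proof -
    have "((3::real) ^ n)\<^sup>2 * (2 * (1/9) ^ n) = 2"
      by (simp add: power2_eq_square power_one_over flip: power_mult_distrib)
    then have eq: "ennreal (((3::real) ^ n)\<^sup>2 * (2 * (1/9) ^ n)) = 2" by (simp only: ennreal_numeral)
    have "(3 ^ n)\<^sup>2 = ennreal ((3 ^ n)\<^sup>2)" by (simp flip: ennreal_power)
    then have "(3 ^ n)\<^sup>2 * ennreal (2 * (1/9) ^ n) = ennreal ((3 ^ n)\<^sup>2) * ennreal (2 * (1/9) ^ n)" by simp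
    also have "\<dots> = ennreal ((3 ^ n)\<^sup>2 * (2 * (1/9) ^ n))" by (rule ennreal_mult[symmetric]) auto
    finally show ?thesis using eq by simp
  qed
  finally show ?thesis .
qed

text \<open>29160 = 10 * 54^2; together with the factors 6 and 9 it is the inverse of
  \<open>threshold\<close>.\<close>

lemma annulus_potential:
  assumes v [measurable]: "v \<in> borel_measurable lebesgue" and p [measurable]: "p \<in> borel_measurable lebesgue"
    and E [measurable]: "E \<in> sets lebesgue" and WE: "ennreal ((1/9) ^ n) \<le> 9 * warea E" and LlogL: "LlogL v E
        \<le> threshold"
  shows "29160 * (\<integral>\<^sup>+x\<in>E. v x * (potential n p x)\<^sup>2 \<partial>lebesgue)
    \<le> (\<integral>\<^sup>+y. (p y)\<^sup>2 \<partial>lebesgue)"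
proof -
  have "29160 * (\<integral>\<^sup>+x\<in>E. v x * (potential n p x)\<^sup>2 \<partial>lebesgue)
    \<le> 29160 * (6 * (9 * LlogL v E) * (\<integral>\<^sup>+y. (p y)\<^sup>2 \<partial>lebesgue))"
  proof (intro mult_left_mono potential_bound v p E)
    show "(\<integral>\<^sup>+y\<in>E. v y * levels n x y \<partial>lebesgue) \<le> 9 * LlogL v E" for x
      by (rule levels_integral_le_LlogL[OF v E WE])
    show "mass v E < top"
      using order_trans[OF integral_le_LlogL LlogL] unfolding threshold_def by (rule le_less_trans) simp
  qed simp
  also have "\<dots> = (1574640 * LlogL v E) * (\<integral>\<^sup>+y. (p y)\<^sup>2 \<partial>lebesgue)" by (simp add: mult.assoc[symmetric])
  also have "\<dots> \<le> 1 * (\<integral>\<^sup>+y. (p y)\<^sup>2 \<partial>lebesgue)"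
  proof (intro mult_right_mono)
    have "1574640 * LlogL v E \<le> 1574640 * threshold" by (intro mult_left_mono LlogL) simp
    also have "\<dots> = 1" unfolding threshold_def by (simp flip: ennreal_mult' ennreal_numeral)
    finally show "1574640 * LlogL v E \<le> 1" .
  qed simp
  finally show ?thesis by simp
qed

text \<open>All levels from n to m - 1 together weigh at most half of level m, which turns the
  influence of a hole into \<open>flux m\<close>.\<close>

lemma sum_pow3_le: "2 * (\<Sum>i<k. 3 ^ (n + i)) \<le> (3 ^ (n + k) :: ennreal)"
proof (induction k)
  case (Suc k)
  have "2 * (\<Sum>i<Suc k. 3 ^ (n + i)) = 2 * (\<Sum>i<k. 3 ^ (n + i)) + 2 * (3 ^ (n + k) :: ennreal)"
    by (simp add: distrib_left)
  also have "\<dots> \<le> 3 ^ (n + k) + 2 * 3 ^ (n + k)" by (intro add_right_mono Suc)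
  also have "\<dots> = (1 + 2) * 3 ^ (n + k)" by (simp only: distrib_right mult_1_left)
  finally show ?case by simp
qed simp

text \<open>At a point of the annulus the gradient in the hole \<open>B\<close> is felt only through
  the cells of levels n to m - 1. That contribution is bounded by a constant, which is multiplied by
  the small mass of \<open>v\<close>; the rest is the potential of \<open>f\<close> cut off to the
  annulus.\<close>

lemma annulus_energy:
  assumes v [measurable]: "v \<in> borel_measurable lebesgue" and g: "grad_pair u f"
    and zero: "(LINT y:ref n x|lebesgue. u y) = 0" and nm: "n \<le> m"
    and [measurable]: "B \<in> sets lebesgue" and B: "B \<subseteq> cell n x"
      "\<And>y k. y \<in> cell n x - B \<Longrightarrow> m \<le> k \<Longrightarrow> cell k y \<inter> B = {}"
    and WE: "ennreal ((1/9) ^ n) \<le> 9 * warea (cell n x - B)" and LlogL: "LlogL v (cell n x - B) \<le> threshold"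
  shows "10 * pot_energy v u (cell n x - B) \<le> 2 * energy f (cell n x - B) + flux m B f"
proof -
  interpret grad_pair u f by (rule g)
  define E where "E = cell n x - B"
  have [measurable]: "E \<in> sets lebesgue" unfolding E_def by measurable
  have [measurable]: "u \<in> borel_measurable lebesgue" using u by (simp add: sq_integrable_def)
  have un: "cell n x = E \<union> B" "E \<inter> B = {}" using B(1) by (auto simp: E_def)
  define VE where "VE = pot_energy v u E"
  define gE where "gE = energy f E"
  define q where "q = wmass f B"
  have FB: "flux m B f = (3 ^ m * q)\<^sup>2" by (simp add: flux_def q_def)
  let ?S = "\<lambda>x. \<Sum>i. 3 ^ (n + i) * wmass (\<lambda>z. f z * indicator E z) (cell (n + i) x)"
  \<comment> \<open>From |u| \<le> 54 (S + 3^m q / 2), with S the potential of the cut-off gradient,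
    and (a + b)^2 \<le> 2a^2 + 2b^2; here 2916 = 54^2 and 11664 = 4 * 54^2.\<close>
  have pt: "AE y in lebesgue. 2 * (v y * (ennreal (norm (u y)))\<^sup>2 * indicator E y)
      \<le> 11664 * (v y * (?S y)\<^sup>2 * indicator E y) + 2916 * (flux m B f * (v y * indicator E y))"
    using pointwise
  proof eventually_elim
    case (elim y)
    show ?case
    proof (cases "y \<in> E")
      case True
      then have yn: "y \<in> cell n x" by (simp add: E_def)
      then have "ref_mean n y = 0" using zero ref_cong[of y n x] unfolding ref_mean_def by simp
      then have "ennreal (norm (u y)) \<le> 54 * potential n f y"
        using elim[rule_format, of n] by simp
      also have "potential n f y
          \<le> (\<Sum>i. 3 ^ (n + i) * wmass (\<lambda>z. f z * indicator E z) (cell (n + i) y)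
                + (if i < m - n then 3 ^ (n + i) * q else 0))"
      proof (intro suminf_le allI summableI)
        fix i
        have inn: "cell (n + i) y \<subseteq> cell n x" using cell_antimono[of n "n + i" y] cell_eq[OF yn] by auto
        have out: "cell (n + i) y \<inter> B = {}" if "\<not> i < m - n"
          using B(2)[of y "n + i"] True that nm by (auto simp: E_def)
        have "wmass f (cell (n + i) y)
            \<le> (\<integral>\<^sup>+z. (f z * indicator E z) * weight z * indicator (cell (n + i) y) z
                 + (if i < m - n then f z * weight z * indicator B z else 0) \<partial>lebesgue)"
          using inn out un by (intro nn_integral_mono) (auto simp: indicator_def)
        also have "\<dots> = wmass (\<lambda>z. f z * indicator E z) (cell (n + i) y) + (if i < m - n then q else 0)"
          unfolding q_def by (subst nn_integral_add) auto
        finally have "3 ^ (n + i) * wmass f (cell (n + i) y)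
          \<le> 3 ^ (n + i) * ((wmass (\<lambda>z. f z * indicator E z) (cell (n + i) y)) + (if i < m - n then q else 0))"
          by (rule mult_left_mono) simp
        then show "3 ^ (n + i) * wmass f (cell (n + i) y)
          \<le> 3 ^ (n + i) * wmass (\<lambda>z. f z * indicator E z) (cell (n + i) y) + (if i < m - n then 3 ^ (n
              + i) * q else 0)"
          by (simp add: distrib_left split: if_splits)
      qed
      also have "\<dots> = ?S y + (\<Sum>i<m - n. 3 ^ (n + i)) * q"
      proof -
        have "(\<Sum>i. if i < m - n then 3 ^ (n + i) * q else 0) = (\<Sum>i<m - n. 3 ^ (n + i) * q)"
          by (subst suminf_finite[of "{..<m - n}"]) auto
        then show ?thesis by (subst suminf_add[symmetric]) (auto simp: sum_distrib_right)
      qed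
      finally have "ennreal (norm (u y)) \<le> 54 * (?S y + (\<Sum>i<m - n. 3 ^ (n + i)) * q)" by (simp add: mult_left_mono)
      then have "2 * ennreal (norm (u y)) \<le> 2 * (54 * (?S y + (\<Sum>i<m - n. 3 ^ (n + i)) * q))"
          by (rule mult_left_mono) simp
      also have "\<dots> = 54 * (2 * ?S y + (2 * (\<Sum>i<m - n. 3 ^ (n + i))) * q)" by (simp add: distrib_left ac_simps)
      also have "\<dots> \<le> 54 * (2 * ?S y + 3 ^ m * q)"
        using sum_pow3_le[where n = n and k = "m - n"] nm by (intro mult_left_mono add_left_mono mult_right_mono) auto
      finally have "(2 * ennreal (norm (u y)))\<^sup>2 \<le> (54 * (2 * ?S y + 3 ^ m * q))\<^sup>2" by (rule power_mono) simp
      also have "\<dots> = 2916 * (2 * ?S y + 3 ^ m * q)\<^sup>2" by (simp only: power_mult_distrib) simp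
      also have "\<dots> \<le> 2916 * (2 * (2 * ?S y)\<^sup>2 + 2 * (3 ^ m * q)\<^sup>2)" by (intro mult_left_mono ennreal_add_sq_le) simp
      also have "\<dots> = 2 * (11664 * (?S y)\<^sup>2 + 2916 * flux m B f)"
        unfolding FB power_mult_distrib by (simp add: distrib_left mult.assoc[symmetric])
      finally have "2 * (2 * (ennreal (norm (u y)))\<^sup>2) \<le> 2 * (11664 * (?S y)\<^sup>2 + 2916 * flux m B f)"
        by (simp add: power_mult_distrib mult.assoc[symmetric])
      then have "2 * (ennreal (norm (u y)))\<^sup>2 \<le> 11664 * (?S y)\<^sup>2 + 2916 * flux m B f"
        by (subst (asm) ennreal_mult_le_mult_iff) auto
      then have "v y * (2 * (ennreal (norm (u y)))\<^sup>2) \<le> v y * (11664 * (?S y)\<^sup>2 + 2916 * flux m B f)"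
        by (rule mult_left_mono) simp
      with True show ?thesis by (simp add: distrib_left ac_simps)
    qed simp
  qed
  have "2 * VE = (\<integral>\<^sup>+y. 2 * (v y * (ennreal (norm (u y)))\<^sup>2 * indicator E y) \<partial>lebesgue)"
    unfolding VE_def by (rule nn_integral_cmult[symmetric]) measurable
  also have "\<dots> \<le> (\<integral>\<^sup>+y. 11664 * (v y * (?S y)\<^sup>2 * indicator E y) + 2916 * (flux m B f * (v y * indicator E y))
      \<partial>lebesgue)"
    by (rule nn_integral_mono_AE[OF pt])
  also have "\<dots> = (\<integral>\<^sup>+y. 11664 * (v y * (?S y)\<^sup>2 * indicator E y) \<partial>lebesgue)
      + (\<integral>\<^sup>+y. 2916 * (flux m B f * (v y * indicator E y)) \<partial>lebesgue)"
    by (rule nn_integral_add) measurable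
  also have "(\<integral>\<^sup>+y. 11664 * (v y * (?S y)\<^sup>2 * indicator E y) \<partial>lebesgue) = 11664 * (\<integral>\<^sup>+y\<in>E. v y * (?S y)\<^sup>2 \<partial>lebesgue)"
    by (rule nn_integral_cmult) measurable
  also have "(\<integral>\<^sup>+y. 2916 * (flux m B f * (v y * indicator E y)) \<partial>lebesgue) = 2916 * (flux m B f * mass v E)"
    by (subst nn_integral_cmult, measurable, subst nn_integral_cmult, measurable)
  finally have "5 * (2 * VE) \<le> 5 * (11664 * (\<integral>\<^sup>+y\<in>E. v y * (?S y)\<^sup>2 \<partial>lebesgue) + 2916 * (flux m B f * mass v E))"
    by (rule mult_left_mono) simp
  also have "\<dots> = 2 * (29160 * (\<integral>\<^sup>+y\<in>E. v y * (?S y)\<^sup>2 \<partial>lebesgue)) + flux m B f * (14580 * mass v E)"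
    by (simp add: distrib_left mult.assoc[symmetric]) (simp add: ac_simps)
  also have "\<dots> \<le> 2 * gE + flux m B f * 1"
  proof (intro add_mono mult_left_mono)
    have "29160 * (\<integral>\<^sup>+y\<in>E. v y * (?S y)\<^sup>2 \<partial>lebesgue) \<le> (\<integral>\<^sup>+y. (f y * indicator E y)\<^sup>2 \<partial>lebesgue)"
      using LlogL WE by (intro annulus_potential v) (auto simp: E_def)
    also have "\<dots> = gE" unfolding gE_def by (intro nn_integral_cong) (auto simp: indicator_def)
    finally show "29160 * (\<integral>\<^sup>+y\<in>E. v y * (?S y)\<^sup>2 \<partial>lebesgue) \<le> gE" .
    have "14580 * mass v E \<le> 14580 * threshold"
      using order_trans[OF integral_le_LlogL LlogL] by (intro mult_left_mono) (auto simp: E_def)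
    also have "\<dots> = ennreal (14580 * (1 / 1574640))"
      unfolding threshold_def by (subst ennreal_mult) auto
    also have "\<dots> \<le> ennreal 1" by (rule ennreal_leI) simp
    finally show "14580 * mass v E \<le> 1" by simp
  qed auto
  finally have "10 * VE \<le> 2 * gE + flux m B f" by (simp add: mult.assoc[symmetric])
  then show ?thesis unfolding VE_def gE_def E_def .
qed

text \<open>The case of an empty hole: \<open>annulus_energy\<close> gives 5V \<le> e and
  \<open>flux_le\<close> adds 2e, well below 5e.\<close>

lemma controls_light:
  assumes v [measurable]: "v \<in> borel_measurable lebesgue" and LlogL: "LlogL v (cell n x) \<le> threshold"
  shows "controls v n (cell n x) {ref n x}"
  unfolding controls_def
proof (intro allI impI)
  fix u f assume g: "grad_pair u f" and zero: "\<forall>r\<in>{ref n x}. (LINT y:r|lebesgue. u y) = 0"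
  define V where "V = pot_energy v u (cell n x)"
  define e where "e = energy f (cell n x)"
  define F where "F = flux n (cell n x) f"
  have "10 * pot_energy v u (cell n x - {}) \<le> 2 * energy f (cell n x - {}) + flux n {} f"
    using zero LlogL warea_cell_ge[of n x] by (intro annulus_energy v g) auto
  then have 1: "10 * V \<le> 2 * e" by (simp add: flux_def V_def e_def)
  have 2: "F \<le> 2 * e"
    unfolding F_def e_def using g by (intro flux_le[where x = x]) (auto simp: grad_pair_def)
  have "2 * (5 * V + F) = 10 * V + 2 * F" by (simp add: distrib_left mult.assoc[symmetric])
  also have "\<dots> \<le> 2 * e + 2 * (2 * e)" by (intro add_mono 1 mult_left_mono 2) simp
  also have "\<dots> = (2 + 4) * e" by (simp only: distrib_right mult.assoc[symmetric]) simp
  also have "\<dots> \<le> 10 * e" by (intro mult_right_mono) auto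
  also have "\<dots> = 2 * (5 * e)" by (simp add: mult.assoc[symmetric])
  finally have "5 * V + F \<le> 5 * e" by (subst (asm) ennreal_mult_le_mult_iff) auto
  then show "5 * pot_energy v u (cell n x) + flux n (cell n x) f \<le> 5 * energy f (cell n x)"
    unfolding V_def F_def e_def .
qed

lemma nn_integral_Union_disjoint:
  assumes "finite \<C>" "\<And>c. c \<in> \<C> \<Longrightarrow> c \<in> sets M" "g \<in> borel_measurable M"
    "\<And>c d. c \<in> \<C> \<Longrightarrow> d \<in> \<C> \<Longrightarrow> c \<noteq> d \<Longrightarrow> c \<inter> d = {}"
  shows "(\<integral>\<^sup>+x\<in>\<Union>\<C>. g x \<partial>M) = (\<Sum>c\<in>\<C>. \<integral>\<^sup>+x\<in>c. g x \<partial>M)"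
proof -
  have "g x * indicator (\<Union>\<C>) x = (\<Sum>c\<in>\<C>. g x * indicator c x)" for x
  proof (cases "x \<in> \<Union>\<C>")
    case True
    then obtain c where c: "c \<in> \<C>" "x \<in> c" by blast
    have "(\<Sum>d\<in>\<C>. g x * indicator d x) = (\<Sum>d\<in>\<C>. if d = c then g x else 0)"
      using c assms(4) by (intro sum.cong) (auto simp: indicator_def)
    with c assms(1) show ?thesis by (simp add: indicator_def) blast
  next
    case False
    then show ?thesis by (auto simp: indicator_def intro!: sum.neutral[symmetric])
  qed
  then have "(\<integral>\<^sup>+x\<in>\<Union>\<C>. g x \<partial>M) = (\<integral>\<^sup>+x. (\<Sum>c\<in>\<C>. g x * indicator c x) \<partial>M)" by simp
  also have "\<dots> = (\<Sum>c\<in>\<C>. \<integral>\<^sup>+x\<in>c. g x \<partial>M)"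
    using assms(2,3) by (intro nn_integral_sum) auto
  finally show ?thesis .
qed

text \<open>The flux passes from a cell to its children without loss: Cauchy-Schwarz over at most
  nine of them costs 9, the square of the ratio of 3^(n+1) to 3^n. So no functional is spent on the
  branching itself.\<close>

lemma controls_branch:
  assumes v [measurable]: "v \<in> borel_measurable lebesgue" and n: "1 \<le> n"
    and G: "\<And>c. c \<in> children n x \<Longrightarrow> controls v (Suc n) c G"
  shows "controls v n (cell n x) G"
  unfolding controls_def
proof (intro allI impI)
  fix u f assume g: "grad_pair u f" and zero: "\<forall>r\<in>G. (LINT y:r|lebesgue. u y) = 0"
  interpret grad_pair u f by (rule g)
  have [measurable]: "u \<in> borel_measurable lebesgue" using u by (simp add: sq_integrable_def)
  let ?C = "children n x"
  have split: "mass h (cell n x) = (\<Sum>c\<in>?C. \<integral>\<^sup>+y\<in>c. h y \<partial>lebesgue)"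
    if "h \<in> borel_measurable lebesgue" for h
    unfolding children_Union[symmetric]
    by (intro nn_integral_Union_disjoint card_children children_sets that children_disjoint)
  have "flux n (cell n x) f = (3 ^ n)\<^sup>2 * (\<Sum>c\<in>?C. \<integral>\<^sup>+y\<in>c. f y * weight y \<partial>lebesgue)\<^sup>2"
    unfolding flux_def power_mult_distrib by (subst split) auto
  also have "\<dots> \<le> (3 ^ n)\<^sup>2 * (9 * (\<Sum>c\<in>?C. (wmass f c)\<^sup>2))"
  proof (intro mult_left_mono order_trans[OF ennreal_sum_sq_le] mult_right_mono)
    have "(of_nat (card ?C) :: ennreal) \<le> of_nat 9" using card_children(3)[OF n] by (intro of_nat_mono)
    then show "(of_nat (card ?C) :: ennreal) \<le> 9" by simp
  qed auto
  also have "\<dots> = (\<Sum>c\<in>?C. flux (Suc n) c f)"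
  proof -
    have "((3::ennreal) ^ Suc n)\<^sup>2 = (3 ^ n)\<^sup>2 * 9" by (simp add: power2_eq_square mult.commute mult.left_commute)
    then show ?thesis unfolding flux_def power_mult_distrib by (simp only: sum_distrib_left mult.assoc)
  qed
  finally have F: "flux n (cell n x) f \<le> (\<Sum>c\<in>?C. flux (Suc n) c f)" .
  have "5 * pot_energy v u (cell n x) + flux n (cell n x) f
     \<le> (\<Sum>c\<in>?C. 5 * pot_energy v u c) + (\<Sum>c\<in>?C. flux (Suc n) c f)"
    by (subst split) (auto simp: sum_distrib_left F intro: add_left_mono)
  also have "\<dots> = (\<Sum>c\<in>?C. 5 * pot_energy v u c + flux (Suc n) c f)"
    by (rule sum.distrib[symmetric])
  also have "\<dots> \<le> (\<Sum>c\<in>?C. 5 * energy f c)"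
    using G g zero unfolding controls_def by (intro sum_mono) blast
  also have "\<dots> = 5 * energy f (cell n x)"
    by (subst split) (auto simp: sum_distrib_left)
  finally show "5 * pot_energy v u (cell n x) + flux n (cell n x) f
     \<le> 5 * energy f (cell n x)" .
qed

text \<open>Up to scaling, the estimates are 5 VE \<le> gE + FB/2 and F \<le> 4 gE + 2/9 FB, with FB
  the flux of the hole; the 2/9 comes from n < m. They add up to 5 gE + 13/18 FB, and as 13/18 < 1
  the slack of the hole absorbs FB. The 5 in \<open>controls\<close> is this 1 + 4.\<close>

lemma controls_annulus:
  assumes v [measurable]: "v \<in> borel_measurable lebesgue" and nm: "n < m"
    and LlogL: "LlogL v (cell n x - cell m x) \<le> threshold" and G: "controls v m (cell m x) G"
  shows "controls v n (cell n x) (insert (ref n x) G)"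
  unfolding controls_def
proof (intro allI impI)
  fix u f assume g: "grad_pair u f" and zero: "\<forall>r\<in>insert (ref n x) G. (LINT y:r|lebesgue. u y) = 0"
  interpret grad_pair u f by (rule g)
  define B where "B = cell m x"
  define E where "E = cell n x - B"
  have [measurable]: "B \<in> sets lebesgue" "E \<in> sets lebesgue" unfolding B_def E_def by measurable
  have [measurable]: "u \<in> borel_measurable lebesgue" using u by (simp add: sq_integrable_def)
  have sub: "B \<subseteq> cell n x" unfolding B_def using nm by (intro cell_antimono) simp
  have un: "cell n x = E \<union> B" "E \<inter> B = {}" using sub by (auto simp: E_def)
  have split: "mass h (cell n x) = mass h E + mass h B"
    if [measurable]: "h \<in> borel_measurable lebesgue" for h
    unfolding un(1) using un(2)
    by (subst nn_integral_add[symmetric]) (auto simp: indicator_def intro!: nn_integral_cong)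
  define VE where "VE = pot_energy v u E"
  define VB where "VB = pot_energy v u B"
  define gE where "gE = energy f E"
  define gB where "gB = energy f B"
  define q where "q = wmass f B"
  have FB: "flux m B f = (3 ^ m * q)\<^sup>2" by (simp add: flux_def q_def)
  have 1: "10 * VE \<le> 2 * gE + flux m B f"
    unfolding VE_def gE_def E_def
  proof (rule annulus_energy[OF v g])
    show "cell k y \<inter> B = {}" if yk: "y \<in> cell n x - B" "m \<le> k" for y k
    proof (rule ccontr)
      assume "cell k y \<inter> B \<noteq> {}"
      then obtain w where "w \<in> cell m y" "w \<in> cell m x"
        using cell_antimono[OF yk(2), of y] by (auto simp: B_def)
      then have "cell m y = cell m x" using cell_eq by metis
      with yk(1) show False using cell_refl[of y m] by (simp add: B_def)
    qed
  qed (use zero nm sub LlogL warea_diff_ge[OF nm, of x x] in \<open>auto simp: B_def\<close>)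
  have 2: "9 * flux n (cell n x) f \<le> 36 * gE + 2 * flux m B f"
  proof -
    have "flux n (cell n x) f = (3 ^ n * wmass f E + 3 ^ n * q)\<^sup>2"
      unfolding flux_def q_def by (subst split) (auto simp: distrib_left)
    also have "\<dots> \<le> 2 * (3 ^ n * wmass f E)\<^sup>2 + 2 * (3 ^ n * q)\<^sup>2"
      by (rule ennreal_add_sq_le)
    also have "\<dots> \<le> 2 * (2 * gE) + 2 * (3 ^ n * q)\<^sup>2"
      using flux_le[OF f, of E n x] un(1) unfolding gE_def flux_def by (intro add_right_mono mult_left_mono) auto
    finally have "9 * flux n (cell n x) f \<le> 9 * (2 * (2 * gE) + 2 * (3 ^ n * q)\<^sup>2)" by (rule mult_left_mono) simp
    also have "\<dots> = 36 * gE + 2 * (3 ^ Suc n * q)\<^sup>2" by (simp add: distrib_left power_mult_distrib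
        mult.assoc[symmetric])
    also have "\<dots> \<le> 36 * gE + 2 * (3 ^ m * q)\<^sup>2"
      using nm by (intro add_left_mono mult_left_mono power_mono mult_right_mono power_increasing) auto
    finally show ?thesis unfolding FB .
  qed
  have 3: "5 * VB + flux m B f \<le> 5 * gB"
    using G g zero unfolding controls_def VB_def gB_def B_def by blast
  have "18 * (5 * (VE + VB) + flux n (cell n x) f) = 9 * (10 * VE) + 2 * (9 * flux n (cell n x) f) + 90 * VB"
    by (simp add: distrib_left mult.assoc[symmetric] add_ac)
  also have "\<dots> \<le> 9 * (2 * gE + flux m B f) + 2 * (36 * gE + 2 * flux m B f) + 90 * VB"
    by (intro add_mono mult_left_mono 1 2) auto
  also have "\<dots> = 18 * gE + 72 * gE + (9 * flux m B f + 4 * flux m B f) + 90 * VB"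
    by (simp add: distrib_left mult.assoc[symmetric] add_ac)
  also have "\<dots> = (18 + 72) * gE + (9 + 4) * flux m B f + 90 * VB"
    by (simp only: distrib_right)
  also have "\<dots> \<le> 90 * gE + 18 * flux m B f + 90 * VB"
    by (intro add_mono mult_right_mono) auto
  also have "\<dots> = 90 * gE + 18 * (5 * VB + flux m B f)"
    by (simp add: distrib_left mult.assoc[symmetric] add_ac)
  also have "\<dots> \<le> 90 * gE + 18 * (5 * gB)" by (intro add_left_mono mult_left_mono 3) simp
  also have "\<dots> = 18 * (5 * (gE + gB))" by (simp add: distrib_left mult.assoc[symmetric])
  finally have "5 * (VE + VB) + flux n (cell n x) f \<le> 5 * (gE + gB)"
    by (subst (asm) ennreal_mult_le_mult_iff) auto
  moreover have "pot_energy v u (cell n x) = VE + VB"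
    unfolding VE_def VB_def by (rule split) measurable
  moreover have "energy f (cell n x) = gE + gB"
    unfolding gE_def gB_def by (rule split) measurable
  ultimately show "5 * pot_energy v u (cell n x) + flux n (cell n x) f
      \<le> 5 * energy f (cell n x)" by simp
qed

section \<open>Counting the functionals\<close>

definition ref_squares :: "(real^2) set set" where "ref_squares = (\<Union>n. range (ref n))"

lemma LlogL_empty: "LlogL v {} = 0"
  by (simp add: LlogL_def dist_fun_def warea_def)

lemma disjoint_children: "disjoint_family_on (\<lambda>c. c) (children n x)"
  unfolding disjoint_family_on_def using children_disjoint by blast

text \<open>The additive \<open>10\<close> pays for splitting: with two heavy children it is gained once more than it is spent, and
  with one heavy child the annulus contributes more than \<open>threshold\<close>.\<close>

lemma controls_heavy:
  assumes v [measurable]: "v \<in> borel_measurable lebesgue"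
    and n0: "\<And>n x. n0 \<le> n \<Longrightarrow> LlogL v (cell n x) \<le> threshold"
  shows "1 \<le> n \<Longrightarrow> n \<le> m \<Longrightarrow> threshold < LlogL v (cell m y) \<Longrightarrow> LlogL v (cell n y - cell m y) \<le> threshold \<Longrightarrow>
    \<exists>G. finite G \<and> G \<subseteq> ref_squares \<and> controls v n (cell n y) G
      \<and> (of_nat (card G) + 10) * threshold \<le> 20 * LlogL v (cell n y)"
proof (induction "n0 - m" arbitrary: n m y rule: less_induct)
  case less
  have "m < n0" using n0[of m y] less.prems(3) by (meson leD not_le_imp_less)
  then have dec: "n0 - Suc m < n0 - m" by simp
  have sub: "cell m y \<subseteq> cell n y" using less.prems(2) by (rule cell_antimono)
  define C where "C = children m y"
  define H where "H = {c \<in> C. threshold < LlogL v c}"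
  have C: "finite C" "card C \<le> 9" "\<And>c. c \<in> C \<Longrightarrow> c \<in> sets lebesgue" "\<Union>C = cell m y"
    unfolding C_def using card_children(1)[of m y] card_children(3)[of m y] children_sets children_Union
        less.prems by auto
  have H: "H \<subseteq> C" "finite H" using C(1) by (auto simp: H_def)
  have cell_of: "\<exists>z. c = cell (Suc m) z \<and> cell n z = cell n y" if "c \<in> C" for c
    using that sub cell_eq unfolding C_def children_def by blast
  show ?case
  \<comment> \<open>A sole heavy child inside a still light annulus merely prolongs the chain: m
    advances, n stays, and no functional is spent.\<close>
  proof (cases "\<exists>c. H = {c} \<and> LlogL v (cell n y - c) \<le> threshold")
    case True
    then obtain c where c: "H = {c}" "LlogL v (cell n y - c) \<le> threshold" by blast
    then obtain z where z: "c = cell (Suc m) z" "cell n z = cell n y" using H cell_of by blast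
    have "threshold < LlogL v (cell (Suc m) z)" using c(1) z(1) by (auto simp: H_def)
    then show ?thesis
      using less.hyps[OF dec, of n z] less.prems c(2) unfolding z by auto
  next
    case False
    have "\<exists>G. finite G \<and> G \<subseteq> ref_squares \<and> controls v (Suc m) c G
      \<and> (c \<in> H \<longrightarrow> (of_nat (card G) + 10) * threshold \<le> 20 * LlogL v c) \<and> (c \<notin> H \<longrightarrow> card G \<le> 1)" if "c \<in> C" for c
    proof -
      obtain z where z: "c = cell (Suc m) z" using cell_of[OF \<open>c \<in> C\<close>] by blast
      show ?thesis
      proof (cases "c \<in> H")
        case True
        then have "threshold < LlogL v (cell (Suc m) z)" using z by (simp add: H_def)
        \<comment> \<open>A heavy child starts a new chain with both levels equal to
          \<open>Suc m\<close>; its annulus is empty, hence light.\<close>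
        then show ?thesis using less.hyps[OF dec, of "Suc m" z] True unfolding z by (auto simp: LlogL_empty)
      next
        case False
        then have "LlogL v (cell (Suc m) z) \<le> threshold" using that z by (simp add: H_def not_less)
        then have "controls v (Suc m) c {ref (Suc m) z}" unfolding z by (rule controls_light[OF v])
        with False show ?thesis by (intro exI[of _ "{ref (Suc m) z}"]) (auto simp: ref_squares_def)
      qed
    qed
    then have "\<forall>c\<in>C. \<exists>G. finite G \<and> G \<subseteq> ref_squares \<and> controls v (Suc m) c G
      \<and> (c \<in> H \<longrightarrow> (of_nat (card G) + 10) * threshold \<le> 20 * LlogL v c) \<and> (c \<notin> H \<longrightarrow> card G \<le> 1)" by blast
    from bchoice[OF this] obtain g where
      gC: "\<forall>c\<in>C. finite (g c) \<and> g c \<subseteq> ref_squares \<and> controls v (Suc m) c (g c)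
        \<and> (c \<in> H \<longrightarrow> (of_nat (card (g c)) + 10) * threshold \<le> 20 * LlogL v c) \<and> (c \<notin> H \<longrightarrow> card (g c) \<le> 1)" ..
    have g: "finite (g c)" "g c \<subseteq> ref_squares" "controls v (Suc m) c (g c)"
        "c \<in> H \<longrightarrow> (of_nat (card (g c)) + 10) * threshold \<le> 20 * LlogL v c" "c \<notin> H \<longrightarrow> card (g c) \<le> 1"
      if "c \<in> C" for c
      using bspec[OF gC that] by - (elim conjE, assumption)+
    have gH: "(of_nat (card (g c)) + 10) * threshold \<le> 20 * LlogL v c" if "c \<in> H" for c
      using g(4)[OF subsetD[OF H(1) that]] that by (rule mp)
    define G1 where "G1 = (\<Union>c\<in>C. g c)"
    define G where "G = insert (ref n y) G1"
    have "controls v m (cell m y) G1"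
    proof (rule controls_branch[OF v])
      show "1 \<le> m" using less.prems by simp
      show "controls v (Suc m) c G1" if "c \<in> children m y" for c
        by (rule controls_mono[OF g(3)]) (use that in \<open>auto simp: G1_def C_def\<close>)
    qed
    note branch = this
    have ctl: "controls v n (cell n y) G"
    proof (cases "n = m")
      case True
      then have "controls v n (cell n y) G1" using branch by simp
      then show ?thesis by (rule controls_mono) (auto simp: G_def)
    next
      case False
      then show ?thesis unfolding G_def using less.prems(2,4) branch by (intro controls_annulus[OF v]) auto
    qed
    have "ref n y \<in> ref_squares" by (auto simp: ref_squares_def)
    moreover have "G1 \<subseteq> ref_squares" unfolding G1_def by (intro UN_least g(2))
    ultimately have fin: "finite G" "G \<subseteq> ref_squares"
      unfolding G_def using C(1) g(1) by (simp_all add: G1_def)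
    \<comment> \<open>One functional for the annulus, one for each of at most 9 - card H light
      children, and those already chosen for the heavy ones.\<close>
    have card: "card G + 10 + card H \<le> 20 + (\<Sum>c\<in>H. card (g c))"
    proof -
      have "card G \<le> Suc (card G1)" unfolding G_def by (rule card_insert_le_m1) auto
      also have "card G1 \<le> (\<Sum>c\<in>C. card (g c))" unfolding G1_def by (rule card_UN_le[OF C(1)])
      also have "\<dots> = (\<Sum>c\<in>H. card (g c)) + (\<Sum>c\<in>C - H. card (g c))"
        using sum.subset_diff[OF H(1) C(1), of "\<lambda>c. card (g c)"] by simp
      also have "(\<Sum>c\<in>C - H. card (g c)) \<le> (\<Sum>c\<in>C - H. 1)" using g(5) by (intro sum_mono) auto
      also have "(\<Sum>c\<in>C - H. 1) = card C - card H" using H by (simp add: card_Diff_subset)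
      finally show ?thesis using C(2) card_mono[OF C(1) H(1)] by linarith
    qed
    have sumZ: "(\<Sum>c\<in>H. LlogL v c) \<le> LlogL v (cell m y)"
    proof -
      have "(\<Sum>c\<in>H. LlogL v c) \<le> LlogL v (\<Union>c\<in>H. c)"
        using H(1) C(3) disjoint_family_on_mono[OF H(1)] disjoint_children[of m y] unfolding C_def[symmetric]
        by (intro LlogL_sum_le v H(2)) auto
      also have "\<dots> \<le> LlogL v (cell m y)" using H(1) C(4) by (intro LlogL_mono) auto
      finally show ?thesis .
    qed
    have mono: "LlogL v (cell m y) \<le> LlogL v (cell n y)" by (rule LlogL_mono[OF sub])
    have "(of_nat (card G) + 10) * threshold \<le> 20 * LlogL v (cell n y)"
    proof -
      consider "card H = 0" | "card H = 1" | "2 \<le> card H" by linarith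
      then show ?thesis
      proof cases
        case 1
        then have "H = {}" using H(2) by simp
        then have "card G + 10 \<le> 20" using card by simp
        from of_nat_mono[OF this, where 'a = ennreal] have "(of_nat (card G) + 10 :: ennreal) \<le> 20"
          by (simp only: of_nat_add of_nat_numeral)
        then have "(of_nat (card G) + 10) * threshold \<le> 20 * threshold" by (intro mult_right_mono) auto
        also have "\<dots> \<le> 20 * LlogL v (cell n y)" using less.prems(3) mono by (intro mult_left_mono) auto
        finally show ?thesis .
      next
        case 2
        then obtain c where c: "H = {c}" by (auto simp: card_1_singleton_iff)
        then have big: "threshold < LlogL v (cell n y - c)" using False by (auto simp: not_le)
        have cC: "c \<in> C" "c \<in> H" using c H(1) by auto
        have "card G + 10 \<le> 9 + (card (g c) + 10)" using card 2 unfolding c by simp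
        from of_nat_mono[OF this, where 'a = ennreal]
        have "(of_nat (card G) + 10 :: ennreal) \<le> 9 + (of_nat (card (g c)) + 10)"
          by (simp only: of_nat_add of_nat_numeral)
        then have "(of_nat (card G) + 10) * threshold \<le> 9 * threshold + (of_nat (card (g c)) + 10) * threshold"
          unfolding distrib_right[symmetric] by (intro mult_right_mono) auto
        also have "\<dots> \<le> 20 * LlogL v (cell n y - c) + 20 * LlogL v c"
          using big by (intro add_mono gH cC mult_mono) auto
        also have "\<dots> = 20 * (LlogL v (cell n y - c) + LlogL v c)" by (rule distrib_left[symmetric])
        also have "\<dots> \<le> 20 * LlogL v ((cell n y - c) \<union> c)"
          using C(3)[OF cC(1)] by (intro mult_left_mono LlogL_superadditive v) auto
        also have "(cell n y - c) \<union> c = cell n y" using cC(1) C(4) sub by auto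
        finally show ?thesis .
      next
        case 3
        have "(\<Sum>c\<in>H. card (g c) + 10) = (\<Sum>c\<in>H. card (g c)) + 10 * card H" by (simp add: sum.distrib)
        with card 3 have "card G + 10 \<le> (\<Sum>c\<in>H. card (g c) + 10)" by linarith
        from of_nat_mono[OF this, where 'a = ennreal]
        have "(of_nat (card G) + 10 :: ennreal) \<le> (\<Sum>c\<in>H. of_nat (card (g c)) + 10)"
          by (simp only: of_nat_add of_nat_numeral of_nat_sum)
        then have "(of_nat (card G) + 10) * threshold \<le> (\<Sum>c\<in>H. of_nat (card (g c)) + 10) * threshold"
          by (rule mult_right_mono) simp
        also have "\<dots> = (\<Sum>c\<in>H. (of_nat (card (g c)) + 10) * threshold)" by (rule sum_distrib_right)
        also have "\<dots> \<le> (\<Sum>c\<in>H. 20 * LlogL v c)" by (intro sum_mono gH)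
        also have "\<dots> = 20 * (\<Sum>c\<in>H. LlogL v c)" by (rule sum_distrib_left[symmetric])
        also have "\<dots> \<le> 20 * LlogL v (cell n y)" using order_trans[OF sumZ mono] by (rule mult_left_mono) simp
        finally show ?thesis .
      qed
    qed
    with ctl fin show ?thesis by blast
  qed
qed

text \<open>The root is treated apart because it may have ten children, one more than
  \<open>controls_branch\<close> allows. Each child costs at most \<open>threshold\<close> plus 20
  times its \<open>LlogL\<close>; when the plane is heavy, ten thresholds are below 10 times its
  \<open>LlogL\<close>, whence 30.\<close>

theorem finite_control:
  assumes v [measurable]: "v \<in> borel_measurable lebesgue" and fin: "LlogL v UNIV < top"
  obtains G where "finite G" "G \<subseteq> ref_squares" "of_nat (card G) * threshold \<le> threshold + 30 * LlogL v UNIV"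
    "\<And>u f. grad_pair u f \<Longrightarrow> (\<forall>r\<in>G. (LINT y:r|lebesgue. u y) = 0) \<Longrightarrow>
      (\<integral>\<^sup>+x. v x * (ennreal (norm (u x)))\<^sup>2 \<partial>lebesgue) \<le> (\<integral>\<^sup>+x. (f x)\<^sup>2 \<partial>lebesgue)"
proof -
  have cancel: "a \<le> b" if "5 * a + c \<le> 5 * (b::ennreal)" for a b c
  proof -
    have "5 * a \<le> 5 * a + c" by simp
    also note that
    finally have "5 * a \<le> 5 * b" .
    then show ?thesis by (subst (asm) ennreal_mult_le_mult_iff) auto
  qed
  show thesis
  proof (cases "LlogL v UNIV \<le> threshold")
    case True
    then have ctl: "controls v 0 UNIV {ref 0 0}" using controls_light[OF v, of 0 0] by (simp add: cell_0)
    show thesis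
    proof (rule that[of "{ref 0 0}"])
      show "of_nat (card {ref 0 0}) * threshold \<le> threshold + 30 * LlogL v UNIV" by simp
      fix u f assume "grad_pair u f" "\<forall>r\<in>{ref 0 0}. (LINT y:r|lebesgue. u y) = 0"
      with ctl show "(\<integral>\<^sup>+x. v x * (ennreal (norm (u x)))\<^sup>2 \<partial>lebesgue) \<le> (\<integral>\<^sup>+x. (f x)\<^sup>2 \<partial>lebesgue)"
        unfolding controls_def by - (rule cancel[where c = "flux 0 UNIV f"], simp)
    qed (auto simp: ref_squares_def)
  next
    case big: False
    have "0 < threshold" by (simp add: threshold_def)
    from LlogL_cell_small[OF v fin this] obtain n0 where n0: "\<And>n x. n0 \<le> n \<Longrightarrow> LlogL v (cell n x) \<le> threshold" by blast
    define C where "C = children 0 0"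
    have C: "finite C" "card C \<le> 10" "\<And>c. c \<in> C \<Longrightarrow> c \<in> sets lebesgue" "\<Union>C = UNIV"
      unfolding C_def using card_children(1,2)[of 0 0] children_sets children_Union[of 0 0] by (auto simp: cell_0)
    have dj: "\<And>c d. c \<in> C \<Longrightarrow> d \<in> C \<Longrightarrow> c \<noteq> d \<Longrightarrow> c \<inter> d = {}"
      unfolding C_def by (rule children_disjoint)
    have "\<exists>G. finite G \<and> G \<subseteq> ref_squares \<and> controls v 1 c G \<and> of_nat (card G) * threshold \<le> threshold
        + 20 * LlogL v c" if "c \<in> C" for c
    proof -
      obtain z where z: "c = cell 1 z" using \<open>c \<in> C\<close> by (auto simp: C_def children_def)
      show ?thesis
      proof (cases "LlogL v c \<le> threshold")
        case True
        then have "controls v 1 c {ref 1 z}" unfolding z by (rule controls_light[OF v])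
        then show ?thesis by (intro exI[of _ "{ref 1 z}"]) (auto simp: ref_squares_def)
      next
        case False
        then obtain G where G: "finite G" "G \<subseteq> ref_squares" "controls v 1 c G" "(of_nat (card G)
            + 10) * threshold \<le> 20 * LlogL v c"
          using controls_heavy[OF v n0, where n = 1 and m = 1 and y = z] unfolding z
              by (auto simp: LlogL_empty not_le)
        have "of_nat (card G) * threshold \<le> (of_nat (card G) + 10) * threshold" by (intro mult_right_mono) auto
        also have "\<dots> \<le> 20 * LlogL v c" by (rule G(4))
        also have "\<dots> \<le> threshold + 20 * LlogL v c" by simp
        finally show ?thesis using G by blast
      qed
    qed
    then have "\<forall>c\<in>C. \<exists>G. finite G \<and> G \<subseteq> ref_squares \<and> controls v 1 c G \<and> of_nat (card G) * threshold \<le> threshold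
        + 20 * LlogL v c" by blast
    from bchoice[OF this] obtain g where
      gC: "\<forall>c\<in>C. finite (g c) \<and> g c \<subseteq> ref_squares \<and> controls v 1 c (g c) \<and> of_nat (card (g c)) * threshold
          \<le> threshold + 20 * LlogL v c" ..
    have g: "finite (g c)" "g c \<subseteq> ref_squares" "controls v 1 c (g c)" "of_nat (card (g c)) * threshold
        \<le> threshold + 20 * LlogL v c"
      if "c \<in> C" for c
      using bspec[OF gC that] by - (elim conjE, assumption)+
    define G where "G = (\<Union>c\<in>C. g c)"
    show thesis
    proof (rule that[of G])
      show "finite G" unfolding G_def using C(1) g(1) by blast
      show "G \<subseteq> ref_squares" unfolding G_def by (intro UN_least g(2))
      have "(of_nat (card G) :: ennreal) \<le> of_nat (\<Sum>c\<in>C. card (g c))"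
        unfolding G_def by (intro of_nat_mono card_UN_le C(1))
      then have "of_nat (card G) * threshold \<le> (\<Sum>c\<in>C. of_nat (card (g c))) * threshold"
        by (intro mult_right_mono) auto
      also have "\<dots> = (\<Sum>c\<in>C. of_nat (card (g c)) * threshold)" by (rule sum_distrib_right)
      also have "\<dots> \<le> (\<Sum>c\<in>C. threshold + 20 * LlogL v c)" by (intro sum_mono g(4))
      also have "\<dots> = of_nat (card C) * threshold + 20 * (\<Sum>c\<in>C. LlogL v c)"
        by (simp add: sum.distrib sum_distrib_left)
      also have "\<dots> \<le> 10 * LlogL v UNIV + 20 * LlogL v UNIV"
      proof (intro add_mono mult_mono mult_left_mono)
        show "(of_nat (card C) :: ennreal) \<le> 10" using of_nat_mono[OF C(2)] by simp
        have "(\<Sum>c\<in>C. LlogL v c) \<le> LlogL v (\<Union>c\<in>C. c)"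
          using C disjoint_children[of 0 0] unfolding C_def[symmetric] by (intro LlogL_sum_le v) auto
        then show "(\<Sum>c\<in>C. LlogL v c) \<le> LlogL v UNIV" using C(4) by simp
      qed (use big in auto)
      also have "\<dots> = (10 + 20) * LlogL v UNIV" by (rule distrib_right[symmetric])
      also have "\<dots> \<le> threshold + 30 * LlogL v UNIV" by simp
      finally show "of_nat (card G) * threshold \<le> threshold + 30 * LlogL v UNIV" .
    next
      fix u f assume gp: "grad_pair u f" and zero: "\<forall>r\<in>G. (LINT y:r|lebesgue. u y) = 0"
      interpret grad_pair u f by (rule gp)
      have [measurable]: "u \<in> borel_measurable lebesgue" using u by (simp add: sq_integrable_def)
      have split: "(\<integral>\<^sup>+y. h y \<partial>lebesgue) = (\<Sum>c\<in>C. \<integral>\<^sup>+y\<in>c. h y \<partial>lebesgue)"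
        if "h \<in> borel_measurable lebesgue" for h
        using nn_integral_Union_disjoint[OF C(1,3) that dj] unfolding C(4) by simp
      have "(\<integral>\<^sup>+x. v x * (ennreal (norm (u x)))\<^sup>2 \<partial>lebesgue) = (\<Sum>c\<in>C. \<integral>\<^sup>+x\<in>c. v x * (ennreal (norm (u x)))\<^sup>2
          \<partial>lebesgue)"
        by (rule split) measurable
      also have "\<dots> \<le> (\<Sum>c\<in>C. \<integral>\<^sup>+x\<in>c. (f x)\<^sup>2 \<partial>lebesgue)"
      proof (intro sum_mono)
        fix c assume "c \<in> C"
        then have "controls v 1 c (g c)" "\<forall>r\<in>g c. (LINT y:r|lebesgue. u y) = 0"
          using g(3) zero by (auto simp: G_def)
        then show "pot_energy v u c \<le> energy f c"
          using gp unfolding controls_def by - (rule cancel[where c = "flux 1 c f"], blast)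
      qed
      also have "\<dots> = (\<integral>\<^sup>+x. (f x)\<^sup>2 \<partial>lebesgue)" by (rule split[symmetric]) measurable
      finally show "(\<integral>\<^sup>+x. v x * (ennreal (norm (u x)))\<^sup>2 \<partial>lebesgue) \<le> (\<integral>\<^sup>+x. (f x)\<^sup>2 \<partial>lebesgue)" .
    qed
  qed
qed

section \<open>Negative subspaces\<close>

context vector_space
begin

text \<open>Each functional lowers the dimension by at most one: it vanishes on L, or L is spanned
  by its kernel in L and one further vector.\<close>

lemma subset_span_of_functionals:
  assumes "finite I" "subspace L"
    and "\<And>i u w. i \<in> I \<Longrightarrow> u \<in> L \<Longrightarrow> w \<in> L \<Longrightarrow> l i (u + w) = l i u + l i w"
    and "\<And>i c u. i \<in> I \<Longrightarrow> u \<in> L \<Longrightarrow> l i (scale c u) = c * l i u"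
    and "\<And>u. u \<in> L \<Longrightarrow> (\<And>i. i \<in> I \<Longrightarrow> l i u = 0) \<Longrightarrow> u = 0"
  shows "\<exists>B. finite B \<and> card B \<le> card I \<and> L \<subseteq> span B"
  using assms
proof (induction I arbitrary: L rule: finite_induct)
  case empty
  then have "L \<subseteq> span {}" by auto
  then show ?case by (intro exI[of _ "{}"]) simp
next
  case (insert i I)
  note sub = insert.prems(1) and add = insert.prems(2) and hom = insert.prems(3) and triv = insert.prems(4)
  define L' where "L' = {u \<in> L. l i u = 0}"
  have "l i 0 = 0" using hom[of i 0 0] subspace_0[OF sub] by simp
  then have "subspace L'"
    using sub add[of i] hom[of i] unfolding L'_def by (auto simp: subspace_def)
  then have "\<exists>B. finite B \<and> card B \<le> card I \<and> L' \<subseteq> span B"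
  proof (rule insert.IH)
    show "u = 0" if "u \<in> L'" "\<And>j. j \<in> I \<Longrightarrow> l j u = 0" for u
      by (rule triv) (use that in \<open>auto simp: L'_def\<close>)
  qed (use add hom in \<open>auto simp: L'_def\<close>)
  then obtain B where B: "finite B" "card B \<le> card I" "L' \<subseteq> span B" by blast
  show ?case
  proof (cases "L \<subseteq> L'")
    case True
    with B insert.hyps show ?thesis by (intro exI[of _ B]) auto
  next
    case False
    then obtain w where w: "w \<in> L" "l i w \<noteq> 0" by (auto simp: L'_def)
    have "u \<in> span (insert w B)" if "u \<in> L" for u
    proof -
      define c where "c = l i u / l i w"
      have m: "scale (- c) w \<in> L" using sub w by (intro subspace_scale)
      then have "u + scale (- c) w \<in> L" using sub that by (intro subspace_add)
      moreover have "l i (u + scale (- c) w) = 0"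
        using add[of i u "scale (- c) w"] hom[of i w "- c"] m that w by (simp add: c_def)
      ultimately have "u + scale (- c) w \<in> span (insert w B)"
        using B(3) span_mono[of B "insert w B"] by (auto simp: L'_def)
      moreover have "scale c w \<in> span (insert w B)" by (intro span_scale span_base) simp
      ultimately have "(u + scale (- c) w) + scale c w \<in> span (insert w B)" by (rule span_add)
      moreover have "(u + scale (- c) w) + scale c w = u" by simp
      ultimately show ?thesis by (simp only:)
    qed
    moreover have "card (insert w B) \<le> card (insert i I)"
      using B insert.hyps card_insert_le_m1[of "card (insert i I)" B w] by simp
    ultimately show ?thesis using B(1) by (intro exI[of _ "insert w B"]) auto
  qed
qed

text \<open>The finite spanning set both excludes the infinite value of \<open>edim\<close> and
  bounds \<open>dim\<close>.\<close>

lemma edim_le_card_functionals: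
  assumes "finite I" "subspace L"
    and "\<And>i u w. i \<in> I \<Longrightarrow> u \<in> L \<Longrightarrow> w \<in> L \<Longrightarrow> l i (u + w) = l i u + l i w"
    and "\<And>i c u. i \<in> I \<Longrightarrow> u \<in> L \<Longrightarrow> l i (scale c u) = c * l i u"
    and "\<And>u. u \<in> L \<Longrightarrow> (\<And>i. i \<in> I \<Longrightarrow> l i u = 0) \<Longrightarrow> u = 0"
  shows "edim L \<le> enat (card I)"
proof -
  obtain B where B: "finite B" "card B \<le> card I" "L \<subseteq> span B"
    using subset_span_of_functionals[of I L l] assms by blast
  then have "dim L \<le> card I" using dim_le_card[of L B] by linarith
  with B show ?thesis unfolding edim_def by auto
qed

end

section \<open>Representatives of classes and their gradients\<close>

lemma rep_l2_sq_integrable: "sq_integrable (rep_l2 u)"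
  using Quotient3_rel_rep[OF Quotient3_l2, of u u] by (simp add: l2_rel_def)

lemma abs_rep_l2: "abs_l2 (rep_l2 u) = u"
  by (rule Quotient3_abs_rep[OF Quotient3_l2])

lemma rep_abs_l2: "sq_integrable f \<Longrightarrow> AE x in lebesgue. rep_l2 (abs_l2 f) x = f x"
  using Quotient3_rep_abs[OF Quotient3_l2, of f] by (simp add: l2_rel_def)

lemma l2_eqI: "AE x in lebesgue. rep_l2 u x = rep_l2 w x \<Longrightarrow> u = w"
  using Quotient3_rel_rep[OF Quotient3_l2, of u w] by (simp add: l2_rel_def rep_l2_sq_integrable)

text \<open>The choice of representatives is linear only almost everywhere, which is enough for the
  means to be linear functionals on classes.\<close>

lemma rep_l2_add: "AE x in lebesgue. rep_l2 (u + w) x = rep_l2 u x + rep_l2 w x"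
proof -
  have "u + w = abs_l2 (\<lambda>x. rep_l2 u x + rep_l2 w x)"
    using plus_l2.abs_eq[of "rep_l2 u" "rep_l2 w"] by (simp add: abs_rep_l2 l2_rel_def rep_l2_sq_integrable)
  then show ?thesis
    using rep_abs_l2[OF sq_integrable_add[OF rep_l2_sq_integrable rep_l2_sq_integrable]] by simp
qed

lemma rep_l2_scale: "AE x in lebesgue. rep_l2 (scale_l2 c u) x = c * rep_l2 u x"
proof -
  have "scale_l2 c u = abs_l2 (\<lambda>x. c * rep_l2 u x)"
    using scale_l2.abs_eq[of "rep_l2 u" c] by (simp add: abs_rep_l2 l2_rel_def rep_l2_sq_integrable)
  then show ?thesis
    using rep_abs_l2[OF sq_integrable_scale[OF rep_l2_sq_integrable]] by simp
qed

lemma rep_l2_measurable [measurable]: "rep_l2 u \<in> borel_measurable lebesgue"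
  using rep_l2_sq_integrable by (simp add: sq_integrable_def)

lemma has_weak_pderiv_iff: "has_weak_pderiv i u g \<longleftrightarrow> weak_deriv i (rep_l2 u) (rep_l2 g)"
  by (simp add: has_weak_pderiv_def weak_deriv_def)

text \<open>Uniqueness makes the definite description in \<open>weak_pderiv\<close> denote.\<close>

lemma weak_pderiv_works:
  assumes "u \<in> W12" shows "weak_deriv i (rep_l2 u) (rep_l2 (weak_pderiv i u))"
proof -
  obtain g where g: "has_weak_pderiv i u g" using assms by (auto simp: W12_def)
  have "h = g" if "has_weak_pderiv i u h" for h
    using that g weak_deriv_unique rep_l2_sq_integrable unfolding has_weak_pderiv_iff by (intro l2_eqI) blast
  with g have "has_weak_pderiv i u (weak_pderiv i u)" unfolding weak_pderiv_def by (rule theI)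
  then show ?thesis by (simp add: has_weak_pderiv_iff)
qed

definition grad_sq :: "l2 \<Rightarrow> real^2 \<Rightarrow> real" where
  "grad_sq u x = (\<Sum>i\<in>UNIV. (norm (rep_l2 (weak_pderiv i u) x))\<^sup>2)"

lemma grad_sq_integrable: "integrable lebesgue (grad_sq u)"
  unfolding grad_sq_def using rep_l2_sq_integrable by (intro Bochner_Integration.integrable_sum) (simp add:
      sq_integrable_def)

lemma grad_sq_nonneg: "0 \<le> grad_sq u x" unfolding grad_sq_def by (intro sum_nonneg) auto

text \<open>The length of the gradient dominates each partial derivative, so one \<open>f\<close>
  serves both directions.\<close>

lemma grad_pair_rep_l2:
  assumes "u \<in> W12" shows "grad_pair (rep_l2 u) (\<lambda>x. ennreal (sqrt (grad_sq u x)))"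
proof
  show "sq_integrable (rep_l2 u)" by (rule rep_l2_sq_integrable)
  have [measurable]: "grad_sq u \<in> borel_measurable lebesgue" unfolding grad_sq_def by measurable
  show "(\<lambda>x. ennreal (sqrt (grad_sq u x))) \<in> borel_measurable lebesgue" by measurable
  have "(\<integral>\<^sup>+x. (ennreal (sqrt (grad_sq u x)))\<^sup>2 \<partial>lebesgue) = ennreal (\<integral>x. grad_sq u x \<partial>lebesgue)"
    by (subst nn_integral_eq_integral[symmetric]) (auto simp: grad_sq_integrable grad_sq_nonneg ennreal_power)
  then show "(\<integral>\<^sup>+x. (ennreal (sqrt (grad_sq u x)))\<^sup>2 \<partial>lebesgue) < \<infinity>" by simp
next
  fix i k :: 2 and a b a' b' c d :: real
  assume *: "i \<noteq> k" "a < b" "a' < b'" "c < d"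
  have "ennreal (norm ((LINT x:slab i k a b c d|lebesgue. rep_l2 u x) / of_real (b - a)
        - (LINT x:slab i k a' b' c d|lebesgue. rep_l2 u x) / of_real (b' - a')))
     \<le> (\<integral>\<^sup>+x\<in>cslab i k (min a a') (max b b') c d. ennreal (norm (rep_l2 (weak_pderiv i u) x)) \<partial>lebesgue)"
    by (intro weak_deriv_slab_mean_diff weak_pderiv_works assms rep_l2_sq_integrable *)
  also have "\<dots> \<le> (\<integral>\<^sup>+x\<in>cslab i k (min a a') (max b b') c d. ennreal (sqrt (grad_sq u x)) \<partial>lebesgue)"
  proof (intro nn_integral_mono mult_right_mono ennreal_leI real_le_rsqrt)
    fix x
    show "(norm (rep_l2 (weak_pderiv i u) x))\<^sup>2 \<le> grad_sq u x"
      unfolding grad_sq_def by (rule member_le_sum) auto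
  qed simp
  finally show "ennreal (norm ((LINT x:slab i k a b c d|lebesgue. rep_l2 u x) / of_real (b - a)
        - (LINT x:slab i k a' b' c d|lebesgue. rep_l2 u x) / of_real (b' - a')))
     \<le> (\<integral>\<^sup>+x\<in>cslab i k (min a a') (max b b') c d. ennreal (sqrt (grad_sq u x)) \<partial>lebesgue)" .
qed

lemma set_integral_rep_l2_linear:
  assumes [measurable]: "r \<in> sets lebesgue" and fin: "emeasure lebesgue r < \<infinity>"
  shows "(LINT y:r|lebesgue. rep_l2 (u + w) y) = (LINT y:r|lebesgue. rep_l2 u y) + (LINT y:r|lebesgue. rep_l2 w y)"
    "(LINT y:r|lebesgue. rep_l2 (scale_l2 c u) y) = c * (LINT y:r|lebesgue. rep_l2 u y)"
proof -
  have int: "set_integrable lebesgue r (rep_l2 u)" for u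
    by (intro sq_integrable_set_integrable rep_l2_sq_integrable assms)
  have "(LINT y:r|lebesgue. rep_l2 (u + w) y) = (LINT y:r|lebesgue. rep_l2 u y + rep_l2 w y)"
    unfolding set_lebesgue_integral_def
  proof (rule integral_cong_AE)
    show "AE y in lebesgue. indicator r y *\<^sub>R rep_l2 (u + w) y = indicator r y *\<^sub>R (rep_l2 u y + rep_l2 w y)"
      using rep_l2_add[of u w] by eventually_elim simp
  qed measurable
  then show "(LINT y:r|lebesgue. rep_l2 (u + w) y) = (LINT y:r|lebesgue. rep_l2 u y)
      + (LINT y:r|lebesgue. rep_l2 w y)"
    using int by (simp add: set_integral_add)
  have "(LINT y:r|lebesgue. rep_l2 (scale_l2 c u) y) = (LINT y:r|lebesgue. c * rep_l2 u y)"
    unfolding set_lebesgue_integral_def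
  proof (rule integral_cong_AE)
    show "AE y in lebesgue. indicator r y *\<^sub>R rep_l2 (scale_l2 c u) y = indicator r y *\<^sub>R (c * rep_l2 u y)"
      using rep_l2_scale[of c u] by eventually_elim simp
  qed measurable
  then show "(LINT y:r|lebesgue. rep_l2 (scale_l2 c u) y) = c * (LINT y:r|lebesgue. rep_l2 u y)"
    by simp
qed

lemma ref_squares_finite:
  assumes "r \<in> ref_squares"
  shows "r \<in> sets lebesgue" "emeasure lebesgue r < \<infinity>"
  using assms unfolding ref_squares_def ref_def by (auto simp: square_sets emeasure_square simp del:
      emeasure_completion)

lemma form_E_nonneg:
  assumes V: "AE x in lebesgue. 0 \<le> V x" and u: "u \<in> dom_E V"
    and le: "(\<integral>\<^sup>+x. ennreal (V x) * (ennreal (norm (rep_l2 u x)))\<^sup>2 \<partial>lebesgue)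
       \<le> (\<integral>\<^sup>+x. (ennreal (sqrt (grad_sq u x)))\<^sup>2 \<partial>lebesgue)"
  shows "0 \<le> form_E V u"
proof -
  have int: "integrable lebesgue (\<lambda>x. V x * (norm (rep_l2 u x))\<^sup>2)" using u by (simp add: dom_E_def)
  have nonneg: "AE x in lebesgue. 0 \<le> V x * (norm (rep_l2 u x))\<^sup>2"
    using V by eventually_elim simp
  have "ennreal (\<integral>x. V x * (norm (rep_l2 u x))\<^sup>2 \<partial>lebesgue) = (\<integral>\<^sup>+x. ennreal (V x * (norm (rep_l2 u x))\<^sup>2) \<partial>lebesgue)"
    by (rule nn_integral_eq_integral[OF int nonneg, symmetric])
  also have "\<dots> = (\<integral>\<^sup>+x. ennreal (V x) * (ennreal (norm (rep_l2 u x)))\<^sup>2 \<partial>lebesgue)"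
    by (intro nn_integral_cong) (simp add: ennreal_mult'' ennreal_power)
  also have "\<dots> \<le> (\<integral>\<^sup>+x. (ennreal (sqrt (grad_sq u x)))\<^sup>2 \<partial>lebesgue)" by (rule le)
  also have "\<dots> = (\<integral>\<^sup>+x. ennreal (grad_sq u x) \<partial>lebesgue)"
    by (intro nn_integral_cong) (simp add: ennreal_power grad_sq_nonneg)
  also have "\<dots> = ennreal (\<integral>x. grad_sq u x \<partial>lebesgue)"
    by (intro nn_integral_eq_integral grad_sq_integrable) (simp add: grad_sq_nonneg)
  finally have "(\<integral>x. V x * (norm (rep_l2 u x))\<^sup>2 \<partial>lebesgue) \<le> (\<integral>x. grad_sq u x \<partial>lebesgue)"
    by (subst (asm) ennreal_le_iff) (auto intro: integral_nonneg_AE simp: grad_sq_nonneg)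
  then show ?thesis by (simp add: form_E_def grad_sq_def)
qed

section \<open>The bound for the index of the form\<close>

lemma N_minus_le:
  assumes [measurable]: "V \<in> borel_measurable lebesgue" and V: "AE x in lebesgue. 0 \<le> V x"
    and fin: "LlogL (\<lambda>x. ennreal (V x)) UNIV < top"
  shows "ennreal_of_enat (l2.N_minus (dom_E V) (form_E V)) \<le> 1 + 47239200 * LlogL (\<lambda>x. ennreal (V x)) UNIV"
proof -
  have "(\<lambda>x. ennreal (V x)) \<in> borel_measurable lebesgue" by measurable
  from finite_control[OF this fin] obtain G where G: "finite G" "G \<subseteq> ref_squares"
    "of_nat (card G) * threshold \<le> threshold + 30 * LlogL (\<lambda>x. ennreal (V x)) UNIV"
    "\<And>u f. grad_pair u f \<Longrightarrow> (\<forall>r\<in>G. (LINT y:r|lebesgue. u y) = 0) \<Longrightarrow>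
      (\<integral>\<^sup>+x. ennreal (V x) * (ennreal (norm (u x)))\<^sup>2 \<partial>lebesgue) \<le> (\<integral>\<^sup>+x. (f x)\<^sup>2 \<partial>lebesgue)" by blast
  have r: "r \<in> sets lebesgue" "emeasure lebesgue r < \<infinity>" if "r \<in> G" for r
    using ref_squares_finite G(2) that by blast+
  have "l2.N_minus (dom_E V) (form_E V) \<le> enat (card G)"
    unfolding l2.N_minus_def
  proof (rule SUP_least)
    fix L assume "L \<in> {L. l2.subspace L \<and> L \<subseteq> dom_E V \<and> (\<forall>u\<in>L - {0}. form_E V u < 0)}"
    then have L: "l2.subspace L" "L \<subseteq> dom_E V" "\<And>u. u \<in> L \<Longrightarrow> u \<noteq> 0 \<Longrightarrow> form_E V u < 0" by auto
    show "l2.edim L \<le> enat (card G)"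
    proof (rule l2.edim_le_card_functionals[where l = "\<lambda>r u. LINT y:r|lebesgue. rep_l2 u y"])
      fix u assume u: "u \<in> L" "\<And>r. r \<in> G \<Longrightarrow> (LINT y:r|lebesgue. rep_l2 u y) = 0"
      then have "u \<in> W12" "u \<in> dom_E V" using L(2) by (auto simp: dom_E_def)
      then have "0 \<le> form_E V u"
        using u(2) by (intro form_E_nonneg V G(4) grad_pair_rep_l2) auto
      with L(3)[OF u(1)] show "u = 0" by force
    qed (use G(1) L(1) r in \<open>auto intro: set_integral_rep_l2_linear\<close>)
  qed
  then have "ennreal_of_enat (l2.N_minus (dom_E V) (form_E V)) \<le> of_nat (card G)"
    by (cases "l2.N_minus (dom_E V) (form_E V)") auto
  also have "\<dots> \<le> 1 + 47239200 * LlogL (\<lambda>x. ennreal (V x)) UNIV"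
  proof -
    \<comment> \<open>1574640 is the reciprocal of \<open>threshold\<close>; 47239200 is 30 times
      that.\<close>
    have one: "1574640 * threshold = 1" unfolding threshold_def by (simp flip: ennreal_mult' ennreal_numeral)
    have "of_nat (card G) = 1574640 * (of_nat (card G) * threshold)"
      using one by (metis mult.left_commute mult.right_neutral)
    also have "\<dots> \<le> 1574640 * (threshold + 30 * LlogL (\<lambda>x. ennreal (V x)) UNIV)" by (intro mult_left_mono G(3)) simp
    also have "\<dots> = 1 + 47239200 * LlogL (\<lambda>x. ennreal (V x)) UNIV"
      by (simp add: distrib_left one mult.assoc[symmetric])
    finally show ?thesis .
  qed
  finally show ?thesis .
qed

theorem theorem4p3:
  shows "\<exists>C6::real. C6 > 0 \<and>
    (\<forall>(V :: real^2 \<Rightarrow> real) (Vs :: real \<Rightarrow> ennreal).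
       locally_integrable V \<longrightarrow> (AE x in lebesgue. V x \<ge> 0) \<longrightarrow> is_rearrangement V Vs \<longrightarrow>
       ennreal_of_enat (l2.N_minus (dom_E V) (form_E V))
         \<le> ennreal C6 *
             ((\<integral>\<^sup>+x. ennreal (V x * ln (2 + norm x)) \<partial>lebesgue)
              + (\<integral>\<^sup>+x. Vs (norm x) * ennreal (ln_plus (1 / norm x)) \<partial>(lebesgue :: (real^2) measure)))
           + 1)"
\<comment> \<open>12 * 47239200, the 12 coming from \<open>LlogL_UNIV_le\<close>.\<close>
proof (intro exI[of _ 566870400] conjI allI impI)
  fix V :: "real^2 \<Rightarrow> real" and Vs :: "real \<Rightarrow> ennreal"
  assume V: "locally_integrable V" "AE x in lebesgue. V x \<ge> 0" and R: "is_rearrangement V Vs"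
  have meas: "V \<in> borel_measurable lebesgue" by (rule locally_integrable_measurable[OF V(1)])
  let ?R = "(\<integral>\<^sup>+x. ennreal (V x * ln (2 + norm x)) \<partial>lebesgue)
    + (\<integral>\<^sup>+x. Vs (norm x) * ennreal (ln_plus (1 / norm x)) \<partial>(lebesgue :: (real^2) measure))"
  have LlogL: "LlogL (\<lambda>x. ennreal (V x)) UNIV \<le> 12 * ?R" by (rule LlogL_UNIV_le[OF meas R])
  show "ennreal_of_enat (l2.N_minus (dom_E V) (form_E V)) \<le> ennreal 566870400 * ?R + 1"
  proof (cases "?R = top")
    case True
    then show ?thesis by (simp only: ennreal_mult_top) simp
  next
    case False
    then have "12 * ?R < top" by (simp only: ennreal_mult_less_top less_top) simp
    with LlogL have "LlogL (\<lambda>x. ennreal (V x)) UNIV < top" by (rule le_less_trans)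
    from N_minus_le[OF meas V(2) this]
    have "ennreal_of_enat (l2.N_minus (dom_E V) (form_E V)) \<le> 1 + 47239200 * LlogL (\<lambda>x. ennreal (V x)) UNIV" .
    also have "\<dots> \<le> 1 + 47239200 * (12 * ?R)" by (intro add_left_mono mult_left_mono LlogL) simp
    also have "\<dots> = 566870400 * ?R + 1" by (simp only: mult.assoc[symmetric] add.commute) simp
    finally show ?thesis by simp
  qed
qed simp

end
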